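(* Let $d\ge3$, $M=S^{d-1}$ and $0<s\le\frac{d-1}{2}$. For $0<t<1$ the series \[ K_{s,t}(m,m')=\sum_{\ell=0}^\infty(1+\lambda_\ell^s)^{-1}t^\ell\,\Pi_\ell(m,m') \] converges, and for $m\ne m'$ the Abel limit $\lim_{t\uparrow1}K_{s,t}(m,m')$ exists and equals the distributional kernel $K_s(m,m')$ of $(1+\Delta^s)^{-1}$ on $L^2(S^{d-1},d\sigma)$; thus off the diagonal $K_s$ is a function, which is real analytic on $\{(m,m'):m\ne m'\}$. Moreover, as $m'\to m$, \[ |K_s(m,m')|=O(|m-m'|^{2s-d+1})\quad\text{if }2s<d-1,\qquad |K_s(m,m')|=O(|\log|m-m'||)\quad\text{if }2s=d-1. \]
   Context: $S^{d-1}\subset\mathbb R^d$ carries the induced metric and surface measure $d\sigma$; $\Delta$ is its nonnegative Laplace–Beltrami operator and $(1+\Delta^s)^{-1}$ is defined by spectral calculus. $\lambda_\ell=\ell(\ell+d-2)$ is the eigenvalue of $\Delta$ on the space $H_\ell$ of spherical harmonics of degree $\ell$, and $\Pi_\ell(m,m')=\sum_{k=1}^{d_\ell}f_{\ell,k}(m)f_{\ell,k}(m')=\frac{d_\ell}{\omega_d}B^\nu_\ell(\langle m,m'\rangle)$ is the kernel of the orthogonal projection onto $H_\ell$, where $\{f_{\ell,k}\}$ is a real orthonormal basis of $H_\ell$, $d_\ell=\dim H_\ell=(2\ell+d-2)\frac{\Gamma(\ell+d-2)}{\Gamma(d-1)\Gamma(\ell+1)}$, $\omega_d=2\pi^{d/2}/\Gamma(d/2)$,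 $\nu=\frac d2-1$, and $B^\nu_\ell=C^\nu_\ell/C^\nu_\ell(1)$ is the normalized Gegenbauer polynomial defined via $(1-2zt+t^2)^{-\nu}=\sum_\ell C^\nu_\ell(z)t^\ell$. $|m-m'|$ is the Euclidean distance in $\mathbb R^d$. *)

theory Defs
  imports "HOL-Analysis.Analysis" "HOL-Computational_Algebra.Formal_Power_Series"
    "HOL-Library.Landau_Symbols"
begin

text \<open>Gegenbauer polynomial C^nu_l(z): coefficient of t^l in (1 - 2 z t + t^2)^(-nu),
  i.e. (1+u)^(-nu) with u = -2 z t + t^2, as a formal power series in t.\<close>
definition gegenbauer :: "real \<Rightarrow> nat \<Rightarrow> real \<Rightarrow> real" where
  "gegenbauer \<nu> l z =
     fps_nth (fps_binomial (- \<nu>) oo (fps_const (- 2 * z) * fps_X + fps_X ^ 2)) l"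

definition gegenbauer_norm :: "real \<Rightarrow> nat \<Rightarrow> real \<Rightarrow> real" where
  "gegenbauer_norm \<nu> l z = gegenbauer \<nu> l z / gegenbauer \<nu> l 1"

definition harm_dim :: "nat \<Rightarrow> nat \<Rightarrow> real" where
  "harm_dim d l = (2 * real l + real d - 2) * Gamma (real l + real d - 2)
                    / (Gamma (real d - 1) * Gamma (real l + 1))"

definition sphere_area :: "nat \<Rightarrow> real" where
  "sphere_area d = 2 * pi powr (real d / 2) / Gamma (real d / 2)"

definition sph_eigen :: "nat \<Rightarrow> nat \<Rightarrow> real" where
  "sph_eigen d l = real l * (real l + real d - 2)"

text \<open>Kernel of the orthogonal projection onto H_l, on S^(d-1) with d = CARD('n).\<close>
definition proj_kernel :: "nat \<Rightarrow> real^'n \<Rightarrow> real^'n \<Rightarrow> real" where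
  "proj_kernel l m m' =
     harm_dim CARD('n) l / sphere_area CARD('n)
       * gegenbauer_norm (real CARD('n) / 2 - 1) l (m \<bullet> m')"

definition Kst_term :: "real \<Rightarrow> real \<Rightarrow> real^'n \<Rightarrow> real^'n \<Rightarrow> nat \<Rightarrow> real" where
  "Kst_term s t m m' l =
     inverse (1 + sph_eigen CARD('n) l powr s) * t ^ l * proj_kernel l m m'"

definition Kst :: "real \<Rightarrow> real \<Rightarrow> real^'n \<Rightarrow> real^'n \<Rightarrow> real" where
  "Kst s t m m' = (\<Sum>l. Kst_term s t m m' l)"

text \<open>Integral over S^(d-1) w.r.t. surface measure d sigma, via the cone formula
  int_S f dsigma = d * int_{|x|<1} f(x/|x|) dx.\<close>
definition sphere_integral :: "(real^'n \<Rightarrow> real) \<Rightarrow> real" where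
  "sphere_integral f =
     real CARD('n) * (LINT x : ball 0 1 | lborel. f (x /\<^sub>R norm x))"

definition sphere_support :: "(real^'n \<Rightarrow> real) \<Rightarrow> (real^'n) set" where
  "sphere_support f = closure {x \<in> sphere 0 1. f x \<noteq> 0}"

text \<open>Real analyticity at a point of a Euclidean space: locally the sum of an
  (unconditionally = absolutely) convergent multivariate power series.\<close>
definition real_analytic_at :: "('a::euclidean_space \<Rightarrow> real) \<Rightarrow> 'a \<Rightarrow> bool" where
  "real_analytic_at F p \<longleftrightarrow>
     (\<exists>r>0. \<exists>c :: ('a \<Rightarrow> nat) \<Rightarrow> real. \<forall>x\<in>ball p r.
        ((\<lambda>\<alpha>. c \<alpha> * (\<Prod>b\<in>Basis. ((x - p) \<bullet> b) ^ \<alpha> b)) has_sum F x)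
          (Basis \<rightarrow>\<^sub>E (UNIV :: nat set)))"

end

theory Submission
  imports Defs
begin

text \<open>
  Write \<open>\<nu> = d / 2 - 1\<close>. The projection kernels are \<open>\<kappa> (l + \<nu>) C\<^sub>l(z)\<close> with \<open>z = \<langle>m, m'\<rangle>\<close> and a constant \<open>\<kappa>\<close>,
  and \<open>\<Sum>l. (l + \<nu>) C\<^sub>l(z) r\<^sup>l\<close> is the Poisson kernel \<open>\<nu> (1 - r\<^sup>2) (1 - 2 r z + r\<^sup>2) powr - (\<nu> + 1)\<close>.
  Since \<open>\<lambda>\<^sub>l = (l + \<nu>)\<^sup>2 - \<nu>\<^sup>2\<close>, expanding \<open>1 / (1 + \<lambda>\<^sub>l\<^sup>s)\<close> first in powers of \<open>\<lambda>\<^sub>l powr - s\<close> and then in powers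
  of \<open>1 / (l + \<nu>)\<close> exhibits it, for \<open>l \<ge> 1\<close>, as a Laplace transform \<open>\<integral> \<psi>(u) exp (- l u) du\<close> with
  \<open>\<psi>(u) = O(u powr (2 s - 1))\<close> at \<open>0\<close>. Hence the kernel is, up to the term \<open>l = 0\<close>, the integral of the Poisson
  kernel at \<open>r = t exp (- u)\<close> against \<open>\<psi>\<close>. For \<open>z < 1\<close> dominated convergence gives the Abel limit, expanding
  the Poisson kernel at \<open>z\<^sub>0\<close> under the integral gives analyticity, and splitting the integral at
  \<open>u = |m - m'|\<close> gives the bounds near the diagonal.

  To identify the limit with the operator kernel, the series of pairings must converge, not only
  be Abel summable. The zonal kernels are reproducing kernels for the Fischer inner product and thus
  positive semidefinite; the mass of the (positive) Poisson kernel is bounded, so the series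
  \<open>\<Sum>l. \<langle>f, \<Pi>\<^sub>l f\<rangle>\<close> converges, and by Cauchy-Schwarz so does \<open>\<Sum>l. \<langle>g, \<Pi>\<^sub>l f\<rangle>\<close>, absolutely.
\<close>

section \<open>Gegenbauer polynomials\<close>

text \<open>The degree \<open>l = 0\<close> stands apart because its eigenvalue is \<open>0\<close>,
  where a series in powers of \<open>\<lambda> powr - s\<close> has no meaning; for
  \<open>l \<ge> 1\<close> the eigenvalue \<open>l (l + 2 \<nu>)\<close> exceeds \<open>1\<close>,
  and absolute convergence at \<open>l = 1\<close> serves all degrees. Without \<open>l = 0\<close>
  the Poisson sum also vanishes linearly at \<open>r = 0\<close>, as it must, since only
  \<open>\<psi>(u) exp (- u)\<close>, not \<open>\<psi>\<close>, is known to be integrable. Near the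
  diagonal, with \<open>\<rho> = |m - m'|\<close>, the Poisson kernel at
  \<open>r = exp (- u)\<close> is at most a constant times
  \<open>u * (max u \<rho>) powr - (2 \<nu> + 2)\<close> for small \<open>u\<close>, so the
  integrand is at most of order \<open>u powr (2 s) * (max u \<rho>) powr - (2 \<nu> + 2)\<close>.
  Integration yields the exponent \<open>2 s - 2 \<nu> - 1 = 2 s - d + 1\<close>, and a logarithm
  when it is zero. Spaces of spherical harmonics are never built: positivity of the zonal kernels
  and the bound \<open>|C\<^sub>l(z)| \<le> C\<^sub>l(1)\<close> both come from the finite-rank form
  that the Fischer product gives to \<open>C\<^sub>l\<close>.\<close>

lemma gegenbauer_ode:
  fixes \<nu> z :: real
  defines "G \<equiv> Abs_fps (\<lambda>l. gegenbauer \<nu> l z)"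
  shows "(1 + (fps_const (- 2 * z) * fps_X + fps_X ^ 2)) * fps_deriv G
           = fps_const (- \<nu>) * G * (fps_const (- 2 * z) + 2 * fps_X)"
proof -
  define u :: "real fps" where "u = fps_const (- 2 * z) * fps_X + fps_X ^ 2"
  define B where "B = fps_binomial (- \<nu>)"
  have G: "G = B oo u"
    by (simp add: G_def B_def u_def gegenbauer_def fps_eq_iff)
  have u0: "fps_nth u 0 = 0" by (simp add: u_def)
  \<comment> \<open>The binomial series \<open>B\<close> satisfies
    \<open>(1 + X) B' = - \<nu> B\<close>; composing with \<open>u\<close> and the chain rule carry
    this over to \<open>G\<close>.\<close>
  have "(1 + fps_X) * fps_deriv B = fps_const (-\<nu>) * B"
    unfolding B_def by (subst fps_binomial_deriv) (simp add: fps_divide_unit inverse_mult_eq_1' mult.left_commute)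
  then have "((1 + fps_X) * fps_deriv B) oo u = (fps_const (-\<nu>) * B) oo u" by simp
  then have "(1 + u) * (fps_deriv B oo u) = fps_const (-\<nu>) * G"
    by (simp add: fps_compose_mult_distrib[OF u0] fps_compose_add_distrib fps_X_fps_compose_startby0[OF u0] G)
  moreover have "fps_deriv G = (fps_deriv B oo u) * fps_deriv u"
    unfolding G by (rule fps_compose_deriv[OF u0])
  moreover have "fps_deriv u = fps_const (- 2 * z) + 2 * fps_X"
    by (simp add: u_def fps_deriv_power numeral_2_eq_2)
  ultimately show ?thesis unfolding u_def by (metis mult.assoc)
qed

lemma gegenbauer_0 [simp]: "gegenbauer \<nu> 0 z = 1"
  by (simp add: gegenbauer_def)

lemma gegenbauer_1: "gegenbauer \<nu> (Suc 0) z = 2 * \<nu> * z"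
proof -
  have "fps_nth ((1 + (fps_const (- 2 * z) * fps_X + fps_X ^ 2)) * fps_deriv (Abs_fps (\<lambda>l. gegenbauer \<nu> l z))) 0
     = fps_nth (fps_const (- \<nu>) * Abs_fps (\<lambda>l. gegenbauer \<nu> l z) * (fps_const (- 2 * z) + 2 * fps_X)) 0"
    by (simp only: gegenbauer_ode)
  then show ?thesis by (simp add: fps_mult_nth)
qed

text \<open>Compares the coefficients of \<open>t ^ (n + 1)\<close> in
  \<open>gegenbauer_ode\<close>. The recursion of \<open>zonal\<close> is modelled on it.\<close>

lemma gegenbauer_recurrence:
  "real (n + 2) * gegenbauer \<nu> (n + 2) z
     = 2 * (real n + 1 + \<nu>) * z * gegenbauer \<nu> (n + 1) z - (real n + 2 * \<nu>) * gegenbauer \<nu> n z"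
proof -
  define G where "G = Abs_fps (\<lambda>l. gegenbauer \<nu> l z)"
  have L: "(1 + (fps_const (- 2 * z) * fps_X + fps_X ^ 2)) * fps_deriv G
     = fps_deriv G - fps_const (2 * z) * (fps_X * fps_deriv G) + fps_X * (fps_X * fps_deriv G)"
    by (simp add: algebra_simps power2_eq_square flip: fps_const_neg)
  have R: "fps_const (- \<nu>) * G * (fps_const (- 2 * z) + 2 * fps_X)
     = fps_const (2 * \<nu> * z) * G - fps_const (2 * \<nu>) * (fps_X * G)"
  proof -
    have "(2::real fps) = fps_const 2" by (simp add: numeral_fps_const)
    then show ?thesis
      by (simp only: fps_const_neg[symmetric] fps_const_mult[symmetric] minus_mult_left[symmetric])
         (simp add: algebra_simps flip: fps_const_mult)
  qed
  have "fps_nth (fps_deriv G - fps_const (2 * z) * (fps_X * fps_deriv G) + fps_X * (fps_X * fps_deriv G)) (n + 1)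
     = fps_nth (fps_const (2 * \<nu> * z) * G - fps_const (2 * \<nu>) * (fps_X * G)) (n + 1)"
    using gegenbauer_ode[of z \<nu>] unfolding G_def[symmetric] L R by simp
  then show ?thesis
    by (cases n) (simp_all add: G_def algebra_simps)
qed

text \<open>At \<open>z = 1\<close> the generating function is
  \<open>(1 - t) powr (- 2 \<nu>)\<close>; the proof checks its coefficients against the
  recurrence.\<close>

lemma gegenbauer_at_1: "gegenbauer \<nu> n 1 = pochhammer (2 * \<nu>) n / fact n"
proof (induction n rule: induct_nat_012)
  case (ge2 n)
  have f: "(fact (Suc (Suc n)) :: real) = (real n + 2) * ((real n + 1) * fact n)"
    by (simp add: algebra_simps)
  have "real (n + 2) * gegenbauer \<nu> (n + 2) 1
     = 2 * (real n + 1 + \<nu>) * (pochhammer (2 * \<nu>) n * (2 * \<nu> + real n) / ((real n + 1) * fact n)) 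
      - (real n + 2 * \<nu>) * (pochhammer (2 * \<nu>) n / fact n)"
    using gegenbauer_recurrence[of n \<nu> 1] ge2 by (simp add: pochhammer_Suc)
  also have "\<dots> = real (n + 2) * (pochhammer (2 * \<nu>) (n + 2) / fact (n + 2))"
  proof -
    define m F P where "m = real n" and "F = (fact n :: real)" and "P = pochhammer (2 * \<nu>) n"
    have "m + 1 \<noteq> 0" "m + 2 \<noteq> 0" "F \<noteq> 0" by (simp_all add: m_def F_def)
    then have "2 * (m + 1 + \<nu>) * (P * (2 * \<nu> + m) / ((m + 1) * F)) - (m + 2 * \<nu>) * (P / F)
        = (m + 2) * (P * (2 * \<nu> + m) * (2 * \<nu> + (m + 1)) / ((m + 2) * ((m + 1) * F)))"
      by (simp add: divide_simps) (simp add: algebra_simps)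
    then show ?thesis
      using f by (simp add: pochhammer_Suc m_def F_def P_def add.commute)
  qed
  finally show ?case by (simp only: mult_cancel_left of_nat_eq_0_iff) simp
qed (simp_all add: gegenbauer_1)

section \<open>The Fischer inner product\<close>

text \<open>A polynomial on \<open>real ^ 'n\<close> is represented by its coefficient function on multi-indices.
  Multiplication by a coordinate is adjoint to the partial derivative, so the harmonic
  polynomials of degree n form the orthogonal complement of the multiples of the squared norm.\<close>

definition mono_mult :: "'n \<Rightarrow> (('n \<Rightarrow> nat) \<Rightarrow> real) \<Rightarrow> ('n \<Rightarrow> nat) \<Rightarrow> real" where
  "mono_mult i p \<alpha> = (if \<alpha> i = 0 then 0 else p (\<alpha>(i := \<alpha> i - 1)))"

definition mono_diff :: "'n \<Rightarrow> (('n \<Rightarrow> nat) \<Rightarrow> real) \<Rightarrow> ('n \<Rightarrow> nat) \<Rightarrow> real" where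
  "mono_diff i p \<alpha> = real (\<alpha> i + 1) * p (\<alpha>(i := \<alpha> i + 1))"

definition lin_mult :: "real ^ 'n \<Rightarrow> (('n::finite \<Rightarrow> nat) \<Rightarrow> real) \<Rightarrow> ('n \<Rightarrow> nat) \<Rightarrow> real" where
  "lin_mult y p \<alpha> = (\<Sum>i\<in>UNIV. y $ i * mono_mult i p \<alpha>)"

definition dir_diff :: "real ^ 'n \<Rightarrow> (('n::finite \<Rightarrow> nat) \<Rightarrow> real) \<Rightarrow> ('n \<Rightarrow> nat) \<Rightarrow> real" where
  "dir_diff y p \<alpha> = (\<Sum>i\<in>UNIV. y $ i * mono_diff i p \<alpha>)"

definition sq_mult :: "(('n::finite \<Rightarrow> nat) \<Rightarrow> real) \<Rightarrow> ('n \<Rightarrow> nat) \<Rightarrow> real" where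
  "sq_mult p \<alpha> = (\<Sum>i\<in>UNIV. mono_mult i (mono_mult i p) \<alpha>)"

definition mono_lap :: "(('n::finite \<Rightarrow> nat) \<Rightarrow> real) \<Rightarrow> ('n \<Rightarrow> nat) \<Rightarrow> real" where
  "mono_lap p \<alpha> = (\<Sum>i\<in>UNIV. mono_diff i (mono_diff i p) \<alpha>)"

section \<open>Commutation relations between multiplications and derivatives\<close>

lemma mono_diff_mult:
  "mono_diff i (mono_mult j p) \<alpha> = mono_mult j (mono_diff i p) \<alpha> + (if i = j then p \<alpha> else 0)"
  by (cases "i = j"; cases "\<alpha> i")
     (auto simp: mono_diff_def mono_mult_def fun_upd_twist algebra_simps fun_upd_idem)

lemma mono_diff_commute: "mono_diff i (mono_diff j p) \<alpha> = mono_diff j (mono_diff i p) \<alpha>"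
  by (cases "i = j") (auto simp: mono_diff_def fun_upd_twist)

lemma mono_linear:
  "mono_mult i (\<lambda>\<alpha>. a * p \<alpha> + b * q \<alpha>) \<alpha> = a * mono_mult i p \<alpha> + b * mono_mult i q \<alpha>"
  "mono_diff i (\<lambda>\<alpha>. a * p \<alpha> + b * q \<alpha>) \<alpha> = a * mono_diff i p \<alpha> + b * mono_diff i q \<alpha>"
  "mono_mult i (\<lambda>\<alpha>. \<Sum>j\<in>A. c j * P j \<alpha>) \<alpha> = (\<Sum>j\<in>A. c j * mono_mult i (P j) \<alpha>)"
  "mono_diff i (\<lambda>\<alpha>. \<Sum>j\<in>A. c j * P j \<alpha>) \<alpha> = (\<Sum>j\<in>A. c j * mono_diff i (P j) \<alpha>)"
  by (auto simp: mono_mult_def mono_diff_def algebra_simps sum_distrib_left)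

lemmas fischer_defs = lin_mult_def dir_diff_def sq_mult_def mono_lap_def

lemma dir_diff_lin_mult:
  "dir_diff x (lin_mult y p) \<alpha> = lin_mult y (dir_diff x p) \<alpha> + (x \<bullet> y) * p \<alpha>"
proof -
  have "dir_diff x (lin_mult y p) \<alpha> = (\<Sum>i\<in>UNIV. \<Sum>j\<in>UNIV. x $ i * (y $ j * mono_diff i (mono_mult j p) \<alpha>))"
    by (simp add: dir_diff_def lin_mult_def[abs_def] mono_linear sum_distrib_left)
  also have "\<dots> = (\<Sum>i\<in>UNIV. \<Sum>j\<in>UNIV. x $ i * (y $ j * mono_mult j (mono_diff i p) \<alpha>))
      + (\<Sum>i\<in>UNIV. \<Sum>j\<in>UNIV. x $ i * (y $ j * (if i = j then p \<alpha> else 0)))"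
    by (simp only: mono_diff_mult sum.distrib distrib_left)
  also have "(\<Sum>i\<in>UNIV. \<Sum>j\<in>UNIV. x $ i * (y $ j * (if i = j then p \<alpha> else 0))) = (x \<bullet> y) * p \<alpha>"
    by (simp add: inner_vec_def sum_distrib_right if_distrib cong: if_cong)
       (simp add: mult.assoc)
  also have "(\<Sum>i\<in>UNIV. \<Sum>j\<in>UNIV. x $ i * (y $ j * mono_mult j (mono_diff i p) \<alpha>)) = lin_mult y (dir_diff x p) \<alpha>"
    by (subst sum.swap)
       (simp add: dir_diff_def[abs_def] lin_mult_def mono_linear sum_distrib_left mult.left_commute)
  finally show ?thesis .
qed

lemma mono_diff_sq_mult:
  "mono_diff i (sq_mult p) \<alpha> = sq_mult (mono_diff i p) \<alpha> + 2 * mono_mult i p \<alpha>"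
proof -
  have m: "mono_diff i (mono_mult j p) = (\<lambda>\<alpha>. 1 * mono_mult j (mono_diff i p) \<alpha> + (if i = j then 1 else 0) * p \<alpha>)" for j p
    by (rule ext) (simp add: mono_diff_mult)
  have "mono_diff i (sq_mult p) \<alpha> = (\<Sum>j\<in>UNIV. mono_diff i (mono_mult j (mono_mult j p)) \<alpha>)"
    using mono_linear(4)[of i "\<lambda>_. 1" "\<lambda>j. mono_mult j (mono_mult j p)" UNIV \<alpha>]
    by (simp add: sq_mult_def[abs_def])
  also have "\<dots> = (\<Sum>j\<in>UNIV. mono_mult j (mono_mult j (mono_diff i p)) \<alpha> + 2 * ((if i = j then 1 else 0) * mono_mult j p \<alpha>))"
    by (intro sum.cong refl) (simp only: m mono_linear, simp)
  also have "\<dots> = sq_mult (mono_diff i p) \<alpha> + 2 * mono_mult i p \<alpha>"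
    by (simp add: sum.distrib sq_mult_def if_distrib[of "\<lambda>x. x * _"] flip: sum_distrib_left cong: if_cong)
  finally show ?thesis .
qed

lemma mono_diff_lin_mult:
  "mono_diff i (lin_mult y p) \<alpha> = lin_mult y (mono_diff i p) \<alpha> + y $ i * p \<alpha>"
  by (simp add: lin_mult_def[abs_def] mono_linear mono_diff_mult distrib_left sum.distrib
        if_distrib[of "\<lambda>x. _ * x"] cong: if_cong)

lemma lin_mult_linear:
  "lin_mult y (\<lambda>\<alpha>. a * p \<alpha> + b * q \<alpha>) \<alpha> = a * lin_mult y p \<alpha> + b * lin_mult y q \<alpha>"
  "dir_diff y (\<lambda>\<alpha>. a * p \<alpha> + b * q \<alpha>) \<alpha> = a * dir_diff y p \<alpha> + b * dir_diff y q \<alpha>"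
  by (simp_all add: lin_mult_def dir_diff_def mono_linear sum.distrib sum_distrib_left algebra_simps)

lemma sq_mult_linear:
  "sq_mult (\<lambda>\<alpha>. a * p \<alpha> + b * q \<alpha>) \<alpha> = a * sq_mult p \<alpha> + b * sq_mult q \<alpha>"
  "mono_lap (\<lambda>\<alpha>. a * p \<alpha> + b * q \<alpha>) \<alpha> = a * mono_lap p \<alpha> + b * mono_lap q \<alpha>"
  by (simp_all add: sq_mult_def mono_lap_def mono_linear[abs_def] sum.distrib sum_distrib_left)

lemma dir_diff_sq_mult:
  "dir_diff y (sq_mult p) \<alpha> = sq_mult (dir_diff y p) \<alpha> + 2 * lin_mult y p \<alpha>"
proof -
  have "sq_mult (dir_diff y p) \<alpha> = (\<Sum>j\<in>UNIV. \<Sum>i\<in>UNIV. y $ i * mono_mult j (mono_mult j (mono_diff i p)) \<alpha>)"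
    by (simp add: sq_mult_def dir_diff_def[abs_def] mono_linear(3)[abs_def])
  also have "\<dots> = (\<Sum>i\<in>UNIV. y $ i * sq_mult (mono_diff i p) \<alpha>)"
    by (subst sum.swap) (simp add: sq_mult_def sum_distrib_left)
  finally show ?thesis
    by (simp add: dir_diff_def mono_diff_sq_mult lin_mult_def distrib_left sum.distrib sum_distrib_left mult.left_commute)
qed

lemma mono_lap_lin_mult:
  "mono_lap (lin_mult y p) \<alpha> = lin_mult y (mono_lap p) \<alpha> + 2 * dir_diff y p \<alpha>"
proof -
  have m: "mono_diff i (lin_mult y p) = (\<lambda>\<alpha>. 1 * lin_mult y (mono_diff i p) \<alpha> + y $ i * p \<alpha>)" for i p
    by (rule ext) (simp add: mono_diff_lin_mult)
  have "mono_diff i (mono_diff i (lin_mult y p)) \<alpha>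
     = lin_mult y (mono_diff i (mono_diff i p)) \<alpha> + 2 * (y $ i * mono_diff i p \<alpha>)" for i
    by (simp only: m mono_linear, simp)
  moreover have "(\<Sum>i\<in>UNIV. lin_mult y (mono_diff i (mono_diff i p)) \<alpha>) = lin_mult y (mono_lap p) \<alpha>"
    using mono_linear(3)[of _ "\<lambda>_. 1" "\<lambda>j. mono_diff j (mono_diff j p)" UNIV \<alpha>]
    by (subst (2) lin_mult_def) (simp add: mono_lap_def[abs_def] lin_mult_def sum_distrib_left, rule sum.swap)
  ultimately show ?thesis
    by (simp add: mono_lap_def[of "lin_mult y p"] sum.distrib dir_diff_def sum_distrib_left)
qed

lemma mono_mult_diff: "mono_mult i (mono_diff i p) \<alpha> = real (\<alpha> i) * p \<alpha>"
  by (cases "\<alpha> i") (auto simp: mono_mult_def mono_diff_def fun_upd_idem)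

text \<open>On coefficient functions the Euler operator is multiplication by the total degree of
  \<open>\<alpha>\<close>. It arises from \<open>mono_mult_diff\<close>, and the dimension from
  summing the remaining constant over all coordinates.\<close>

lemma mono_lap_sq_mult:
  fixes p :: "('n::finite \<Rightarrow> nat) \<Rightarrow> real"
  shows "mono_lap (sq_mult p) \<alpha>
    = sq_mult (mono_lap p) \<alpha> + (4 * real (\<Sum>i\<in>UNIV. \<alpha> i) + 2 * real CARD('n)) * p \<alpha>"
proof -
  have m: "mono_diff i (sq_mult p) = (\<lambda>\<alpha>. 1 * sq_mult (mono_diff i p) \<alpha> + 2 * mono_mult i p \<alpha>)" for i and p :: "('n \<Rightarrow> nat) \<Rightarrow> real"
    by (rule ext) (simp add: mono_diff_sq_mult)
  have "mono_diff i (mono_diff i (sq_mult p)) \<alpha>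
     = sq_mult (mono_diff i (mono_diff i p)) \<alpha> + (4 * (real (\<alpha> i) * p \<alpha>) + 2 * p \<alpha>)" for i
    by (simp only: m mono_linear mono_diff_mult mono_mult_diff, simp)
  moreover have "(\<Sum>i\<in>UNIV. sq_mult (mono_diff i (mono_diff i p)) \<alpha>) = sq_mult (mono_lap p) \<alpha>"
    using mono_linear(3)[of _ "\<lambda>_. 1" "\<lambda>j. mono_diff j (mono_diff j p)" UNIV, abs_def]
      mono_linear(3)[of _ "\<lambda>_. 1" "\<lambda>j. mono_mult i (mono_diff j (mono_diff j p))" UNIV for i]
    by (subst (2) sq_mult_def) (simp add: mono_lap_def[abs_def] sq_mult_def, rule sum.swap)
  ultimately show ?thesis
    by (simp add: mono_lap_def[of "sq_mult p"] sum.distrib distrib_right flip: sum_distrib_left sum_distrib_right)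
qed

lemma mono_lap_dir_diff: "mono_lap (dir_diff y p) \<alpha> = dir_diff y (mono_lap p) \<alpha>"
proof -
  have c: "mono_diff i (mono_diff j p) = mono_diff j (mono_diff i p)" for i j and p :: "('n::finite \<Rightarrow> nat) \<Rightarrow> real"
    by (rule ext) (rule mono_diff_commute)
  have "mono_lap (dir_diff y p) \<alpha> = (\<Sum>i\<in>UNIV. \<Sum>j\<in>UNIV. y $ j * mono_diff i (mono_diff i (mono_diff j p)) \<alpha>)"
    by (simp add: mono_lap_def dir_diff_def[abs_def] mono_linear(4)[abs_def])
  also have "\<dots> = (\<Sum>j\<in>UNIV. y $ j * (\<Sum>i\<in>UNIV. mono_diff j (mono_diff i (mono_diff i p)) \<alpha>))"
    by (subst sum.swap) (simp add: sum_distrib_left c)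
  also have "\<dots> = dir_diff y (mono_lap p) \<alpha>"
    using mono_linear(4)[of _ "\<lambda>_. 1" "\<lambda>j. mono_diff j (mono_diff j p)" UNIV \<alpha>]
    by (simp add: dir_diff_def mono_lap_def[abs_def])
  finally show ?thesis .
qed

subsection \<open>Zonal harmonics\<close>

text \<open>For a unit vector \<open>y\<close> this is the homogenized Gegenbauer polynomial
  \<open>|x| ^ n * C(<x, y> / |x|)\<close> as a polynomial in \<open>x\<close>: in the three-term
  recurrence, \<open>z\<close> becomes \<open>lin_mult y\<close>, and a factor
  \<open>|x| ^ 2\<close> restores homogeneity in the last term.\<close>

fun zonal :: "real \<Rightarrow> real ^ 'n \<Rightarrow> nat \<Rightarrow> ('n::finite \<Rightarrow> nat) \<Rightarrow> real" where
  "zonal \<nu> y 0 = (\<lambda>\<alpha>. if \<alpha> = (\<lambda>_. 0) then 1 else 0)"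
| "zonal \<nu> y (Suc 0) = (\<lambda>\<alpha>. 2 * \<nu> * lin_mult y (zonal \<nu> y 0) \<alpha>)"
| "zonal \<nu> y (Suc (Suc n)) =
     (\<lambda>\<alpha>. 2 * (real n + 1 + \<nu>) / (real n + 2) * lin_mult y (zonal \<nu> y (Suc n)) \<alpha>
        + - (real n + 2 * \<nu>) / (real n + 2) * sq_mult (zonal \<nu> y n) \<alpha>)"

lemma mono_mult_homogeneous:
  assumes "\<And>\<alpha>. (\<Sum>i\<in>UNIV. \<alpha> i) \<noteq> n \<Longrightarrow> p \<alpha> = 0" "(\<Sum>i\<in>UNIV. \<alpha> i) \<noteq> Suc n"
  shows "mono_mult (j::'n::finite) p \<alpha> = 0"
proof (cases "\<alpha> j")
  case (Suc k)
  have "(\<Sum>i\<in>UNIV. \<alpha> i) = \<alpha> j + (\<Sum>i\<in>UNIV - {j}. \<alpha> i)"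
    "(\<Sum>i\<in>UNIV. (\<alpha>(j := k)) i) = k + (\<Sum>i\<in>UNIV - {j}. (\<alpha>(j := k)) i)"
    by (subst sum.remove[of _ j]; simp)+
  moreover have "(\<Sum>i\<in>UNIV - {j}. (\<alpha>(j := k)) i) = (\<Sum>i\<in>UNIV - {j}. \<alpha> i)"
    by (rule sum.cong) auto
  ultimately have "(\<Sum>i\<in>UNIV. (\<alpha>(j := k)) i) \<noteq> n" using assms(2) Suc by simp
  then show ?thesis using assms(1) Suc by (simp add: mono_mult_def)
qed (simp add: mono_mult_def)

lemma zonal_homogeneous: "(\<Sum>i\<in>UNIV. \<alpha> i) \<noteq> n \<Longrightarrow> zonal \<nu> y n \<alpha> = 0"
proof (induction n arbitrary: \<alpha> rule: induct_nat_012)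
  case 0
  then show ?case by auto
next
  case 1
  have "mono_mult i (zonal \<nu> y 0) \<alpha> = 0" for i
    by (rule mono_mult_homogeneous[of 0]) (use 1 in auto)
  then show ?case by (simp add: lin_mult_def mono_mult_homogeneous[of 0] del: zonal.simps(1))
next
  case (ge2 n)
  have "mono_mult i (zonal \<nu> y (Suc n)) \<alpha> = 0" for i
    by (rule mono_mult_homogeneous[of "Suc n"]) (use ge2 in auto)
  moreover have "mono_mult i (mono_mult i (zonal \<nu> y n)) \<alpha> = 0" for i
    by (rule mono_mult_homogeneous[of "Suc n"], rule mono_mult_homogeneous[of n]) (use ge2 in auto)
  ultimately show ?case by (simp add: lin_mult_def sq_mult_def)
qed



lemma mult_divide_combination:
  "(c::real) \<noteq> 0 \<Longrightarrow> c * (a / c * x + - b / c * y) = a * x - b * y"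
  by (simp add: field_simps)

lemma fischer_scale:
  "lin_mult y (\<lambda>\<alpha>. a * p \<alpha>) \<alpha> = a * lin_mult y p \<alpha>"
  "dir_diff y (\<lambda>\<alpha>. a * p \<alpha>) \<alpha> = a * dir_diff y p \<alpha>"
  "sq_mult (\<lambda>\<alpha>. a * p \<alpha>) \<alpha> = a * sq_mult p \<alpha>"
  "mono_lap (\<lambda>\<alpha>. a * p \<alpha>) \<alpha> = a * mono_lap p \<alpha>"
  using lin_mult_linear[of y a p 0 p \<alpha>] sq_mult_linear[of a p 0 p \<alpha>] by simp_all

lemma fischer_zero:
  "lin_mult y (\<lambda>\<alpha>. 0) \<alpha> = 0" "dir_diff y (\<lambda>\<alpha>. 0) \<alpha> = 0"
  "sq_mult (\<lambda>\<alpha>. 0) \<alpha> = 0" "mono_lap (\<lambda>\<alpha>. 0) \<alpha> = 0"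
  by (simp_all add: fischer_defs mono_mult_def[abs_def] mono_diff_def[abs_def])

lemma mono_diff_zonal_0: "mono_diff i (zonal \<nu> y 0) = (\<lambda>\<alpha>. 0)"
proof
  fix \<alpha> :: "'a \<Rightarrow> nat"
  have "\<alpha>(i := Suc (\<alpha> i)) \<noteq> (\<lambda>_. 0)" by (metis fun_upd_same nat.distinct(1))
  then show "mono_diff i (zonal \<nu> y 0) \<alpha> = 0" by (simp add: mono_diff_def)
qed

lemma dir_diff_zonal_0: "dir_diff x (zonal \<nu> y 0) = (\<lambda>\<alpha>. 0)"
  by (rule ext) (simp add: dir_diff_def mono_diff_zonal_0 del: zonal.simps)

lemma mono_lap_zonal_0: "mono_lap (zonal \<nu> y 0) = (\<lambda>\<alpha>. 0)"
  by (rule ext, simp add: mono_lap_def mono_diff_zonal_0 del: zonal.simps) (simp add: mono_diff_def)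

text \<open>The derivative along the pole appears when the Laplacian meets \<open>lin_mult y\<close>
  in \<open>mono_lap_lin_mult\<close>. The identity corresponds to differentiating the homogenized
  generating function \<open>(1 - 2 t <x, y> + t ^ 2 |x| ^ 2) powr - \<nu>\<close> along
  \<open>y\<close>.\<close>

lemma dir_diff_zonal:
  fixes y :: "real ^ 'n"
  assumes y: "norm y = 1"
  shows "dir_diff y (zonal \<nu> y (Suc n)) = (\<lambda>\<alpha>. (real n + 2 * \<nu>) * zonal \<nu> y n \<alpha>)"
proof -
  have base: "dir_diff y (zonal \<nu> y (Suc 0)) = (\<lambda>\<alpha>. (real 0 + 2 * \<nu>) * zonal \<nu> y 0 \<alpha>)"
    using y by (auto simp: fun_eq_iff zonal.simps(2) fischer_scale dir_diff_lin_mult dir_diff_zonal_0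
          fischer_zero norm_eq_1 simp del: zonal.simps(1))
  show ?thesis
  proof (induction n rule: induct_nat_012)
    case 0
    show ?case by (rule base)
  next
    case 1
    have "dir_diff y (zonal \<nu> y (Suc (Suc 0))) \<alpha>
        = (1 + \<nu>) * (2 * \<nu> * lin_mult y (zonal \<nu> y 0) \<alpha> + zonal \<nu> y (Suc 0) \<alpha>) - \<nu> * (2 * lin_mult y (zonal \<nu> y 0) \<alpha>)" for \<alpha>
      unfolding zonal.simps(3) lin_mult_linear(2) dir_diff_lin_mult dir_diff_sq_mult base dir_diff_zonal_0
        fischer_zero fischer_scale using y by (simp add: norm_eq_1 del: zonal.simps)
    then show ?case by (simp add: fun_eq_iff algebra_simps del: zonal.simps(1,3))
  next
    case (ge2 n)
    show ?case
    proof
      fix \<alpha> :: "'n \<Rightarrow> nat"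
      \<comment> \<open>After the commutation relations and the induction hypotheses only these
        three values remain, and the recurrence defining \<open>Z\<close> ties them
        together.\<close>
      define L S Z where "L = lin_mult y (zonal \<nu> y (Suc n)) \<alpha>" and "S = sq_mult (zonal \<nu> y n) \<alpha>"
        and "Z = zonal \<nu> y (Suc (Suc n)) \<alpha>"
      define m where "m = real n"
      have m: "m + 2 \<noteq> 0" "m + 3 \<noteq> 0" "m \<ge> 0" by (simp_all add: m_def)
      have Z: "(m + 2) * Z = 2 * (m + 1 + \<nu>) * L - (m + 2 * \<nu>) * S"
        unfolding Z_def L_def S_def m_def zonal.simps(3) by (rule mult_divide_combination) simp
      have "dir_diff y (zonal \<nu> y (Suc (Suc (Suc n)))) \<alpha> =
         2 * (m + 2 + \<nu>) / (m + 3) * ((m + 1 + 2 * \<nu>) * L + Z)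
          + - (m + 1 + 2 * \<nu>) / (m + 3) * ((m + 2 * \<nu>) * S + 2 * L)"
        unfolding zonal.simps(3)[of \<nu> y "Suc n"] lin_mult_linear(2) dir_diff_lin_mult dir_diff_sq_mult ge2
          fischer_scale L_def S_def Z_def m_def using y by (simp add: norm_eq_1 add.commute del: zonal.simps)
      also have "\<dots> = ((m + 1 + 2 * \<nu>) * (2 * (m + 1 + \<nu>) * L - (m + 2 * \<nu>) * S) + 2 * (m + 2 + \<nu>) * Z) / (m + 3)"
        using m by (simp add: divide_simps) (simp add: algebra_simps)
      also have "\<dots> = (m + 2 + 2 * \<nu>) * Z"
        unfolding Z[symmetric] using m by (simp add: divide_simps) (simp add: algebra_simps)
      finally show "dir_diff y (zonal \<nu> y (Suc (Suc (Suc n)))) \<alpha> = (real (Suc (Suc n)) + 2 * \<nu>) * zonal \<nu> y (Suc (Suc n)) \<alpha>"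
        by (simp add: Z_def m_def add.commute del: zonal.simps)
    qed
  qed
qed

text \<open>In the recursion step the Laplacian of the \<open>lin_mult\<close> term leaves
  \<open>2 * dir_diff y\<close>, that of the \<open>sq_mult\<close> term leaves the degree factor
  \<open>4 n + 2 d\<close>. The two cancel because \<open>d = 2 \<nu> + 2\<close>.\<close>

lemma zonal_harmonic:
  fixes y :: "real ^ 'n"
  assumes y: "norm y = 1" and \<nu>: "\<nu> = real CARD('n) / 2 - 1"
  shows "mono_lap (zonal \<nu> y n) = (\<lambda>\<alpha>. 0)"
proof (induction n rule: induct_nat_012)
  case 0
  show ?case by (rule mono_lap_zonal_0)
next
  case 1
  show ?case
    unfolding zonal.simps(2) fun_eq_iff fischer_scale mono_lap_lin_mult mono_lap_zonal_0 dir_diff_zonal_0 fischer_zero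
    by simp
next
  case (ge2 n)
  show ?case
  proof
    fix \<alpha> :: "'n \<Rightarrow> nat"
    have E: "(4 * real (sum \<alpha> UNIV) + 2 * real CARD('n)) * zonal \<nu> y n \<alpha> = 4 * (real n + \<nu> + 1) * zonal \<nu> y n \<alpha>"
      using zonal_homogeneous[of \<alpha> n \<nu> y] by (cases "sum \<alpha> UNIV = n") (auto simp: \<nu>)
    show "mono_lap (zonal \<nu> y (Suc (Suc n))) \<alpha> = 0"
      unfolding zonal.simps(3) sq_mult_linear(2) mono_lap_lin_mult mono_lap_sq_mult ge2 fischer_zero
        dir_diff_zonal[OF y] E by (simp add: field_simps)
  qed
qed

subsection \<open>Evaluation and the reproducing property\<close>

text \<open>By Euler's identity, \<open>n\<close> directional derivatives along \<open>x\<close> yield \<open>n!\<close> times the value at \<open>x\<close>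
  of a homogeneous polynomial of degree \<open>n\<close>.\<close>
fun hom_eval :: "real ^ 'n \<Rightarrow> nat \<Rightarrow> (('n::finite \<Rightarrow> nat) \<Rightarrow> real) \<Rightarrow> real" where
  "hom_eval x 0 p = p (\<lambda>_. 0)"
| "hom_eval x (Suc n) p = hom_eval x n (dir_diff x p) / (real n + 1)"

lemma hom_eval_linear:
  "hom_eval x n (\<lambda>\<alpha>. a * p \<alpha> + b * q \<alpha>) = a * hom_eval x n p + b * hom_eval x n q"
proof (induction n arbitrary: p q)
  case (Suc n)
  have "dir_diff x (\<lambda>\<alpha>. a * p \<alpha> + b * q \<alpha>) = (\<lambda>\<alpha>. a * dir_diff x p \<alpha> + b * dir_diff x q \<alpha>)"
    by (rule ext) (rule lin_mult_linear)
  then show ?case by (simp add: Suc add_divide_distrib)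
qed simp

lemma hom_eval_lin_mult: "hom_eval x (Suc n) (lin_mult y p) = (x \<bullet> y) * hom_eval x n p"
proof (induction n arbitrary: p)
  case 0
  show ?case by (simp add: dir_diff_lin_mult) (simp add: lin_mult_def mono_mult_def)
next
  case (Suc n)
  have "dir_diff x (lin_mult y p) = (\<lambda>\<alpha>. 1 * lin_mult y (dir_diff x p) \<alpha> + (x \<bullet> y) * p \<alpha>)"
    by (rule ext) (simp add: dir_diff_lin_mult)
  then have "hom_eval x (Suc (Suc n)) (lin_mult y p)
     = hom_eval x (Suc n) (\<lambda>\<alpha>. 1 * lin_mult y (dir_diff x p) \<alpha> + (x \<bullet> y) * p \<alpha>) / (real (Suc n) + 1)"
    by (simp only: hom_eval.simps(2)[of x "Suc n"])
  also have "\<dots> = (x \<bullet> y) * (hom_eval x n (dir_diff x p) + hom_eval x (Suc n) p) / (real (Suc n) + 1)"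
    by (simp only: hom_eval_linear Suc) (simp add: algebra_simps)
  also have "hom_eval x n (dir_diff x p) = (real n + 1) * hom_eval x (Suc n) p" by simp
  also have "(x \<bullet> y) * ((real n + 1) * hom_eval x (Suc n) p + hom_eval x (Suc n) p) / (real (Suc n) + 1)
     = (x \<bullet> y) * hom_eval x (Suc n) p"
    by (simp add: divide_simps del: hom_eval.simps) (simp add: algebra_simps del: hom_eval.simps)
  finally show ?case .
qed

lemma hom_eval_sum: "finite A \<Longrightarrow> hom_eval x n (\<lambda>\<alpha>. \<Sum>i\<in>A. P i \<alpha>) = (\<Sum>i\<in>A. hom_eval x n (P i))"
proof (induction A rule: finite_induct)
  case empty
  then show ?case using hom_eval_linear[of x n 0 "\<lambda>_. 0" 0 "\<lambda>_. 0"] by simp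
next
  case (insert i A)
  then show ?case using hom_eval_linear[of x n 1 "P i" 1 "\<lambda>\<alpha>. \<Sum>i\<in>A. P i \<alpha>"] by simp
qed

lemma hom_eval_sq_mult: "hom_eval x (Suc (Suc n)) (sq_mult p) = (x \<bullet> x) * hom_eval x n p"
proof -
  have m: "mono_mult i = lin_mult (axis i 1)" for i :: 'a
    by (intro ext) (simp add: lin_mult_def axis_def if_distrib[of "\<lambda>x. x * _"] cong: if_cong)
  have "hom_eval x (Suc (Suc n)) (sq_mult p) = (\<Sum>i\<in>UNIV. (x $ i * (x $ i * hom_eval x n p)))"
    unfolding sq_mult_def[abs_def] m
    by (subst hom_eval_sum) (simp_all add: hom_eval_lin_mult inner_axis del: hom_eval.simps)
  then show ?thesis by (simp add: inner_vec_def sum_distrib_right mult.assoc)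
qed

text \<open>At a unit vector, evaluation turns \<open>lin_mult y\<close> into the factor
  \<open>x \<bullet> y\<close> and \<open>sq_mult\<close> into \<open>1\<close>, so the recursion of
  \<open>zonal\<close> becomes the Gegenbauer recurrence.\<close>

lemma hom_eval_zonal:
  assumes "norm x = 1"
  shows "hom_eval x n (zonal \<nu> y n) = gegenbauer \<nu> n (x \<bullet> y)"
proof (induction n rule: induct_nat_012)
  case 1
  have "hom_eval x (Suc 0) (\<lambda>\<alpha>. 2 * \<nu> * lin_mult y (zonal \<nu> y 0) \<alpha> + 0 * 0) = 2 * \<nu> * (x \<bullet> y)"
    by (simp only: hom_eval_linear[where q="\<lambda>_. 0"] hom_eval_lin_mult) simp
  then show ?case by (simp add: gegenbauer_1)
next
  case (ge2 n)
  have "hom_eval x (Suc (Suc n)) (zonal \<nu> y (Suc (Suc n))) =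
     2 * (real n + 1 + \<nu>) / (real n + 2) * ((x \<bullet> y) * gegenbauer \<nu> (Suc n) (x \<bullet> y))
      + - (real n + 2 * \<nu>) / (real n + 2) * gegenbauer \<nu> n (x \<bullet> y)"
    unfolding zonal.simps(3) hom_eval_linear hom_eval_lin_mult hom_eval_sq_mult ge2
    using assms by (simp add: norm_eq_1)
  then have "(real n + 2) * hom_eval x (Suc (Suc n)) (zonal \<nu> y (Suc (Suc n))) =
     2 * (real n + 1 + \<nu>) * ((x \<bullet> y) * gegenbauer \<nu> (Suc n) (x \<bullet> y)) - (real n + 2 * \<nu>) * gegenbauer \<nu> n (x \<bullet> y)"
    by (simp only:) (rule mult_divide_combination, simp)
  also have "\<dots> = (real n + 2) * gegenbauer \<nu> (Suc (Suc n)) (x \<bullet> y)"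
    using gegenbauer_recurrence[of n \<nu> "x \<bullet> y"] by (simp add: mult.assoc add.commute)
  finally show ?case by (simp del: zonal.simps hom_eval.simps)
qed simp

definition multi_index :: "nat \<Rightarrow> ('n::finite \<Rightarrow> nat) set" where
  "multi_index n = {\<alpha>. (\<Sum>i\<in>UNIV. \<alpha> i) = n}"

lemma finite_multi_index: "finite (multi_index n :: ('n::finite \<Rightarrow> nat) set)"
proof (rule finite_subset)
  show "multi_index n \<subseteq> (UNIV :: 'n set) \<rightarrow>\<^sub>E {..n}"
    by (auto simp: multi_index_def intro: member_le_sum)
qed (simp add: finite_PiE)

text \<open>For homogeneous \<open>p\<close> and \<open>q\<close> of degree \<open>n\<close> this is
  \<open>p(D) q\<close>, the differential operator with symbol \<open>p\<close> applied to
  \<open>q\<close>. The weights \<open>\<alpha>!\<close> are what makes coordinate multiplication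
  adjoint to differentiation.\<close>

definition fischer :: "nat \<Rightarrow> (('n::finite \<Rightarrow> nat) \<Rightarrow> real) \<Rightarrow> (('n \<Rightarrow> nat) \<Rightarrow> real) \<Rightarrow> real" where
  "fischer n p q = (\<Sum>\<alpha>\<in>multi_index n. (\<Prod>i\<in>UNIV. fact (\<alpha> i)) * p \<alpha> * q \<alpha>)"

lemma sum_fun_upd: "(\<Sum>j\<in>UNIV. (\<alpha>(i := k)) j) + \<alpha> i = (\<Sum>j\<in>UNIV. \<alpha> j) + (k::nat)" for i :: "'n::finite"
proof -
  have "(\<Sum>j\<in>UNIV. (\<alpha>(i := k)) j) = k + (\<Sum>j\<in>UNIV - {i}. (\<alpha>(i := k)) j)"
    by (subst sum.remove[of _ i]; simp)
  also have "(\<Sum>j\<in>UNIV - {i}. (\<alpha>(i := k)) j) = (\<Sum>j\<in>UNIV - {i}. \<alpha> j)"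
    by (rule sum.cong) auto
  finally show ?thesis by (subst (2) sum.remove[of _ i]) simp_all
qed

lemma fischer_mono_mult: "fischer (Suc n) (mono_mult i p) q = fischer n p (mono_diff i q)"
proof -
  let ?w = "\<lambda>\<alpha>. (\<Prod>j\<in>UNIV. fact (\<alpha> j)) :: real"
  have w: "?w (\<alpha>(i := Suc (\<alpha> i))) = real (\<alpha> i + 1) * ?w \<alpha>" for \<alpha>
  proof -
    have "?w (\<alpha>(i := Suc (\<alpha> i))) = fact (Suc (\<alpha> i)) * (\<Prod>j\<in>UNIV - {i}. fact ((\<alpha>(i := Suc (\<alpha> i))) j))"
      by (subst prod.remove[of _ i]; simp)
    also have "(\<Prod>j\<in>UNIV - {i}. fact ((\<alpha>(i := Suc (\<alpha> i))) j)) = ((\<Prod>j\<in>UNIV - {i}. fact (\<alpha> j)) :: real)"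
      by (rule prod.cong) auto
    finally show ?thesis by (subst (2) prod.remove[of _ i]) simp_all
  qed
  have "fischer (Suc n) (mono_mult i p) q = (\<Sum>\<alpha>\<in>{\<alpha>\<in>multi_index (Suc n). \<alpha> i \<noteq> 0}. ?w \<alpha> * mono_mult i p \<alpha> * q \<alpha>)"
    unfolding fischer_def
    by (rule sum.mono_neutral_right) (auto simp: finite_multi_index mono_mult_def)
  also have "\<dots> = (\<Sum>\<alpha>\<in>multi_index n. ?w \<alpha> * p \<alpha> * mono_diff i q \<alpha>)"
  proof (rule sum.reindex_bij_witness[of _ "\<lambda>\<alpha>. \<alpha>(i := Suc (\<alpha> i))" "\<lambda>\<alpha>. \<alpha>(i := \<alpha> i - 1)"])
    fix \<alpha> assume a: "\<alpha> \<in> {\<alpha> \<in> multi_index (Suc n). \<alpha> i \<noteq> 0}"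
    then obtain k where k: "\<alpha> i = Suc k" by (cases "\<alpha> i") auto
    show 1: "(\<alpha>(i := \<alpha> i - 1))(i := Suc ((\<alpha>(i := \<alpha> i - 1)) i)) = \<alpha>" using k by (auto simp: fun_eq_iff)
    show "\<alpha>(i := \<alpha> i - 1) \<in> multi_index n"
      using a k sum_fun_upd[of \<alpha> i "\<alpha> i - 1"] by (simp add: multi_index_def)
    have "?w \<alpha> = real (\<alpha> i) * ?w (\<alpha>(i := \<alpha> i - 1))"
      using w[of "\<alpha>(i := \<alpha> i - 1)"] k unfolding 1 by (simp del: fun_upd_apply add: fun_upd_same)
    then show "?w (\<alpha>(i := \<alpha> i - 1)) * p (\<alpha>(i := \<alpha> i - 1)) * mono_diff i q (\<alpha>(i := \<alpha> i - 1)) = ?w \<alpha> * mono_mult i p \<alpha> * q \<alpha>"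
      using k by (simp add: mono_mult_def mono_diff_def fun_upd_idem)
  next
    fix \<alpha> :: "'a \<Rightarrow> nat" assume "\<alpha> \<in> multi_index n"
    then show "\<alpha>(i := Suc (\<alpha> i)) \<in> {\<alpha> \<in> multi_index (Suc n). \<alpha> i \<noteq> 0}"
      using sum_fun_upd[of \<alpha> i "Suc (\<alpha> i)"] by (simp add: multi_index_def)
  qed simp
  finally show ?thesis by (simp add: fischer_def)
qed

lemma fischer_linear:
  "fischer n (\<lambda>\<alpha>. a * p \<alpha> + b * p' \<alpha>) q = a * fischer n p q + b * fischer n p' q"
  by (simp add: fischer_def sum.distrib sum_distrib_left algebra_simps)

lemma fischer_sum:
  "fischer n (\<lambda>\<alpha>. \<Sum>i\<in>A. c i * P i \<alpha>) q = (\<Sum>i\<in>A. c i * fischer n (P i) q)"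
  "fischer n p (\<lambda>\<alpha>. \<Sum>i\<in>A. c i * P i \<alpha>) = (\<Sum>i\<in>A. c i * fischer n p (P i))"
  unfolding fischer_def sum_distrib_left sum_distrib_right
  by (subst sum.swap, simp add: mult_ac)+

lemma fischer_lin_mult: "fischer (Suc n) (lin_mult y p) q = fischer n p (dir_diff y q)"
  by (simp add: lin_mult_def[abs_def] dir_diff_def[abs_def] fischer_sum fischer_mono_mult)

lemma fischer_sq_mult: "fischer (Suc (Suc n)) (sq_mult p) q = fischer n p (mono_lap q)"
proof -
  have "fischer (Suc (Suc n)) (sq_mult p) q = (\<Sum>i\<in>UNIV. 1 * fischer (Suc (Suc n)) (mono_mult i (mono_mult i p)) q)"
    unfolding fischer_sum[symmetric] by (simp add: sq_mult_def[abs_def])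
  also have "\<dots> = (\<Sum>i\<in>UNIV. 1 * fischer n p (mono_diff i (mono_diff i q)))"
    by (simp add: fischer_mono_mult)
  also have "\<dots> = fischer n p (mono_lap q)"
    unfolding fischer_sum[symmetric] by (simp add: mono_lap_def[abs_def])
  finally show ?thesis .
qed

text \<open>Reproducing property. By adjointness the \<open>sq_mult\<close> part of the recursion
  sees the Laplacian of \<open>q\<close> and drops out, while the \<open>lin_mult\<close> part
  differentiates \<open>q\<close> along \<open>x\<close>. Each degree thus contributes one factor
  \<open>2 (\<nu> + n)\<close> and one step of \<open>hom_eval\<close>.\<close>

lemma fischer_zonal:
  assumes "mono_lap q = (\<lambda>\<alpha>. 0)"
  shows "fischer n (zonal \<nu> x n) q = 2 ^ n * pochhammer \<nu> n * hom_eval x n q"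
  using assms
proof (induction n arbitrary: q rule: induct_nat_012)
  case 0
  have "multi_index 0 = {\<lambda>_::'a. 0::nat}" by (auto simp: multi_index_def)
  then show ?case by (simp add: fischer_def)
next
  case 1
  have m: "multi_index 0 = {\<lambda>_::'a. 0::nat}" by (auto simp: multi_index_def)
  have "fischer (Suc 0) (\<lambda>\<alpha>. 2 * \<nu> * lin_mult x (zonal \<nu> x 0) \<alpha> + 0 * 0) q
      = 2 * \<nu> * fischer 0 (zonal \<nu> x 0) (dir_diff x q)"
    by (simp only: fischer_linear[where p'="\<lambda>_. 0"] fischer_lin_mult)
  then show ?case by (simp add: fischer_def m)
next
  case (ge2 n)
  have h: "mono_lap (dir_diff x q) = (\<lambda>\<alpha>. 0)"
    by (rule ext) (simp add: mono_lap_dir_diff ge2 fischer_zero)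
  have "fischer n p (\<lambda>\<alpha>. 0) = 0" for p :: "('a \<Rightarrow> nat) \<Rightarrow> real" by (simp add: fischer_def)
  then have "fischer (Suc (Suc n)) (zonal \<nu> x (Suc (Suc n))) q
     = 2 * (real n + 1 + \<nu>) / (real n + 2) * (2 ^ Suc n * pochhammer \<nu> (Suc n) * hom_eval x (Suc n) (dir_diff x q))"
    unfolding zonal.simps(3) fischer_linear fischer_lin_mult fischer_sq_mult ge2.prems ge2.IH(2)[OF h] by simp
  also have "\<dots> = 2 ^ Suc (Suc n) * pochhammer \<nu> (Suc (Suc n)) * hom_eval x (Suc (Suc n)) q"
    by (simp only: hom_eval.simps(2)[of x "Suc n" q] pochhammer_Suc[of \<nu> "Suc n"])
       (simp add: field_simps del: hom_eval.simps)
  finally show ?case .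
qed

lemma continuous_zonal: "continuous_on UNIV (\<lambda>x. zonal \<nu> x n \<alpha>)"
proof (induction n arbitrary: \<alpha> rule: induct_nat_012)
  case 1
  show ?case by (simp add: lin_mult_def mono_mult_def) (intro continuous_intros)
next
  case (ge2 n)
  have "continuous_on UNIV (\<lambda>x. mono_mult i (zonal \<nu> x (Suc n)) \<alpha>)" for i
    by (cases "\<alpha> i = 0") (auto simp: mono_mult_def ge2 simp del: zonal.simps)
  moreover have "continuous_on UNIV (\<lambda>x. mono_mult i (mono_mult i (zonal \<nu> x n)) \<alpha>)" for i
    by (cases "\<alpha> i = 0 \<or> \<alpha> i = 1") (auto simp: mono_mult_def ge2 simp del: zonal.simps)
  ultimately show ?case
    unfolding zonal.simps(3) lin_mult_def sq_mult_def by (intro continuous_intros) auto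
qed simp

text \<open>Up to a constant, the Gegenbauer kernel is the reproducing kernel of the harmonic
  polynomials for the Fischer inner product; the index set enumerates monomials.\<close>
lemma gegenbauer_finite_rank:
  assumes d: "CARD('n) \<ge> 3"
  shows "\<exists>(A :: ('n::finite \<Rightarrow> nat) set) \<phi>. finite A \<and> (\<forall>a\<in>A. continuous_on UNIV (\<phi> a)) \<and>
    (\<forall>x\<in>sphere (0::real^'n) 1. \<forall>y\<in>sphere 0 1.
       gegenbauer (real CARD('n) / 2 - 1) n (x \<bullet> y) = (\<Sum>a\<in>A. \<phi> a x * \<phi> a y))"
proof -
  define \<nu> where "\<nu> = real CARD('n) / 2 - 1"
  define c where "c = 2 ^ n * pochhammer \<nu> n"
  have c: "c > 0" using d by (simp add: c_def \<nu>_def pochhammer_pos)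
  \<comment> \<open>The reproducing constant \<open>c\<close> is positive, so it can be divided out
    of the Fischer weights and the square root split evenly between both arguments.\<close>
  define w :: "('n \<Rightarrow> nat) \<Rightarrow> real" where "w \<alpha> = (\<Prod>i\<in>UNIV. fact (\<alpha> i)) / c" for \<alpha>
  have w: "w \<alpha> \<ge> 0" for \<alpha> using c by (simp add: w_def prod_nonneg)
  define \<phi> where "\<phi> \<alpha> x = sqrt (w \<alpha>) * zonal \<nu> x n \<alpha>" for \<alpha> and x :: "real ^ 'n"
  have "gegenbauer \<nu> n (x \<bullet> y) = (\<Sum>\<alpha>\<in>multi_index n. \<phi> \<alpha> x * \<phi> \<alpha> y)"
    if "norm x = 1" "norm y = 1" for x y
  proof -
    have "fischer n (zonal \<nu> x n) (zonal \<nu> y n) = c * gegenbauer \<nu> n (x \<bullet> y)"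
      using that by (simp add: fischer_zonal zonal_harmonic \<nu>_def hom_eval_zonal c_def)
    then have "gegenbauer \<nu> n (x \<bullet> y) = fischer n (zonal \<nu> x n) (zonal \<nu> y n) / c"
      using c by simp
    also have "\<dots> = (\<Sum>\<alpha>\<in>multi_index n. (sqrt (w \<alpha>) * sqrt (w \<alpha>)) * zonal \<nu> x n \<alpha> * zonal \<nu> y n \<alpha>)"
      unfolding real_sqrt_mult_self abs_of_nonneg[OF w]
      by (simp add: fischer_def sum_divide_distrib w_def)
    finally show ?thesis by (simp add: \<phi>_def mult_ac del: real_sqrt_mult_self)
  qed
  moreover have "continuous_on UNIV (\<phi> \<alpha>)" for \<alpha>
    unfolding \<phi>_def by (intro continuous_intros continuous_zonal)
  ultimately show ?thesis
    using finite_multi_index unfolding \<nu>_def by (intro exI[of _ "multi_index n"] exI[of _ \<phi>]) auto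
qed

text \<open>Estimates each product in the finite-rank form by the mean of the squares; the sums of
  squares are the diagonal values, both equal to the value at \<open>1\<close>.\<close>

lemma abs_gegenbauer_le:
  assumes d: "CARD('n) \<ge> 3" and xy: "x \<in> sphere (0::real^'n) 1" "y \<in> sphere 0 1"
  shows "\<bar>gegenbauer (real CARD('n) / 2 - 1) n (x \<bullet> y)\<bar> \<le> gegenbauer (real CARD('n) / 2 - 1) n 1"
proof -
  obtain A :: "('n \<Rightarrow> nat) set" and \<phi> where
    *: "\<And>x y::real^'n. x \<in> sphere 0 1 \<Longrightarrow> y \<in> sphere 0 1 \<Longrightarrow>
       gegenbauer (real CARD('n) / 2 - 1) n (x \<bullet> y) = (\<Sum>a\<in>A. \<phi> a x * \<phi> a y)"
    using gegenbauer_finite_rank[OF d] by metis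
  have xx: "x \<bullet> x = 1" "y \<bullet> y = 1" using xy by (simp_all add: norm_eq_1)
  have le: "\<bar>a * b\<bar> \<le> (a * a + b * b) / 2" for a b :: real
    using sum_squares_bound[of a b] sum_squares_bound[of a "-b"] by (auto simp: power2_eq_square)
  have "\<bar>\<Sum>a\<in>A. \<phi> a x * \<phi> a y\<bar> \<le> (\<Sum>a\<in>A. \<bar>\<phi> a x * \<phi> a y\<bar>)" by (rule sum_abs)
  also have "\<dots> \<le> (\<Sum>a\<in>A. (\<phi> a x * \<phi> a x + \<phi> a y * \<phi> a y) / 2)"
    by (rule sum_mono) (rule le)
  also have "\<dots> = gegenbauer (real CARD('n) / 2 - 1) n 1"
    using *[OF xy(1) xy(1)] *[OF xy(2) xy(2)] xx
    by (simp add: sum.distrib flip: sum_divide_distrib)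
  finally show ?thesis using *[OF xy] by simp
qed

section \<open>Laplace representation of the resolvent multiplier\<close>

lemma AE_summable_norm_if_summable_integral:
  fixes f :: "nat \<Rightarrow> 'a \<Rightarrow> real"
  assumes f: "\<And>i. integrable M (f i)" and s: "summable (\<lambda>i. \<integral>x. \<bar>f i x\<bar> \<partial>M)"
  shows "AE x in M. summable (\<lambda>i. \<bar>f i x\<bar>)"
proof -
  have m[measurable]: "f i \<in> borel_measurable M" for i using f by auto
  have "(\<integral>\<^sup>+x. (\<Sum>i. ennreal \<bar>f i x\<bar>) \<partial>M) = (\<Sum>i. \<integral>\<^sup>+x. ennreal \<bar>f i x\<bar> \<partial>M)"
    by (rule nn_integral_suminf) measurable
  also have "\<dots> = (\<Sum>i. ennreal (\<integral>x. \<bar>f i x\<bar> \<partial>M))"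
    using f by (simp add: nn_integral_eq_integral)
  also have "\<dots> = ennreal (\<Sum>i. \<integral>x. \<bar>f i x\<bar> \<partial>M)"
    by (rule suminf_ennreal2) (use s in auto)
  finally have "(\<integral>\<^sup>+x. (\<Sum>i. ennreal \<bar>f i x\<bar>) \<partial>M) \<noteq> \<infinity>" by simp
  then have "AE x in M. (\<Sum>i. ennreal \<bar>f i x\<bar>) \<noteq> \<infinity>"
    by (intro nn_integral_noteq_infinite) auto
  then show ?thesis
    by eventually_elim (rule summable_suminf_not_top, auto)
qed

text \<open>Termwise integration with the pointwise condition discharged: summable norms force
  absolute convergence almost everywhere.\<close>

lemma sums_integral_if_summable:
  fixes f :: "nat \<Rightarrow> 'a \<Rightarrow> real"
  assumes f: "\<And>i. integrable M (f i)" and s: "summable (\<lambda>i. \<integral>x. \<bar>f i x\<bar> \<partial>M)"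
  shows "integrable M (\<lambda>x. \<Sum>i. f i x)" "(\<lambda>i. \<integral>x. f i x \<partial>M) sums (\<integral>x. (\<Sum>i. f i x) \<partial>M)"
  using integrable_suminf[of M f] sums_integral[of M f] AE_summable_norm_if_summable_integral[of M f] assms
  by auto

text \<open>Its Laplace transform at \<open>x\<close> is \<open>(x + \<nu>) powr - q\<close>. The
  factor \<open>exp (- (\<nu> * u))\<close> shifts the argument, so that powers of
  \<open>l + \<nu>\<close> are transforms evaluated at \<open>l\<close>.\<close>

definition gamma_kernel :: "real \<Rightarrow> real \<Rightarrow> real \<Rightarrow> real" where
  "gamma_kernel \<nu> q u = (if u > 0 then u powr (q - 1) / Gamma q * exp (- (\<nu> * u)) else 0)"

lemma gamma_kernel_nonneg: "q > 0 \<Longrightarrow> gamma_kernel \<nu> q u \<ge> 0"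
  by (simp add: gamma_kernel_def Gamma_real_pos less_imp_le)

lemma borel_measurable_gamma_kernel [measurable]: "gamma_kernel \<nu> q \<in> borel_measurable borel"
  unfolding gamma_kernel_def[abs_def] by measurable

text \<open>Substitutes \<open>(x + \<nu>) * u\<close> in Euler's integral for
  \<open>Gamma q\<close>.\<close>

lemma has_bochner_integral_gamma_kernel:
  assumes q: "q > 0" and x: "x + \<nu> > 0"
  shows "has_bochner_integral lborel (\<lambda>u. gamma_kernel \<nu> q u * exp (- (x * u))) ((x + \<nu>) powr - q)"
proof (rule has_bochner_integral_nn_integral)
  define c where "c = x + \<nu>"
  have c: "c > 0" using x by (simp add: c_def)
  have G: "Gamma q > 0" using q by (rule Gamma_real_pos)
  have "ennreal (Gamma q) = \<bar>c\<bar> * (\<integral>\<^sup>+u. ennreal (indicator {0..} (0 + c * u) * (0 + c * u) powr (q - 1) / exp (0 + c * u)) \<partial>lborel)"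
    unfolding Gamma_conv_nn_integral_real[OF q] by (rule nn_integral_real_affine) (use c in auto)
  also have "(\<integral>\<^sup>+u. ennreal (indicator {0..} (0 + c * u) * (0 + c * u) powr (q - 1) / exp (0 + c * u)) \<partial>lborel)
     = (\<integral>\<^sup>+u. ennreal (c powr (q - 1) * Gamma q) * ennreal (gamma_kernel \<nu> q u * exp (- (x * u))) \<partial>lborel)"
  proof (rule nn_integral_cong)
    fix u :: real
    have "indicator {0..} (0 + c * u) * (0 + c * u) powr (q - 1) / exp (0 + c * u)
        = c powr (q - 1) * Gamma q * (gamma_kernel \<nu> q u * exp (- (x * u)))"
    proof (cases "u > 0")
      case True
      have "exp (- (\<nu> * u)) * exp (- (x * u)) = exp (- (c * u))"
        by (simp add: c_def algebra_simps flip: exp_add)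
      then have "gamma_kernel \<nu> q u * exp (- (x * u)) = u powr (q - 1) / Gamma q * exp (- (c * u))"
        using True by (simp add: gamma_kernel_def mult.assoc)
      then show ?thesis using True c G by (simp add: powr_mult exp_minus field_simps)
    next
      case False
      then have "c * u \<le> 0" using c by (simp add: mult_nonneg_nonpos)
      moreover have "c * u = 0 \<Longrightarrow> (c * u) powr (q - 1) = 0" by simp
      ultimately show ?thesis using False by (cases "c * u = 0") (auto simp: gamma_kernel_def)
    qed
    then show "ennreal (indicator {0..} (0 + c * u) * (0 + c * u) powr (q - 1) / exp (0 + c * u))
       = ennreal (c powr (q - 1) * Gamma q) * ennreal (gamma_kernel \<nu> q u * exp (- (x * u)))"
      using G q by (simp only:) (rule ennreal_mult, auto simp: gamma_kernel_nonneg)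
  qed
  also have "\<dots> = ennreal (c powr (q - 1) * Gamma q) * (\<integral>\<^sup>+u. ennreal (gamma_kernel \<nu> q u * exp (- (x * u))) \<partial>lborel)"
    by (rule nn_integral_cmult) measurable
  finally have E: "ennreal (Gamma q) = ennreal \<bar>c\<bar> * (ennreal (c powr (q - 1) * Gamma q) *
     (\<integral>\<^sup>+u. ennreal (gamma_kernel \<nu> q u * exp (- (x * u))) \<partial>lborel))" .
  have "ennreal (c powr - q) = ennreal (c powr - q / Gamma q) * ennreal (Gamma q)"
    using G by (simp flip: ennreal_mult')
  also have "\<dots> = ennreal (c powr - q / Gamma q * (c * (c powr (q - 1) * Gamma q)))
      * (\<integral>\<^sup>+u. ennreal (gamma_kernel \<nu> q u * exp (- (x * u))) \<partial>lborel)"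
  proof -
    have "ennreal a * (ennreal \<bar>c\<bar> * (ennreal k * I)) = ennreal (a * (c * k)) * I" if "a \<ge> 0" "k \<ge> 0" for a k I
      using that c by (simp add: ennreal_mult mult.assoc)
    then show ?thesis unfolding E using c G by simp
  qed
  also have "c powr - q / Gamma q * (c * (c powr (q - 1) * Gamma q)) = 1"
    using c G by (simp add: powr_diff powr_minus field_simps)
  finally show "(\<integral>\<^sup>+u. ennreal (gamma_kernel \<nu> q u * exp (- (x * u))) \<partial>lborel) = ennreal ((x + \<nu>) powr - q)"
    by (simp add: c_def)
qed (use q in \<open>auto simp: gamma_kernel_nonneg\<close>)

text \<open>Superposes gamma kernels. Since \<open>(x + \<nu>) powr - q\<close> decreases in
  \<open>x\<close>, absolute convergence at \<open>x = 1\<close> covers all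
  \<open>x \<ge> 1\<close>; the smallest exponent \<open>q0\<close> governs the size of
  \<open>\<psi>\<close> at \<open>0\<close>.\<close>

lemma laplace_series:
  fixes b q :: "nat \<Rightarrow> real"
  assumes q0: "q0 > 0" and q: "\<And>i. q i \<ge> q0" and \<nu>: "\<nu> \<ge> 0"
    and s: "summable (\<lambda>i. \<bar>b i\<bar> * (1 + \<nu>) powr - q i)"
  defines "\<psi> \<equiv> \<lambda>u. \<Sum>i. b i * gamma_kernel \<nu> (q i) u"
  shows "\<psi> \<in> borel_measurable borel" "\<And>u. u \<le> 0 \<Longrightarrow> \<psi> u = 0"
    "integrable lborel (\<lambda>u. \<psi> u * exp (- u))"
    "\<And>x. x \<ge> 1 \<Longrightarrow> (\<lambda>i. b i * (x + \<nu>) powr - q i) sums (\<integral>u. \<psi> u * exp (- (x * u)) \<partial>lborel)"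
    "\<exists>C. \<forall>u\<in>{0<..1}. \<bar>\<psi> u\<bar> \<le> C * u powr (q0 - 1)"
proof -
  have qp: "q i > 0" for i using q0 q[of i] by linarith
  show "\<psi> \<in> borel_measurable borel" unfolding \<psi>_def by measurable
  show "\<psi> u = 0" if "u \<le> 0" for u using that by (simp add: \<psi>_def gamma_kernel_def)
  define f where "f x i u = b i * gamma_kernel \<nu> (q i) u * exp (- (x * u))" for x i u
  have fi: "has_bochner_integral lborel (f x i) (b i * (x + \<nu>) powr - q i)" if "x \<ge> 1" for x i
    unfolding f_def mult.assoc
    by (intro has_bochner_integral_mult_right has_bochner_integral_gamma_kernel) (use that \<nu> qp in auto)
  have fa: "has_bochner_integral lborel (\<lambda>u. \<bar>f x i u\<bar>) (\<bar>b i\<bar> * (x + \<nu>) powr - q i)" if "x \<ge> 1" for x i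
  proof -
    have "\<bar>f x i u\<bar> = \<bar>b i\<bar> * (gamma_kernel \<nu> (q i) u * exp (- (x * u)))" for u
      using qp by (simp add: f_def abs_mult gamma_kernel_nonneg)
    then show ?thesis using that \<nu> qp
      by (simp only:) (intro has_bochner_integral_mult_right has_bochner_integral_gamma_kernel, auto)
  qed
  have sx: "summable (\<lambda>i. \<integral>u. \<bar>f x i u\<bar> \<partial>lborel)" if "x \<ge> 1" for x
  proof (rule summable_comparison_test'[OF s, of 0])
    fix i
    have "(x + \<nu>) powr - q i \<le> (1 + \<nu>) powr - q i"
      using that \<nu> qp[of i] by (intro powr_mono2') auto
    then show "norm (\<integral>u. \<bar>f x i u\<bar> \<partial>lborel) \<le> \<bar>b i\<bar> * (1 + \<nu>) powr - q i"
      using has_bochner_integral_integral_eq[OF fa[OF that]] by (simp add: mult_left_mono)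
  qed
  have int: "integrable lborel (f x i)" if "x \<ge> 1" for x i
    using fi[OF that] by (auto simp: has_bochner_integral_iff)
  have \<psi>f: "(\<Sum>i. f x i u) = \<psi> u * exp (- (x * u))" if "summable (\<lambda>i. \<bar>f x i u\<bar>)" for x u
  proof -
    have "summable (\<lambda>i. exp (x * u) * f x i u)"
      using that by (intro summable_mult) (rule summable_rabs_cancel)
    moreover have "exp (x * u) * f x i u = b i * gamma_kernel \<nu> (q i) u" for i
      by (simp add: f_def exp_minus)
    ultimately have "summable (\<lambda>i. b i * gamma_kernel \<nu> (q i) u)" by simp
    then show ?thesis unfolding f_def \<psi>_def by (simp add: suminf_mult2)
  qed
  have AE: "AE u in lborel. (\<Sum>i. f x i u) = \<psi> u * exp (- (x * u))" if "x \<ge> 1" for x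
    using AE_summable_norm_if_summable_integral[OF int[OF that] sx[OF that]] by eventually_elim (rule \<psi>f)
  have [measurable]: "\<psi> \<in> borel_measurable borel" unfolding \<psi>_def by measurable
  have [measurable]: "f x i \<in> borel_measurable borel" for x i unfolding f_def[abs_def] by measurable
  show "(\<lambda>i. b i * (x + \<nu>) powr - q i) sums (\<integral>u. \<psi> u * exp (- (x * u)) \<partial>lborel)" if x: "x \<ge> 1" for x
  proof -
    have "(\<lambda>i. \<integral>u. f x i u \<partial>lborel) sums (\<integral>u. (\<Sum>i. f x i u) \<partial>lborel)"
      by (rule sums_integral_if_summable[OF int[OF x] sx[OF x]])
    also have "(\<integral>u. (\<Sum>i. f x i u) \<partial>lborel) = (\<integral>u. \<psi> u * exp (- (x * u)) \<partial>lborel)"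
      by (rule integral_cong_AE) (use AE[OF x] in auto)
    finally show ?thesis using has_bochner_integral_integral_eq[OF fi[OF x]] by simp
  qed
  have "integrable lborel (\<lambda>u. \<Sum>i. f 1 i u)"
    by (rule sums_integral_if_summable[OF int[OF order_refl] sx[OF order_refl]])
  then show "integrable lborel (\<lambda>u. \<psi> u * exp (- u))"
    by (rule integrable_cong_AE_imp) (use AE[of 1] in auto)
  \<comment> \<open>Convergence is known only almost everywhere, but a single good point
    \<open>u0 \<ge> 1\<close> dominates the whole interval up to \<open>1\<close>, which turns it
    into a bound at every point.\<close>
  have "\<exists>u\<ge>1. summable (\<lambda>i. \<bar>f 1 i u\<bar>)"
  proof (rule ccontr)
    assume "\<not> ?thesis"
    then have *: "\<not> summable (\<lambda>i. \<bar>f 1 i u\<bar>)" if "u \<ge> 1" for u using that by blast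
    have "AE u in lborel. u \<notin> {1..2::real}"
      using AE_summable_norm_if_summable_integral[OF int[OF order_refl] sx[OF order_refl]] by eventually_elim (use * in auto)
    then have "emeasure lborel {1..2::real} = 0" by (subst (asm) AE_iff_measurable[of "{1..2}"]) auto
    then show False by simp
  qed
  then obtain u0 where u0: "u0 \<ge> 1" "summable (\<lambda>i. \<bar>f 1 i u0\<bar>)" by blast
  define S where "S = (\<Sum>i. \<bar>b i\<bar> * gamma_kernel \<nu> (q i) u0)"
  have sS: "summable (\<lambda>i. \<bar>b i\<bar> * gamma_kernel \<nu> (q i) u0)"
  proof -
    have "summable (\<lambda>i. exp u0 * \<bar>f 1 i u0\<bar>)" using u0 by (intro summable_mult)
    moreover have "exp u0 * \<bar>f 1 i u0\<bar> = \<bar>b i\<bar> * gamma_kernel \<nu> (q i) u0" for i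
      using qp by (simp add: f_def abs_mult exp_minus gamma_kernel_nonneg)
    ultimately show ?thesis by simp
  qed
  show "\<exists>C. \<forall>u\<in>{0<..1}. \<bar>\<psi> u\<bar> \<le> C * u powr (q0 - 1)"
  proof (intro exI[of _ "S * exp (\<nu> * u0) * u0 powr (1 - q0)"] ballI)
    fix u :: real assume u: "u \<in> {0<..1}"
    define k where "k = exp (\<nu> * u0) * u0 powr (1 - q0) * u powr (q0 - 1)"
    have le: "gamma_kernel \<nu> (q i) u \<le> k * gamma_kernel \<nu> (q i) u0" for i
    proof -
      \<comment> \<open>As \<open>u / u0 \<le> 1\<close>, the larger exponent gives the smaller
        power. The Gamma factor is the same on both sides, so the comparison constant
        \<open>k\<close> does not depend on \<open>i\<close>.\<close>
      have "(u / u0) powr (q i - 1) \<le> (u / u0) powr (q0 - 1)"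
        using u u0 q by (intro powr_mono') auto
      then have "u powr (q i - 1) \<le> u0 powr (1 - q0) * u powr (q0 - 1) * u0 powr (q i - 1)"
        using u u0 by (simp add: powr_divide powr_diff field_simps)
      moreover have "exp (- (\<nu> * u)) \<le> 1" using u \<nu> by simp
      ultimately have "u powr (q i - 1) * exp (- (\<nu> * u)) \<le> u0 powr (1 - q0) * u powr (q0 - 1) * u0 powr (q i - 1) * 1"
        by (intro mult_mono) auto
      then have "u powr (q i - 1) * exp (- (\<nu> * u)) / Gamma (q i) \<le> u0 powr (1 - q0) * u powr (q0 - 1) * u0 powr (q i - 1) / Gamma (q i)"
        using Gamma_real_pos[OF qp[of i]] by (intro divide_right_mono) auto
      then show ?thesis using u u0 by (simp add: gamma_kernel_def k_def exp_minus field_simps)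
    qed
    have le': "\<bar>b i * gamma_kernel \<nu> (q i) u\<bar> \<le> k * (\<bar>b i\<bar> * gamma_kernel \<nu> (q i) u0)" for i
      using mult_left_mono[OF le[of i], of "\<bar>b i\<bar>"] qp
      by (simp add: abs_mult gamma_kernel_nonneg mult.left_commute)
    have sk: "summable (\<lambda>i. k * (\<bar>b i\<bar> * gamma_kernel \<nu> (q i) u0))" using sS by (rule summable_mult)
    have "summable (\<lambda>i. \<bar>b i * gamma_kernel \<nu> (q i) u\<bar>)"
      by (rule summable_comparison_test'[OF sk, of 0]) (use le' in auto)
    then have "\<bar>\<psi> u\<bar> \<le> (\<Sum>i. \<bar>b i * gamma_kernel \<nu> (q i) u\<bar>)"
      unfolding \<psi>_def by (rule summable_rabs)
    also have "\<dots> \<le> (\<Sum>i. k * (\<bar>b i\<bar> * gamma_kernel \<nu> (q i) u0))"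
      by (rule suminf_le) (use le' sk \<open>summable (\<lambda>i. \<bar>b i * gamma_kernel \<nu> (q i) u\<bar>)\<close> in auto)
    also have "\<dots> = S * k" using suminf_mult[OF sS] by (simp add: S_def)
    finally show "\<bar>\<psi> u\<bar> \<le> S * exp (\<nu> * u0) * u0 powr (1 - q0) * u powr (q0 - 1)"
      by (simp add: k_def mult.assoc)
  qed
qed


section \<open>Expansion of the resolvent multiplier\<close>

lemma binomial_series_neg:
  fixes p y :: real
  assumes "\<bar>y\<bar> < 1"
  shows "(\<lambda>j. pochhammer p j / fact j * y ^ j) sums (1 - y) powr - p"
proof -
  have "(\<lambda>j. (- p gchoose j) * (- y) ^ j) sums (1 + - y) powr - p"
    by (rule gen_binomial_real) (use assms in simp)
  moreover have "(- p gchoose j) * (- y) ^ j = pochhammer p j / fact j * y ^ j" for j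
  proof -
    have "(- p gchoose j) * (- y) ^ j = (- 1) ^ j * (- y) ^ j * (pochhammer p j / fact j)"
      by (simp add: gbinomial_pochhammer mult_ac)
    also have "(- 1) ^ j * (- y) ^ j = y ^ j" by (induction j) simp_all
    finally show ?thesis by (simp only: mult.commute)
  qed
  ultimately show ?thesis by simp
qed

text \<open>With \<open>\<Lambda> = x\<^sup>2 - \<nu>\<^sup>2 > 1\<close>, the geometric series in
  \<open>\<Lambda> powr - s\<close> is combined with the binomial series of
  \<open>x powr (- 2 p) * (1 - (\<nu> / x)\<^sup>2) powr - p\<close>. The binomial coefficients are
  nonnegative, so the absolute values over \<open>j\<close> sum to a power of
  \<open>\<Lambda> powr - s\<close>, and absolute convergence over all pairs reduces to a geometric
  series.\<close>

lemma resolvent_double_series: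
  fixes s \<nu> x :: real
  assumes s: "s > 0" and x: "x > \<nu>" "\<nu> \<ge> 0" "x\<^sup>2 - \<nu>\<^sup>2 > 1"
  defines "c \<equiv> \<lambda>(k, j). pochhammer (real (Suc k) * s) j / fact j * \<nu> ^ (2 * j) * x powr - (2 * real (Suc k) * s + 2 * real j)"
  shows "c summable_on UNIV" "((\<lambda>(k, j). (- 1) ^ k * c (k, j)) has_sum inverse (1 + (x\<^sup>2 - \<nu>\<^sup>2) powr s)) UNIV"
proof -
  define \<Lambda> where "\<Lambda> = x\<^sup>2 - \<nu>\<^sup>2"
  have L: "\<Lambda> > 1" using x by (simp add: \<Lambda>_def)
  have poch: "pochhammer (real (Suc k) * s) j \<ge> 0" for k j
    using s by (intro less_imp_le pochhammer_pos) simp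
  have cp: "c kj \<ge> 0" for kj
    using x poch by (cases kj) (simp add: c_def del: of_nat_Suc)
  have inner: "((\<lambda>j. c (k, j)) has_sum (\<Lambda> powr - s) ^ Suc k) UNIV" for k
  proof (rule sums_nonneg_imp_has_sum)
    define p where "p = real (Suc k) * s"
    define y where "y = (\<nu> / x)\<^sup>2"
    \<comment> \<open>The strict inequality \<open>\<nu> < x\<close> puts \<open>y\<close> inside
      the disc of convergence of the binomial series.\<close>
    have y: "y \<ge> 0" "y < 1" using x by (simp_all add: y_def power_divide power2_eq_square mult_strict_mono)
    have "(\<lambda>j. x powr (- 2 * p) * (pochhammer p j / fact j * y ^ j)) sums (x powr (- 2 * p) * (1 - y) powr - p)"
      by (intro sums_mult binomial_series_neg) (use y in auto)
    moreover have "x powr (- 2 * p) * (pochhammer p j / fact j * y ^ j) = c (k, j)" for j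
    proof -
      have "x powr - (2 * p + 2 * real j) = x powr (- 2 * p) / x ^ (2 * j)"
      proof -
        have "x powr - (2 * p + 2 * real j) = x powr (- 2 * p - real (2 * j))" by (simp add: algebra_simps)
        also have "\<dots> = x powr (- 2 * p) / x powr real (2 * j)" by (rule powr_diff)
        also have "x powr real (2 * j) = x ^ (2 * j)" by (rule powr_realpow) (use x in linarith)
        finally show ?thesis .
      qed
      moreover have "c (k, j) = pochhammer p j / fact j * \<nu> ^ (2 * j) * x powr - (2 * p + 2 * real j)"
        by (simp add: c_def p_def mult.assoc del: of_nat_Suc)
      moreover have "y ^ j = \<nu> ^ (2 * j) / x ^ (2 * j)"
        by (simp only: y_def power_divide power_mult)
      ultimately show ?thesis by simp
    qed
    moreover have "x powr (- 2 * p) * (1 - y) powr - p = (\<Lambda> powr - s) ^ Suc k"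
    proof -
      have "x powr (- 2 * p) = (x\<^sup>2) powr - p"
      proof -
        have "x powr 2 = x\<^sup>2" by (rule powr_numeral) (use x in linarith)
        moreover have "(x powr 2) powr - p = x powr (2 * - p)" by (rule powr_powr)
        ultimately show ?thesis by simp
      qed
      then have "x powr (- 2 * p) * (1 - y) powr - p = (x\<^sup>2 * (1 - y)) powr - p"
        using y by (simp add: powr_mult)
      also have "x\<^sup>2 * (1 - y) = \<Lambda>"
        using x by (simp add: y_def \<Lambda>_def field_simps)
      also have "\<Lambda> powr - p = (\<Lambda> powr - s) ^ Suc k"
      proof -
        have "(\<Lambda> powr - s) ^ Suc k = (\<Lambda> powr - s) powr real (Suc k)"
          by (rule powr_realpow[symmetric]) (use L in simp)
        also have "\<dots> = \<Lambda> powr (- s * real (Suc k))" by (rule powr_powr)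
        also have "- s * real (Suc k) = - p" by (simp add: p_def mult.commute)
        finally show ?thesis ..
      qed
      finally show ?thesis .
    qed
    ultimately show "(\<lambda>j. c (k, j)) sums (\<Lambda> powr - s) ^ Suc k" by simp
  qed (rule cp)
  define r where "r = \<Lambda> powr - s"
  have r: "0 < r" "r < 1"
  proof -
    show "0 < r" using L by (simp add: r_def)
    show "r < 1" unfolding r_def by (rule powr_less_one) (use L s in auto)
  qed
  have nr: "norm (r ^ k) = r ^ k" for k
    unfolding real_norm_def by (rule abs_of_nonneg) (use r in simp)
  have "summable (\<lambda>k. r * r ^ k)" using r by (intro summable_mult summable_geometric) auto
  then have rs: "summable (\<lambda>k. norm (r ^ Suc k))" unfolding nr by (simp only: power_Suc)
  then have gs: "(\<lambda>k. r ^ Suc k) summable_on UNIV" by (rule norm_summable_imp_summable_on)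
  show cs: "c summable_on UNIV"
  proof -
    have "c summable_on (Sigma UNIV (\<lambda>_. UNIV))"
      by (rule summable_on_SigmaI[OF inner]) (use gs cp in \<open>auto simp: r_def\<close>)
    then show ?thesis by simp
  qed
  have "(\<lambda>p. (- 1) ^ fst p * c p) summable_on UNIV"
  proof (rule abs_summable_summable)
    have "norm ((- 1) ^ fst p * c p) = c p" for p
      using cp[of p] by (simp add: abs_mult)
    then show "(\<lambda>p. norm ((- 1) ^ fst p * c p)) summable_on UNIV"
      using cs by (simp only:)
  qed
  then have "(\<lambda>(k, j). (- 1) ^ k * c (k, j)) summable_on UNIV"
    by (simp add: case_prod_unfold)
  moreover have "((\<lambda>k. (- 1) ^ k * r ^ Suc k) has_sum inverse (1 + \<Lambda> powr s)) UNIV"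
  proof (rule norm_summable_imp_has_sum)
    show "summable (\<lambda>k. norm ((- 1) ^ k * r ^ Suc k))"
    proof -
      have "norm ((- 1) ^ k * r ^ Suc k) = norm (r ^ Suc k)" for k
        by (simp only: norm_mult norm_power norm_minus_cancel norm_one power_one mult_1)
      then show ?thesis using rs by (simp only:)
    qed
    have "(\<lambda>k. r * (- r) ^ k) sums (r * (1 / (1 - (- r))))"
      by (intro sums_mult geometric_sums) (use r in simp)
    moreover have "r * (1 / (1 - (- r))) = inverse (1 + \<Lambda> powr s)"
    proof -
      have "\<Lambda> powr s > 0" "r = inverse (\<Lambda> powr s)" using L by (simp_all add: r_def powr_minus)
      then have "r * (1 + \<Lambda> powr s) = 1 + r" by (simp add: distrib_left)
      moreover have "1 + r > 0" "1 + \<Lambda> powr s > 0"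
        using r(1) \<open>\<Lambda> powr s > 0\<close> by linarith+
      ultimately show ?thesis by (simp add: divide_simps)
    qed
    moreover have "r * (- r) ^ k = (- 1) ^ k * r ^ Suc k" for k
      by (induction k) (simp_all add: mult_ac)
    ultimately show "(\<lambda>k. (- 1) ^ k * r ^ Suc k) sums inverse (1 + \<Lambda> powr s)" by (simp only:)
  qed
  ultimately have "((\<lambda>(k, j). (- 1) ^ k * c (k, j)) has_sum inverse (1 + \<Lambda> powr s)) (Sigma UNIV (\<lambda>_. UNIV))"
  proof (intro has_sum_SigmaI[where g = "\<lambda>k. (- 1) ^ k * r ^ Suc k"])
    show "((\<lambda>j. case (k, j) of (k, j) \<Rightarrow> (- 1) ^ k * c (k, j)) has_sum (- 1) ^ k * r ^ Suc k) UNIV" for k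
      using has_sum_cmult_right[OF inner[of k], of "(- 1) ^ k"] by (simp only: r_def split)
  qed simp_all
  then show "((\<lambda>(k, j). (- 1) ^ k * c (k, j)) has_sum inverse (1 + (x\<^sup>2 - \<nu>\<^sup>2) powr s)) UNIV"
    by (simp add: \<Lambda>_def)
qed

lemma resolvent_multiplier_laplace:
  fixes s \<nu> :: real
  assumes s: "s > 0" and \<nu>: "\<nu> > 0"
  obtains \<psi> :: "real \<Rightarrow> real" and C where
    "\<psi> \<in> borel_measurable borel" "\<And>u. u \<le> 0 \<Longrightarrow> \<psi> u = 0"
    "integrable lborel (\<lambda>u. \<psi> u * exp (- u))"
    "\<And>l::nat. l \<ge> 1 \<Longrightarrow> (\<integral>u. \<psi> u * exp (- (real l * u)) \<partial>lborel) = inverse (1 + (real l * (real l + 2 * \<nu>)) powr s)"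
    "\<And>u. 0 < u \<Longrightarrow> u \<le> 1 \<Longrightarrow> \<bar>\<psi> u\<bar> \<le> C * u powr (2 * s - 1)"
proof -
  \<comment> \<open>Signed coefficients \<open>B\<close> and exponents \<open>Q\<close> of the
    double series, so that a term is \<open>B p * x powr - Q p\<close>; \<open>prod_decode\<close>
    then lists the pairs as one sequence for \<open>laplace_series\<close>.\<close>
  define B where "B = (\<lambda>(k, j). (- 1) ^ k * (pochhammer (real (Suc k) * s) j / fact j * \<nu> ^ (2 * j)))"
  define Q where "Q = (\<lambda>(k, j::nat). 2 * real (Suc k) * s + 2 * real j)"
  define b where "b i = B (prod_decode i)" for i
  define q where "q i = Q (prod_decode i)" for i
  have bij: "bij_betw prod_decode UNIV UNIV" by (rule bij_prod_decode)
  have conv: "summable (\<lambda>i. \<bar>b i\<bar> * x powr - q i)"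
    "(\<lambda>i. b i * x powr - q i) sums inverse (1 + (x\<^sup>2 - \<nu>\<^sup>2) powr s)"
    if "x > \<nu>" "x\<^sup>2 - \<nu>\<^sup>2 > 1" for x
  proof -
    define c where "c = (\<lambda>(k, j). pochhammer (real (Suc k) * s) j / fact j * \<nu> ^ (2 * j) * x powr - (2 * real (Suc k) * s + 2 * real j))"
    note d = resolvent_double_series[OF s that(1) less_imp_le[OF \<nu>] that(2)]
    have 1: "\<bar>B p\<bar> * x powr - Q p = c p" for p
    proof -
      have "pochhammer (real (Suc k) * s) j \<ge> 0" for k j
        using s by (intro less_imp_le pochhammer_pos) simp
      then show ?thesis using \<nu> by (cases p) (simp add: B_def Q_def c_def abs_mult power_abs del: of_nat_Suc)
    qed
    have 2: "B p * x powr - Q p = (case p of (k, j) \<Rightarrow> (- 1) ^ k * c (k, j))" for p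
      by (cases p) (simp add: B_def Q_def c_def mult.assoc)
    have "(\<lambda>p. \<bar>B p\<bar> * x powr - Q p) summable_on UNIV"
      using d(1) unfolding 1 c_def .
    then have "(\<lambda>i. \<bar>b i\<bar> * x powr - q i) summable_on UNIV"
      unfolding b_def q_def using summable_on_reindex_bij_betw[OF bij, of "\<lambda>p. \<bar>B p\<bar> * x powr - Q p"] by simp
    then show "summable (\<lambda>i. \<bar>b i\<bar> * x powr - q i)" by (rule summable_on_imp_summable)
    have "((\<lambda>p. B p * x powr - Q p) has_sum inverse (1 + (x\<^sup>2 - \<nu>\<^sup>2) powr s)) UNIV"
      using d(2) unfolding 2 c_def .
    then have "((\<lambda>i. b i * x powr - q i) has_sum inverse (1 + (x\<^sup>2 - \<nu>\<^sup>2) powr s)) UNIV"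
      unfolding b_def q_def using has_sum_reindex_bij_betw[OF bij, of "\<lambda>p. B p * x powr - Q p"] by simp
    then show "(\<lambda>i. b i * x powr - q i) sums inverse (1 + (x\<^sup>2 - \<nu>\<^sup>2) powr s)" by (rule has_sum_imp_sums)
  qed
  \<comment> \<open>For \<open>x = l + \<nu>\<close> the quantity
    \<open>x\<^sup>2 - \<nu>\<^sup>2\<close> is the eigenvalue \<open>l (l + 2 \<nu>)\<close>; this
    is where \<open>l = 0\<close> is excluded.\<close>
  have gt1: "(real l + \<nu>)\<^sup>2 - \<nu>\<^sup>2 > 1" if "l \<ge> 1" for l
  proof -
    have "1 \<le> real l * real l" using that by (simp add: mult_ge1_I)
    moreover have "0 < real l * \<nu>" using that \<nu> by simp
    ultimately show ?thesis by (simp add: power2_eq_square algebra_simps)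
  qed
  \<comment> \<open>The least exponent belongs to the pair \<open>(0, 0)\<close> and yields the
    order \<open>2 s - 1\<close> of \<open>\<psi>\<close> at \<open>0\<close>.\<close>
  have q: "q i \<ge> 2 * s" for i
    using s by (cases "prod_decode i") (simp add: q_def Q_def algebra_simps)
  note L = laplace_series[of "2 * s" q \<nu> b, OF _ q less_imp_le[OF \<nu>] conv(1)[of "1 + \<nu>"]]
  define \<psi> where "\<psi> u = (\<Sum>i. b i * gamma_kernel \<nu> (q i) u)" for u
  obtain C where C: "\<And>u. 0 < u \<Longrightarrow> u \<le> 1 \<Longrightarrow> \<bar>\<psi> u\<bar> \<le> C * u powr (2 * s - 1)"
  proof -
    have "\<exists>C. \<forall>u\<in>{0<..1}. \<bar>\<psi> u\<bar> \<le> C * u powr (2 * s - 1)"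
      unfolding \<psi>_def by (rule L(5)) (use s gt1[of 1] in auto)
    then obtain C where "\<forall>u\<in>{0<..1}. \<bar>\<psi> u\<bar> \<le> C * u powr (2 * s - 1)" ..
    then show thesis by (intro that[of C]) simp
  qed
  show thesis
  proof (rule that[of \<psi> C])
    show "(\<integral>u. \<psi> u * exp (- (real l * u)) \<partial>lborel) = inverse (1 + (real l * (real l + 2 * \<nu>)) powr s)"
      if l: "l \<ge> 1" for l
    proof -
      have "(\<lambda>i. b i * (real l + \<nu>) powr - q i) sums (\<integral>u. \<psi> u * exp (- (real l * u)) \<partial>lborel)"
        unfolding \<psi>_def by (rule L(4)) (use s gt1[of 1] l in auto)
      moreover have "(\<lambda>i. b i * (real l + \<nu>) powr - q i) sums inverse (1 + ((real l + \<nu>)\<^sup>2 - \<nu>\<^sup>2) powr s)"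
        by (rule conv(2)) (use gt1[OF l] l in auto)
      ultimately have "(\<integral>u. \<psi> u * exp (- (real l * u)) \<partial>lborel) = inverse (1 + ((real l + \<nu>)\<^sup>2 - \<nu>\<^sup>2) powr s)"
        by (rule sums_unique2)
      also have "(real l + \<nu>)\<^sup>2 - \<nu>\<^sup>2 = real l * (real l + 2 * \<nu>)"
        by (simp add: power2_eq_square algebra_simps)
      finally show ?thesis .
    qed
  qed (use L(1-3) s gt1[of 1] C in \<open>auto simp: \<psi>_def[abs_def]\<close>)
qed

section \<open>The kernel as a Laplace integral\<close>

definition gen_base :: "real \<Rightarrow> real \<Rightarrow> real" where
  "gen_base r z = 1 - 2 * r * z + r\<^sup>2"

text \<open>Separates the distance of \<open>r\<close> from \<open>1\<close> from that of
  \<open>z\<close> from \<open>1\<close>, so either one alone can keep the denominator away from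
  \<open>0\<close>.\<close>

lemma gen_base_eq: "gen_base r z = (1 - r)\<^sup>2 + 2 * r * (1 - z)"
  by (simp add: gen_base_def power2_eq_square algebra_simps)

lemma gen_base_pos:
  assumes "\<bar>z\<bar> \<le> 1" "\<bar>r\<bar> < 1"
  shows "gen_base r z > 0"
proof -
  have "r * z \<le> \<bar>r\<bar>" using mult_left_mono[OF assms(1), of "\<bar>r\<bar>"] by (simp add: abs_mult[symmetric])
  then have "gen_base r z \<ge> (1 - \<bar>r\<bar>)\<^sup>2" by (simp add: gen_base_def power2_eq_square algebra_simps)
  moreover have "(1 - \<bar>r\<bar>)\<^sup>2 > 0" using assms by simp
  ultimately show ?thesis by linarith
qed

text \<open>The sum of \<open>(l + \<nu>) C\<^sub>l(z) r\<^sup>l\<close> over \<open>l \<ge> 1\<close>.\<close>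
definition gen_sum :: "real \<Rightarrow> real \<Rightarrow> real \<Rightarrow> real" where
  "gen_sum \<nu> r z = \<nu> * ((1 - r\<^sup>2) * gen_base r z powr - (\<nu> + 1) - 1)"

text \<open>The scalar estimates for the Poisson kernel need only these two facts; for
  \<open>\<nu> = d / 2 - 1\<close> the bound comes from the reproducing kernel.\<close>

locale gegenbauer_bounded =
  fixes \<nu> :: real
  assumes nu_pos: "\<nu> > 0"
    and gegenbauer_bound: "\<And>n z. \<bar>z\<bar> \<le> 1 \<Longrightarrow> \<bar>gegenbauer \<nu> n z\<bar> \<le> gegenbauer \<nu> n 1"
begin

lemma gegenbauer_1_nonneg: "gegenbauer \<nu> n 1 \<ge> 0"
  using gegenbauer_bound[of 1 n] by linarith

lemma summable_gegenbauer:
  assumes "\<bar>z\<bar> \<le> 1" "\<bar>r\<bar> < 1"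
  shows "summable (\<lambda>n. gegenbauer \<nu> n z * r ^ n)"
proof (rule summable_comparison_test'[of "\<lambda>n. gegenbauer \<nu> n 1 * \<bar>r\<bar> ^ n" 0])
  show "summable (\<lambda>n. gegenbauer \<nu> n 1 * \<bar>r\<bar> ^ n)"
    unfolding gegenbauer_at_1 using binomial_series_neg[of "\<bar>r\<bar>" "2 * \<nu>"] assms by (auto simp: sums_iff)
  show "norm (gegenbauer \<nu> n z * r ^ n) \<le> gegenbauer \<nu> n 1 * \<bar>r\<bar> ^ n" for n
    using gegenbauer_bound[OF assms(1), of n] by (simp add: abs_mult power_abs mult_right_mono)
qed

lemma gegenbauer_conv_radius:
  assumes "\<bar>z\<bar> \<le> 1"
  shows "fps_conv_radius (Abs_fps (\<lambda>l. gegenbauer \<nu> l z)) \<ge> 1"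
  unfolding fps_conv_radius_def
  by (rule conv_radius_geI_ex') (use summable_gegenbauer[OF assms] in auto)

text \<open>Evaluates the formal differential equation at a point of the open unit interval, where
  the bound on the coefficients guarantees convergence.\<close>

lemma gegenbauer_generating_ode:
  assumes z: "\<bar>z\<bar> \<le> 1" and r: "\<bar>r\<bar> < 1"
  defines "F \<equiv> Abs_fps (\<lambda>l. gegenbauer \<nu> l z)"
  shows "gen_base r z * eval_fps (fps_deriv F) r = 2 * \<nu> * (z - r) * eval_fps F r"
proof -
  have c: "ereal (norm r) < fps_conv_radius F"
    unfolding F_def by (rule less_le_trans[OF _ gegenbauer_conv_radius[OF z]]) (use r in \<open>simp add: one_ereal_def\<close>)
  have c': "ereal (norm r) < fps_conv_radius (fps_deriv F)"
    using c fps_conv_radius_deriv[of F] by (rule less_le_trans)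
  \<comment> \<open>As polynomials, the two coefficient series have infinite radius of convergence
    and evaluate by \<open>poly\<close>.\<close>
  have poly: "1 + (fps_const (- 2 * z) * fps_X + fps_X ^ 2) = fps_of_poly [:1, - 2 * z, 1:]"
    "fps_const (- 2 * z) + 2 * fps_X = fps_of_poly [:- 2 * z, 2:]"
    by (simp_all add: fps_of_poly_pCons power2_eq_square algebra_simps numeral_fps_const)
  have "eval_fps (fps_of_poly [:1, - 2 * z, 1:] * fps_deriv F) r
      = eval_fps (fps_const (- \<nu>) * F * fps_of_poly [:- 2 * z, 2:]) r"
    unfolding poly[symmetric] F_def by (simp only: gegenbauer_ode)
  also have "eval_fps (fps_const (- \<nu>) * F * fps_of_poly [:- 2 * z, 2:]) r
      = eval_fps (fps_const (- \<nu>) * F) r * eval_fps (fps_of_poly [:- 2 * z, 2:]) r"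
    by (rule eval_fps_mult) (use c fps_conv_radius_mult[of "fps_const (- \<nu>)" F] in \<open>simp_all add: less_le_trans\<close>)
  also have "eval_fps (fps_const (- \<nu>) * F) r = - \<nu> * eval_fps F r"
    using c by (subst eval_fps_mult) auto
  also have "eval_fps (fps_of_poly [:1, - 2 * z, 1:] * fps_deriv F) r
      = eval_fps (fps_of_poly [:1, - 2 * z, 1:]) r * eval_fps (fps_deriv F) r"
    by (rule eval_fps_mult) (use c' in simp_all)
  finally have "poly [:1, - 2 * z, 1:] r * eval_fps (fps_deriv F) r
     = - \<nu> * eval_fps F r * poly [:- 2 * z, 2:] r" by (simp only: eval_fps_of_poly)
  moreover have "poly [:1, - 2 * z, 1:] r = gen_base r z" "poly [:- 2 * z, 2:] r = - 2 * (z - r)"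
    by (simp_all add: gen_base_def power2_eq_square algebra_simps)
  ultimately have "gen_base r z * eval_fps (fps_deriv F) r = - \<nu> * eval_fps F r * (- 2 * (z - r))"
    by (simp only:)
  then show ?thesis by (simp add: algebra_simps)
qed

text \<open>By the differential equation \<open>F(x) * gen_base x z powr \<nu>\<close> is constant,
  which identifies the generating function \<open>F\<close>. The weights \<open>l + \<nu>\<close>
  come from applying \<open>r d/dr + \<nu>\<close>, and the same equation then produces the
  numerator \<open>1 - r\<^sup>2\<close>.\<close>

lemma gegenbauer_generating:
  assumes z: "\<bar>z\<bar> \<le> 1" and r: "\<bar>r\<bar> < 1"
  shows "(\<lambda>l. (real l + \<nu>) * gegenbauer \<nu> l z * r ^ l) sums (\<nu> * (1 - r\<^sup>2) * gen_base r z powr - (\<nu> + 1))"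
proof -
  define F where "F = Abs_fps (\<lambda>l. gegenbauer \<nu> l z)"
  have c: "ereal (norm r) < fps_conv_radius F" if "\<bar>r\<bar> < 1" for r :: real
    unfolding F_def by (rule less_le_trans[OF _ gegenbauer_conv_radius[OF z]]) (use that in \<open>simp add: one_ereal_def\<close>)
  define h where "h x = eval_fps F x * gen_base x z powr \<nu>" for x
  have "\<exists>k. \<forall>x\<in>{-1<..<1}. h x = k"
  proof (rule has_field_derivative_zero_constant)
    fix x :: real assume "x \<in> {-1<..<1}"
    then have x: "\<bar>x\<bar> < 1" by auto
    have D: "gen_base x z > 0" by (rule gen_base_pos[OF z x])
    have "((\<lambda>x. gen_base x z) has_field_derivative 2 * x - 2 * z) (at x within {-1<..<1})"
      unfolding gen_base_def by (auto intro!: derivative_eq_intros)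
    then have "((\<lambda>x. gen_base x z powr \<nu>) has_field_derivative \<nu> * gen_base x z powr (\<nu> - 1) * (2 * x - 2 * z)) (at x within {-1<..<1})"
      using D by (auto intro!: derivative_eq_intros)
    then have "(h has_field_derivative
        eval_fps (fps_deriv F) x * gen_base x z powr \<nu>
          + \<nu> * gen_base x z powr (\<nu> - 1) * (2 * x - 2 * z) * eval_fps F x) (at x within {-1<..<1})"
      unfolding h_def by (intro DERIV_mult has_field_derivative_eval_fps c x)
    also have "gen_base x z powr \<nu> = gen_base x z powr (\<nu> - 1) * gen_base x z"
      using D by (simp add: powr_diff)
    also have "eval_fps (fps_deriv F) x * (gen_base x z powr (\<nu> - 1) * gen_base x z)
          + \<nu> * gen_base x z powr (\<nu> - 1) * (2 * x - 2 * z) * eval_fps F x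
       = gen_base x z powr (\<nu> - 1) * (gen_base x z * eval_fps (fps_deriv F) x - 2 * \<nu> * (z - x) * eval_fps F x)"
      by (simp add: algebra_simps)
    also have "\<dots> = 0" unfolding F_def using gegenbauer_generating_ode[OF z x] by simp
    finally show "(h has_field_derivative 0) (at x within {-1<..<1})" .
  qed auto
  then obtain k where k: "\<And>x. x \<in> {-1<..<1} \<Longrightarrow> h x = k" by blast
  have "h r = h 0" using k[of r] k[of 0] r by (auto simp: abs_less_iff)
  also have "h 0 = 1" by (simp add: h_def eval_fps_at_0 F_def gen_base_def)
  finally have D: "gen_base r z > 0" and E: "eval_fps F r = gen_base r z powr - \<nu>"
    using gen_base_pos[OF z r] by (auto simp: h_def powr_minus field_simps)
  define W where "W = fps_X * fps_deriv F + fps_const \<nu> * F"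
  have c': "ereal (norm r) < fps_conv_radius (fps_deriv F)"
    using c[OF r] fps_conv_radius_deriv[of F] by (rule less_le_trans)
  have c1: "ereal (norm r) < fps_conv_radius (fps_X * fps_deriv F)"
    using c' fps_conv_radius_mult[of "fps_X" "fps_deriv F"] by (simp add: less_le_trans)
  have c2: "ereal (norm r) < fps_conv_radius (fps_const \<nu> * F)"
    using c[OF r] fps_conv_radius_mult[of "fps_const \<nu>" F] by (simp add: less_le_trans)
  have c3: "ereal (norm r) < fps_conv_radius W"
    unfolding W_def by (rule less_le_trans[OF _ fps_conv_radius_add]) (use c1 c2 in simp)
  have "(\<lambda>l. fps_nth W l * r ^ l) sums eval_fps W r" by (rule sums_eval_fps[OF c3])
  moreover have "fps_nth W l = (real l + \<nu>) * gegenbauer \<nu> l z" for l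
    by (cases l) (simp_all add: W_def F_def algebra_simps)
  moreover have "eval_fps W r = r * eval_fps (fps_deriv F) r + \<nu> * eval_fps F r"
    unfolding W_def using c1 c2 c' c[OF r] by (simp add: eval_fps_add eval_fps_mult)
  moreover have "r * eval_fps (fps_deriv F) r + \<nu> * eval_fps F r = \<nu> * (1 - r\<^sup>2) * gen_base r z powr - (\<nu> + 1)"
  proof -
    have "gen_base r z * (r * eval_fps (fps_deriv F) r + \<nu> * eval_fps F r)
        = r * (gen_base r z * eval_fps (fps_deriv F) r) + gen_base r z * \<nu> * eval_fps F r"
      by (simp add: algebra_simps)
    also have "\<dots> = \<nu> * (1 - r\<^sup>2) * eval_fps F r"
      unfolding F_def gegenbauer_generating_ode[OF z r]
      by (simp add: gen_base_def algebra_simps power2_eq_square)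
    also have "\<dots> = \<nu> * (1 - r\<^sup>2) * (gen_base r z * gen_base r z powr - (\<nu> + 1))"
      unfolding E using D by (simp add: powr_diff powr_minus field_simps)
    finally have "gen_base r z * (r * eval_fps (fps_deriv F) r + \<nu> * eval_fps F r)
      = gen_base r z * (\<nu> * (1 - r\<^sup>2) * gen_base r z powr - (\<nu> + 1))"
      by (simp only: mult_ac)
    then show ?thesis using D by simp
  qed
  ultimately show ?thesis by simp
qed

lemma gen_sum_sums:
  assumes z: "\<bar>z\<bar> \<le> 1" and r: "\<bar>r\<bar> < 1"
  shows "(\<lambda>l. (real (Suc l) + \<nu>) * gegenbauer \<nu> (Suc l) z * r ^ Suc l) sums gen_sum \<nu> r z"
  using sums_split_initial_segment[OF gegenbauer_generating[OF z r], of 1]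
  by (simp add: gen_sum_def algebra_simps)

lemma summable_gen_1:
  assumes "\<bar>r\<bar> < 1"
  shows "summable (\<lambda>l. (real (Suc l) + \<nu>) * gegenbauer \<nu> (Suc l) 1 * r ^ Suc l)"
  using gen_sum_sums[of 1 r] assms by (auto simp: sums_iff simp del: power_Suc)

text \<open>The series starts at degree \<open>1\<close>, so one factor \<open>r\<close> can be
  pulled out and the rest compared with \<open>r = 1/2\<close>. This linear decay becomes the factor
  \<open>exp (- u)\<close> that makes \<open>\<psi>\<close> integrable.\<close>

lemma gen_sum_small:
  assumes z: "\<bar>z\<bar> \<le> 1" and r: "0 \<le> r" "r \<le> 1/2"
  shows "\<bar>gen_sum \<nu> r z\<bar> \<le> 2 * gen_sum \<nu> (1/2) 1 * r"
proof -
  define c where "c l = (real (Suc l) + \<nu>) * gegenbauer \<nu> (Suc l) 1 * (1/2) ^ Suc l" for l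
  have c: "c sums gen_sum \<nu> (1/2) 1" unfolding c_def by (rule gen_sum_sums) auto
  have le: "\<bar>(real (Suc l) + \<nu>) * gegenbauer \<nu> (Suc l) z * r ^ Suc l\<bar> \<le> 2 * r * c l" for l
  proof -
    have "r ^ l \<le> (1/2) ^ l" using r by (intro power_mono) auto
    then have "r ^ Suc l \<le> 2 * r * (1/2) ^ Suc l" using mult_left_mono[of "r ^ l" "(1/2) ^ l" r] r by simp
    then have "\<bar>gegenbauer \<nu> (Suc l) z\<bar> * r ^ Suc l \<le> gegenbauer \<nu> (Suc l) 1 * (2 * r * (1/2) ^ Suc l)"
      using gegenbauer_bound[OF z, of "Suc l"] r gegenbauer_1_nonneg by (intro mult_mono) auto
    then have "(real (Suc l) + \<nu>) * (\<bar>gegenbauer \<nu> (Suc l) z\<bar> * r ^ Suc l)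
        \<le> (real (Suc l) + \<nu>) * (gegenbauer \<nu> (Suc l) 1 * (2 * r * (1/2) ^ Suc l))"
      using nu_pos by (intro mult_left_mono) auto
    then show ?thesis using nu_pos r by (simp add: c_def abs_mult mult_ac del: power_Suc)
  qed
  have s: "summable (\<lambda>l. 2 * r * c l)" using c by (intro summable_mult) (auto simp: sums_iff)
  have s': "summable (\<lambda>l. \<bar>(real (Suc l) + \<nu>) * gegenbauer \<nu> (Suc l) z * r ^ Suc l\<bar>)"
    by (rule summable_comparison_test'[OF s, of 0]) (use le in auto)
  have "gen_sum \<nu> r z = (\<Sum>l. (real (Suc l) + \<nu>) * gegenbauer \<nu> (Suc l) z * r ^ Suc l)"
    using gen_sum_sums[OF z, of r] r by (auto simp: sums_iff simp del: power_Suc)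
  also have "\<bar>\<dots>\<bar> \<le> (\<Sum>l. \<bar>(real (Suc l) + \<nu>) * gegenbauer \<nu> (Suc l) z * r ^ Suc l\<bar>)"
    by (rule summable_rabs[OF s'])
  also have "\<dots> \<le> (\<Sum>l. 2 * r * c l)" by (rule suminf_le[OF le s' s])
  also have "\<dots> = 2 * gen_sum \<nu> (1/2) 1 * r"
    using c suminf_mult[of c "2 * r"] by (simp add: sums_iff)
  finally show ?thesis .
qed

text \<open>For \<open>r \<ge> 1/2\<close> the factor \<open>2 r\<close> in
  \<open>gen_base_eq\<close> is at least \<open>1\<close>. Keeping both
  \<open>(1 - r)\<^sup>2\<close> and \<open>1 - z\<close> serves the estimates away from the
  diagonal as well as those near it.\<close>

lemma gen_sum_large:
  assumes z: "z < 1" and r: "1/2 \<le> r" "r \<le> 1"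
  shows "\<bar>gen_sum \<nu> r z\<bar> \<le> \<nu> * (1 - r\<^sup>2) * ((1 - r)\<^sup>2 + (1 - z)) powr - (\<nu> + 1) + \<nu>"
proof -
  have "2 * r * (1 - z) \<ge> 1 - z" using mult_right_mono[of 1 "2 * r" "1 - z"] z r by simp
  then have "gen_base r z \<ge> (1 - r)\<^sup>2 + (1 - z)" by (simp add: gen_base_eq)
  then have le: "gen_base r z powr - (\<nu> + 1) \<le> ((1 - r)\<^sup>2 + (1 - z)) powr - (\<nu> + 1)"
    using z nu_pos by (intro powr_mono2') (auto simp: add_nonneg_pos)
  have r2: "1 - r\<^sup>2 \<ge> 0" using r by (simp add: power_le_one)
  have "\<bar>gen_sum \<nu> r z\<bar> \<le> \<nu> * ((1 - r\<^sup>2) * gen_base r z powr - (\<nu> + 1)) + \<nu>"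
  proof -
    have "(1 - r\<^sup>2) * gen_base r z powr - (\<nu> + 1) \<ge> 0" using r2 by simp
    then have "\<bar>(1 - r\<^sup>2) * gen_base r z powr - (\<nu> + 1) - 1\<bar> \<le> (1 - r\<^sup>2) * gen_base r z powr - (\<nu> + 1) + 1"
      by linarith
    from mult_left_mono[OF this, of \<nu>] show ?thesis
      using nu_pos by (simp add: gen_sum_def abs_mult distrib_left)
  qed
  also have "\<dots> \<le> \<nu> * ((1 - r\<^sup>2) * ((1 - r)\<^sup>2 + (1 - z)) powr - (\<nu> + 1)) + \<nu>"
    using le r2 nu_pos by (intro add_right_mono mult_left_mono) auto
  finally show ?thesis by (simp add: mult.assoc)
qed

text \<open>Adds the constants for \<open>r \<le> 1/2\<close> and \<open>r > 1/2\<close>; the second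
  carries a factor \<open>2\<close> since there \<open>1 \<le> 2 r\<close>.\<close>

definition gen_bound :: "real \<Rightarrow> real" where
  "gen_bound \<epsilon> = 2 * \<bar>gen_sum \<nu> (1/2) 1\<bar> + 2 * \<nu> * (\<epsilon> powr - (\<nu> + 1) + 1)"

lemma gen_sum_le:
  assumes z: "\<bar>z\<bar> \<le> 1" "z \<le> 1 - \<epsilon>" "\<epsilon> > 0" and r: "0 \<le> r" "r \<le> 1"
  shows "\<bar>gen_sum \<nu> r z\<bar> \<le> gen_bound \<epsilon> * r"
proof (cases "r \<le> 1/2")
  case True
  have "\<bar>gen_sum \<nu> r z\<bar> \<le> 2 * gen_sum \<nu> (1/2) 1 * r" by (rule gen_sum_small) (use z r True in auto)
  also have "\<dots> \<le> gen_bound \<epsilon> * r"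
    using r nu_pos by (intro mult_right_mono) (auto simp: gen_bound_def intro!: add_increasing2)
  finally show ?thesis .
next
  case False
  then have "\<bar>gen_sum \<nu> r z\<bar> \<le> \<nu> * (1 - r\<^sup>2) * ((1 - r)\<^sup>2 + (1 - z)) powr - (\<nu> + 1) + \<nu>"
    using z r by (intro gen_sum_large) auto
  also have "\<dots> \<le> \<nu> * 1 * \<epsilon> powr - (\<nu> + 1) + \<nu>"
  proof -
    have "((1 - r)\<^sup>2 + (1 - z)) powr - (\<nu> + 1) \<le> \<epsilon> powr - (\<nu> + 1)"
      using z nu_pos by (intro powr_mono2') (auto intro: add_increasing)
    moreover have "1 - r\<^sup>2 \<le> 1" "0 \<le> 1 - r\<^sup>2" using r by (auto simp: power_le_one)
    ultimately show ?thesis using nu_pos by (intro add_right_mono mult_mono) auto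
  qed
  also have "\<dots> = \<nu> * (\<epsilon> powr - (\<nu> + 1) + 1) * 1" by (simp add: algebra_simps)
  also have "\<dots> \<le> \<nu> * (\<epsilon> powr - (\<nu> + 1) + 1) * (2 * r)"
    using nu_pos False by (intro mult_left_mono) (auto intro!: mult_nonneg_nonneg)
  also have "\<dots> \<le> gen_bound \<epsilon> * r"
    using r by (simp add: gen_bound_def algebra_simps)
  finally show ?thesis .
qed

end

text \<open>Fixes a Laplace density \<open>\<psi>\<close> of the multiplier through the properties
  supplied by \<open>resolvent_multiplier_laplace\<close>; its series is no longer needed.\<close>

locale resolvent_kernel = gegenbauer_bounded +
  fixes s C :: real and \<psi> :: "real \<Rightarrow> real"
  assumes s_pos: "s > 0"
    and psi_meas [measurable]: "\<psi> \<in> borel_measurable borel"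
    and psi_nonpos: "\<And>u. u \<le> 0 \<Longrightarrow> \<psi> u = 0"
    and psi_integrable: "integrable lborel (\<lambda>u. \<psi> u * exp (- u))"
    and psi_laplace: "\<And>l::nat. l \<ge> 1 \<Longrightarrow> (\<integral>u. \<psi> u * exp (- (real l * u)) \<partial>lborel) = inverse (1 + (real l * (real l + 2 * \<nu>)) powr s)"
    and psi_bound: "\<And>u. 0 < u \<Longrightarrow> u \<le> 1 \<Longrightarrow> \<bar>\<psi> u\<bar> \<le> C * u powr (2 * s - 1)"
begin

text \<open>The summand \<open>\<nu>\<close> is the term \<open>l = 0\<close>, whose multiplier is
  \<open>1\<close> and whose zonal function is \<open>\<nu>\<close>. The integral makes sense at
  \<open>t = 1\<close> when \<open>z < 1\<close>, where the defining series need not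
  converge.\<close>

definition resolvent_fun :: "real \<Rightarrow> real \<Rightarrow> real" where
  "resolvent_fun t z = \<nu> + (\<integral>u. \<psi> u * gen_sum \<nu> (t * exp (- u)) z \<partial>lborel)"

definition psi_norm :: real where "psi_norm = (\<integral>u. \<bar>\<psi> u * exp (- u)\<bar> \<partial>lborel)"

lemma psi_exp_le: "l \<ge> 1 \<Longrightarrow> \<bar>\<psi> u * exp (- (real l * u))\<bar> \<le> \<bar>\<psi> u * exp (- u)\<bar>"
proof (cases "u > 0")
  case True
  assume "l \<ge> 1"
  then have "1 * u \<le> real l * u" using True by (intro mult_right_mono) auto
  then show ?thesis by (simp add: abs_mult mult_left_mono)
qed (simp add: psi_nonpos)

lemma psi_exp_integrable: "l \<ge> 1 \<Longrightarrow> integrable lborel (\<lambda>u. \<psi> u * exp (- (real l * u)))"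
  by (rule Bochner_Integration.integrable_bound[OF psi_integrable]) (use psi_exp_le in auto)

text \<open>The integral of the \<open>l\<close>-th term is at most \<open>psi_norm\<close> times
  its coefficient, and for \<open>t < 1\<close> the coefficients are summable by comparison with
  \<open>z = 1\<close>. Sum and integral may therefore be exchanged.\<close>

lemma resolvent_sums:
  assumes t: "0 \<le> t" "t < 1" and z: "\<bar>z\<bar> \<le> 1"
  shows "(\<lambda>l. inverse (1 + (real l * (real l + 2 * \<nu>)) powr s) * t ^ l * ((real l + \<nu>) * gegenbauer \<nu> l z))
           sums resolvent_fun t z"
proof -
  define c where "c l = (real (Suc l) + \<nu>) * gegenbauer \<nu> (Suc l) z * t ^ Suc l" for l
  define f where "f l u = c l * (\<psi> u * exp (- (real (Suc l) * u)))" for l u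
  have int: "integrable lborel (f l)" for l
    unfolding f_def by (intro integrable_mult_right psi_exp_integrable) auto
  have cb: "\<bar>c l\<bar> \<le> (real (Suc l) + \<nu>) * gegenbauer \<nu> (Suc l) 1 * t ^ Suc l" for l
    using gegenbauer_bound[OF z, of "Suc l"] t nu_pos
    by (auto simp: c_def abs_mult simp del: power_Suc intro!: mult_right_mono mult_left_mono)
  have sum: "summable (\<lambda>l. \<integral>u. \<bar>f l u\<bar> \<partial>lborel)"
  proof (rule summable_comparison_test'[of "\<lambda>l. (real (Suc l) + \<nu>) * gegenbauer \<nu> (Suc l) 1 * t ^ Suc l * psi_norm" 0])
    show "summable (\<lambda>l. (real (Suc l) + \<nu>) * gegenbauer \<nu> (Suc l) 1 * t ^ Suc l * psi_norm)"
      using summable_gen_1[of t] t by (intro summable_mult2) auto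
    fix l
    have "(\<integral>u. \<bar>f l u\<bar> \<partial>lborel) = \<bar>c l\<bar> * (\<integral>u. \<bar>\<psi> u * exp (- (real (Suc l) * u))\<bar> \<partial>lborel)"
      by (simp add: f_def abs_mult del: of_nat_Suc)
    also have "\<dots> \<le> \<bar>c l\<bar> * psi_norm"
      unfolding psi_norm_def using psi_exp_le[of "Suc l"] psi_exp_integrable[of "Suc l"] psi_integrable
      by (intro mult_left_mono integral_mono) (auto simp del: of_nat_Suc)
    also have "\<dots> \<le> (real (Suc l) + \<nu>) * gegenbauer \<nu> (Suc l) 1 * t ^ Suc l * psi_norm"
      using cb by (intro mult_right_mono) (auto simp: psi_norm_def)
    finally show "norm (\<integral>u. \<bar>f l u\<bar> \<partial>lborel) \<le> (real (Suc l) + \<nu>) * gegenbauer \<nu> (Suc l) 1 * t ^ Suc l * psi_norm"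
      by simp
  qed
  have S: "(\<Sum>l. f l u) = \<psi> u * gen_sum \<nu> (t * exp (- u)) z" for u
  proof (cases "u > 0")
    case True
    have "t * exp (- u) < 1 * 1" using t True by (intro mult_strict_mono) auto
    then have "(\<lambda>l. (real (Suc l) + \<nu>) * gegenbauer \<nu> (Suc l) z * (t * exp (- u)) ^ Suc l) sums gen_sum \<nu> (t * exp (- u)) z"
      using t by (intro gen_sum_sums z) auto
    then have "(\<lambda>l. \<psi> u * ((real (Suc l) + \<nu>) * gegenbauer \<nu> (Suc l) z * (t * exp (- u)) ^ Suc l)) sums (\<psi> u * gen_sum \<nu> (t * exp (- u)) z)"
      by (rule sums_mult)
    moreover have "(t * exp (- u)) ^ Suc l = t ^ Suc l * exp (- (real (Suc l) * u))" for l
      unfolding power_mult_distrib exp_of_nat_mult[symmetric] by (simp add: algebra_simps)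
    ultimately have "(\<lambda>l. f l u) sums (\<psi> u * gen_sum \<nu> (t * exp (- u)) z)"
      by (simp only: f_def c_def mult_ac)
    then show ?thesis by (simp add: sums_iff)
  qed (simp add: f_def psi_nonpos)
  have "(\<lambda>l. \<integral>u. f l u \<partial>lborel) sums (\<integral>u. \<psi> u * gen_sum \<nu> (t * exp (- u)) z \<partial>lborel)"
    using sums_integral_if_summable(2)[OF int sum] unfolding S .
  moreover have "(\<integral>u. f l u \<partial>lborel) = inverse (1 + (real (Suc l) * (real (Suc l) + 2 * \<nu>)) powr s) * t ^ Suc l * ((real (Suc l) + \<nu>) * gegenbauer \<nu> (Suc l) z)" for l
  proof -
    have "(\<integral>u. f l u \<partial>lborel) = c l * (\<integral>u. \<psi> u * exp (- (real (Suc l) * u)) \<partial>lborel)"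
      unfolding f_def by (rule integral_mult_right_zero)
    also have "\<dots> = c l * inverse (1 + (real (Suc l) * (real (Suc l) + 2 * \<nu>)) powr s)"
      using psi_laplace[of "Suc l"] by simp
    finally show ?thesis by (simp only: c_def mult_ac)
  qed
  ultimately have "(\<lambda>l. inverse (1 + (real (Suc l) * (real (Suc l) + 2 * \<nu>)) powr s) * t ^ Suc l * ((real (Suc l) + \<nu>) * gegenbauer \<nu> (Suc l) z))
     sums (\<integral>u. \<psi> u * gen_sum \<nu> (t * exp (- u)) z \<partial>lborel)" by (simp only:)
  \<comment> \<open>Restores the term \<open>l = 0\<close>, which the Laplace formula does not
    cover.\<close>
  from sums_Suc[OF this] show ?thesis
    by (simp add: resolvent_fun_def add.commute)
qed

text \<open>The factor \<open>t * exp (- u)\<close> from \<open>gen_sum_le\<close> is at most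
  \<open>exp (- u)\<close>, so the majorant does not depend on \<open>t\<close> and allows the limit
  \<open>t \<rightarrow> 1\<close>.\<close>

lemma resolvent_integrand_le:
  assumes t: "0 \<le> t" "t \<le> 1" and z: "\<bar>z\<bar> \<le> 1" "z \<le> 1 - \<epsilon>" "\<epsilon> > 0"
  shows "\<bar>\<psi> u * gen_sum \<nu> (t * exp (- u)) z\<bar> \<le> gen_bound \<epsilon> * \<bar>\<psi> u * exp (- u)\<bar>"
proof (cases "u > 0")
  case True
  have te: "t * exp (- u) \<le> 1 * exp (- u)" using t by (intro mult_right_mono) auto
  have "t * exp (- u) \<le> 1 * 1" using t True by (intro mult_mono) auto
  then have "\<bar>gen_sum \<nu> (t * exp (- u)) z\<bar> \<le> gen_bound \<epsilon> * (t * exp (- u))"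
    using t z by (intro gen_sum_le) auto
  also have "\<dots> \<le> gen_bound \<epsilon> * exp (- u)"
    using te nu_pos by (intro mult_left_mono) (auto simp: gen_bound_def intro!: add_nonneg_nonneg)
  finally show ?thesis by (simp add: abs_mult mult.left_commute mult_left_mono)
qed (simp add: psi_nonpos)

lemma resolvent_integrand_measurable [measurable]:
  "(\<lambda>u. \<psi> u * gen_sum \<nu> (t * exp (- u)) z) \<in> borel_measurable borel"
  unfolding gen_sum_def gen_base_def by measurable

lemma resolvent_integrable:
  assumes "0 \<le> t" "t \<le> 1" "\<bar>z\<bar> \<le> 1" "z \<le> 1 - \<epsilon>" "\<epsilon> > 0"
  shows "integrable lborel (\<lambda>u. \<psi> u * gen_sum \<nu> (t * exp (- u)) z)"
proof (rule Bochner_Integration.integrable_bound)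
  show "integrable lborel (\<lambda>u. gen_bound \<epsilon> * (\<psi> u * exp (- u)))"
    using psi_integrable by (rule integrable_mult_right)
  have "gen_bound \<epsilon> \<ge> 0" using nu_pos by (auto simp: gen_bound_def intro!: add_nonneg_nonneg)
  then show "AE u in lborel. norm (\<psi> u * gen_sum \<nu> (t * exp (- u)) z) \<le> norm (gen_bound \<epsilon> * (\<psi> u * exp (- u)))"
    using resolvent_integrand_le[OF assms] by (simp add: abs_mult)
qed simp

lemma resolvent_fun_le:
  assumes "0 \<le> t" "t \<le> 1" "\<bar>z\<bar> \<le> 1" "z \<le> 1 - \<epsilon>" "\<epsilon> > 0"
  shows "\<bar>resolvent_fun t z\<bar> \<le> \<nu> + gen_bound \<epsilon> * psi_norm"
proof -
  have "\<bar>\<integral>u. \<psi> u * gen_sum \<nu> (t * exp (- u)) z \<partial>lborel\<bar> \<le> (\<integral>u. \<bar>\<psi> u * gen_sum \<nu> (t * exp (- u)) z\<bar> \<partial>lborel)"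
    by (rule integral_abs_bound)
  also have "\<dots> \<le> (\<integral>u. gen_bound \<epsilon> * \<bar>\<psi> u * exp (- u)\<bar> \<partial>lborel)"
    using resolvent_integrable[OF assms] psi_integrable resolvent_integrand_le[OF assms]
    by (intro integral_mono) auto
  also have "\<dots> = gen_bound \<epsilon> * psi_norm" by (simp add: psi_norm_def)
  finally show ?thesis using nu_pos by (simp add: resolvent_fun_def)
qed

lemma resolvent_fun_tendsto:
  assumes z: "\<bar>z\<bar> \<le> 1" "z < 1"
  shows "((\<lambda>t. resolvent_fun t z) \<longlongrightarrow> resolvent_fun 1 z) (at_left 1)"
proof (rule tendsto_at_left_sequentially[of 0])
  fix S :: "nat \<Rightarrow> real" assume S: "\<And>n. S n < 1" "\<And>n. 0 < S n" "incseq S" "S \<longlonglongrightarrow> 1"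
  have "(\<lambda>n. \<integral>u. \<psi> u * gen_sum \<nu> (S n * exp (- u)) z \<partial>lborel) \<longlonglongrightarrow> (\<integral>u. \<psi> u * gen_sum \<nu> (1 * exp (- u)) z \<partial>lborel)"
  proof (rule integral_dominated_convergence[where w = "\<lambda>u. gen_bound (1 - z) * \<bar>\<psi> u * exp (- u)\<bar>"])
    show "integrable lborel (\<lambda>u. gen_bound (1 - z) * \<bar>\<psi> u * exp (- u)\<bar>)"
      using psi_integrable by (intro integrable_mult_right integrable_abs)
    show "AE u in lborel. norm (\<psi> u * gen_sum \<nu> (S n * exp (- u)) z) \<le> gen_bound (1 - z) * \<bar>\<psi> u * exp (- u)\<bar>" for n
      using resolvent_integrand_le[of "S n" z "1 - z"] S(1,2)[of n] z by auto
    show "AE u in lborel. (\<lambda>n. \<psi> u * gen_sum \<nu> (S n * exp (- u)) z) \<longlonglongrightarrow> \<psi> u * gen_sum \<nu> (1 * exp (- u)) z"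
    proof (rule AE_I2)
      fix u :: real
      show "(\<lambda>n. \<psi> u * gen_sum \<nu> (S n * exp (- u)) z) \<longlonglongrightarrow> \<psi> u * gen_sum \<nu> (1 * exp (- u)) z"
      proof (cases "u > 0")
        case True
        then have "gen_base (1 * exp (- u)) z > 0" by (intro gen_base_pos z) auto
        then show ?thesis unfolding gen_sum_def gen_base_def using S(4)
          by (intro tendsto_intros) auto
      qed (simp add: psi_nonpos)
    qed
  qed (use resolvent_integrand_measurable[of 1 z] resolvent_integrand_measurable in simp_all)
  then show "(\<lambda>n. resolvent_fun (S n) z) \<longlonglongrightarrow> resolvent_fun 1 z"
    unfolding resolvent_fun_def by (intro tendsto_add tendsto_const)
qed simp

end

section \<open>Behaviour near the diagonal\<close>

context resolvent_kernel
begin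

lemma exp_minus_bounds:
  fixes u :: real
  assumes "0 \<le> u" "u \<le> 1"
  shows "1 - exp (- u) \<ge> u / 2" "1 - (exp (- u))\<^sup>2 \<le> 2 * u"
proof -
  have "exp u \<ge> 1 + u" by (rule exp_ge_add_one_self)
  then have "exp (- u) \<le> 1 / (1 + u)" using assms by (simp add: exp_minus divide_simps)
  also have "\<dots> \<le> 1 - u / 2"
    using assms mult_left_mono[of u 1 u] by (simp add: divide_simps) (simp add: algebra_simps)
  finally show "1 - exp (- u) \<ge> u / 2" by simp
  have "exp (- 2 * u) \<ge> 1 + - 2 * u" by (rule exp_ge_add_one_self)
  then show "1 - (exp (- u))\<^sup>2 \<le> 2 * u" by (simp add: exp_double[symmetric] power2_eq_square flip: exp_add)
qed

text \<open>Here \<open>\<rho>\<close> is the chordal distance. For small \<open>u\<close> the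
  integrand is bounded by a multiple of \<open>u powr (2 * s)\<close> times
  \<open>M powr - (2 * \<nu> + 2)\<close> with \<open>M = max u \<rho>\<close>; the two indicators
  record which of \<open>u\<close> and \<open>\<rho>\<close> is the larger. Large \<open>u\<close>
  goes into the integrable first term.\<close>

lemma resolvent_integrand_near_diagonal:
  defines "A \<equiv> 2 * \<bar>gen_sum \<nu> (1/2) 1\<bar> + 2 * \<nu>"
    and "B \<equiv> 2 * \<nu> * \<bar>C\<bar> * 4 powr (\<nu> + 1)"
    and "e \<equiv> 2 * s - 2 * \<nu> - 2"
  assumes \<rho>: "0 < \<rho>" "\<rho> < 1" and z: "z = 1 - \<rho>\<^sup>2 / 2"
  shows "\<bar>\<psi> u * gen_sum \<nu> (exp (- u)) z\<bar>
    \<le> A * \<bar>\<psi> u * exp (- u)\<bar> + B * (\<rho> powr e * indicator {0..\<rho>} u + u powr e * indicator {\<rho>..1} u)"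
proof -
  have "\<rho>\<^sup>2 < 1" using \<rho> by (simp add: power_less_one_iff)
  then have z1: "\<bar>z\<bar> \<le> 1" "z < 1" using \<rho> z by auto
  have B: "B \<ge> 0" "A \<ge> 0" using nu_pos by (auto simp: B_def A_def)
  consider "u \<le> 0" | "exp (- u) \<le> 1/2" "u > 0" | "exp (- u) > 1/2" "u > 0" by linarith
  then show ?thesis
  proof cases
    case 1
    then show ?thesis using B by (auto simp: psi_nonpos intro!: mult_nonneg_nonneg add_nonneg_nonneg)
  next
    case 2
    have "\<bar>gen_sum \<nu> (exp (- u)) z\<bar> \<le> 2 * gen_sum \<nu> (1/2) 1 * exp (- u)"
      by (rule gen_sum_small) (use z1 2 in auto)
    also have "\<dots> \<le> A * exp (- u)" using nu_pos by (intro mult_right_mono) (auto simp: A_def)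
    finally have "\<bar>\<psi> u\<bar> * \<bar>gen_sum \<nu> (exp (- u)) z\<bar> \<le> \<bar>\<psi> u\<bar> * (A * exp (- u))"
      by (rule mult_left_mono) simp
    then have "\<bar>\<psi> u * gen_sum \<nu> (exp (- u)) z\<bar> \<le> A * \<bar>\<psi> u * exp (- u)\<bar>"
      by (simp add: abs_mult mult.left_commute)
    moreover have "0 \<le> B * (\<rho> powr e * indicator {0..\<rho>} u + u powr e * indicator {\<rho>..1} u)"
      using B by (intro mult_nonneg_nonneg add_nonneg_nonneg) auto
    ultimately show ?thesis by linarith
  next
    case 3
    have u1: "u \<le> 1"
    proof (rule ccontr)
      assume "\<not> u \<le> 1"
      then have "exp u \<ge> 2" using exp_ge_add_one_self[of u] by linarith
      then show False using 3 by (simp add: exp_minus field_simps)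
    qed
    define r where "r = exp (- u)"
    define M where "M = max u \<rho>"
    have M: "M > 0" using \<rho> by (simp add: M_def)
    have "\<bar>gen_sum \<nu> r z\<bar> \<le> \<nu> * (1 - r\<^sup>2) * ((1 - r)\<^sup>2 + (1 - z)) powr - (\<nu> + 1) + \<nu>"
      by (rule gen_sum_large) (use 3 z1 in \<open>auto simp: r_def\<close>)
    also have "\<dots> \<le> \<nu> * (2 * u) * (4 powr (\<nu> + 1) * M powr - (2 * \<nu> + 2)) + \<nu>"
    proof -
      have "(u / 2)\<^sup>2 \<le> (1 - r)\<^sup>2" using exp_minus_bounds(1)[of u] 3 u1 by (intro power_mono) (auto simp: r_def)
      \<comment> \<open>If \<open>u \<le> \<rho>\<close> the summand
        \<open>1 - z = \<rho>\<^sup>2 / 2\<close> suffices; otherwise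
        \<open>1 - r \<ge> u / 2\<close> does.\<close>
      then have "M\<^sup>2 / 4 \<le> (1 - r)\<^sup>2 + (1 - z)"
        using zero_le_power2[of \<rho>] zero_le_power2[of "1 - r"]
        unfolding M_def z max_def power_divide by (cases "u \<le> \<rho>"; simp; linarith)
      then have "((1 - r)\<^sup>2 + (1 - z)) powr - (\<nu> + 1) \<le> (M\<^sup>2 / 4) powr - (\<nu> + 1)"
        using nu_pos M by (intro powr_mono2') auto
      also have "(M\<^sup>2 / 4) powr - (\<nu> + 1) = 4 powr (\<nu> + 1) * (M\<^sup>2) powr - (\<nu> + 1)"
      proof -
        have "(M\<^sup>2 / 4) powr - (\<nu> + 1) = (M\<^sup>2) powr - (\<nu> + 1) / 4 powr - (\<nu> + 1)" by (simp add: powr_divide)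
        also have "4 powr - (\<nu> + 1) = inverse ((4::real) powr (\<nu> + 1))" by (rule powr_minus)
        finally show ?thesis by (simp only: divide_inverse inverse_inverse_eq mult.commute)
      qed
      also have "(M\<^sup>2) powr - (\<nu> + 1) = M powr - (2 * \<nu> + 2)"
      proof -
        have "M powr 2 = M\<^sup>2" by (rule powr_numeral) (use M in linarith)
        moreover have "(M powr 2) powr - (\<nu> + 1) = M powr (2 * - (\<nu> + 1))" by (rule powr_powr)
        ultimately show ?thesis by (simp add: algebra_simps)
      qed
      finally have 4: "((1 - r)\<^sup>2 + (1 - z)) powr - (\<nu> + 1) \<le> 4 powr (\<nu> + 1) * M powr - (2 * \<nu> + 2)" .
      have "1 - r\<^sup>2 \<le> 2 * u" using exp_minus_bounds(2)[of u] 3 u1 by (simp add: r_def)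
      then show ?thesis using 4 nu_pos 3 by (intro add_right_mono mult_mono mult_left_mono) auto
    qed
    finally have g: "\<bar>gen_sum \<nu> r z\<bar> \<le> 2 * \<nu> * 4 powr (\<nu> + 1) * (u * M powr - (2 * \<nu> + 2)) + \<nu>"
      by (simp add: mult_ac)
    \<comment> \<open>The additive constant \<open>\<nu>\<close> has no factor \<open>r\<close> of
      its own; \<open>r > 1/2\<close> supplies one at the cost of a factor \<open>2\<close>, which
      \<open>A\<close> contains.\<close>
    have \<nu>r: "\<nu> \<le> A * r"
    proof -
      have "\<nu> * 1 \<le> \<nu> * (2 * r)" using nu_pos 3 by (intro mult_left_mono) (auto simp: r_def)
      also have "\<dots> \<le> A * r" using 3 by (auto simp: A_def algebra_simps r_def)
      finally show ?thesis by simp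
    qed
    have "\<bar>\<psi> u\<bar> \<le> \<bar>C\<bar> * u powr (2 * s - 1)"
      by (rule order_trans[OF psi_bound mult_right_mono]) (use 3 u1 in auto)
    then have "\<bar>\<psi> u\<bar> * (2 * \<nu> * 4 powr (\<nu> + 1) * (u * M powr - (2 * \<nu> + 2)))
       \<le> \<bar>C\<bar> * u powr (2 * s - 1) * (2 * \<nu> * 4 powr (\<nu> + 1) * (u * M powr - (2 * \<nu> + 2)))"
      using nu_pos 3 by (intro mult_right_mono) auto
    also have "\<dots> = B * ((u powr (2 * s - 1) * u) * M powr - (2 * \<nu> + 2))"
      by (simp add: B_def mult_ac)
    also have "u powr (2 * s - 1) * u = u powr (2 * s)" using 3 by (simp add: powr_diff)
    also have "B * (u powr (2 * s) * M powr - (2 * \<nu> + 2))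
      \<le> B * (\<rho> powr e * indicator {0..\<rho>} u + u powr e * indicator {\<rho>..1} u)"
    proof (intro mult_left_mono B)
      show "u powr (2 * s) * M powr - (2 * \<nu> + 2) \<le> \<rho> powr e * indicator {0..\<rho>} u + u powr e * indicator {\<rho>..1} u"
      proof (cases "u \<le> \<rho>")
        case True
        have "u powr (2 * s) \<le> \<rho> powr (2 * s)" using 3 True s_pos by (intro powr_mono2) auto
        then have "u powr (2 * s) * \<rho> powr - (2 * \<nu> + 2) \<le> \<rho> powr (2 * s) * \<rho> powr - (2 * \<nu> + 2)"
          by (intro mult_right_mono) auto
        also have "\<dots> = \<rho> powr e" by (simp add: e_def algebra_simps flip: powr_add)
        finally have "u powr (2 * s) * M powr - (2 * \<nu> + 2) \<le> \<rho> powr e" using True by (simp add: M_def max_def)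
        then show ?thesis using True 3 by (auto intro!: add_increasing2)
      next
        case False
        have "u powr (2 * s) * u powr - (2 * \<nu> + 2) = u powr e" by (simp add: e_def algebra_simps flip: powr_add)
        then show ?thesis using False 3 u1 by (simp add: M_def max_def)
      qed
    qed
    finally have 5: "\<bar>\<psi> u\<bar> * (2 * \<nu> * 4 powr (\<nu> + 1) * (u * M powr - (2 * \<nu> + 2)))
       \<le> B * (\<rho> powr e * indicator {0..\<rho>} u + u powr e * indicator {\<rho>..1} u)" .
    have "\<bar>\<psi> u * gen_sum \<nu> r z\<bar> \<le> \<bar>\<psi> u\<bar> * (2 * \<nu> * 4 powr (\<nu> + 1) * (u * M powr - (2 * \<nu> + 2)) + A * r)"
      unfolding abs_mult using g \<nu>r by (intro mult_left_mono) auto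
    also have "\<dots> \<le> A * \<bar>\<psi> u * r\<bar> + B * (\<rho> powr e * indicator {0..\<rho>} u + u powr e * indicator {\<rho>..1} u)"
      using 5 by (simp add: distrib_left abs_mult r_def mult_ac)
    finally show ?thesis by (simp add: r_def)
  qed
qed

text \<open>The interval up to \<open>\<rho>\<close> contributes
  \<open>\<rho> powr e * \<rho>\<close>. The integral \<open>J\<close> from \<open>\<rho>\<close> to
  \<open>1\<close> stays a parameter because the power case and the logarithmic case evaluate it by
  different antiderivatives.\<close>

lemma resolvent_fun_near_diagonal:
  obtains A B where "A \<ge> 0" "B \<ge> 0"
    "\<And>\<rho> J. 0 < \<rho> \<Longrightarrow> \<rho> < 1 \<Longrightarrow>
       has_bochner_integral lborel (\<lambda>u. u powr (2 * s - 2 * \<nu> - 2) * indicator {\<rho>..1} u) J \<Longrightarrow>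
       \<bar>resolvent_fun 1 (1 - \<rho>\<^sup>2 / 2)\<bar> \<le> A + B * (\<rho> powr (2 * s - 2 * \<nu> - 1) + J)"
proof -
  define A where "A = 2 * \<bar>gen_sum \<nu> (1/2) 1\<bar> + 2 * \<nu>"
  define B where "B = 2 * \<nu> * \<bar>C\<bar> * 4 powr (\<nu> + 1)"
  define e where "e = 2 * s - 2 * \<nu> - 2"
  have AB: "A \<ge> 0" "B \<ge> 0" using nu_pos by (auto simp: A_def B_def)
  have P: "psi_norm \<ge> 0" by (simp add: psi_norm_def)
  show thesis
  proof (rule that[of "\<nu> + A * psi_norm" B])
    fix \<rho> J :: real
    assume \<rho>: "0 < \<rho>" "\<rho> < 1"
      and J: "has_bochner_integral lborel (\<lambda>u. u powr (2 * s - 2 * \<nu> - 2) * indicator {\<rho>..1} u) J"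
    define z where "z = 1 - \<rho>\<^sup>2 / 2"
    have "\<rho>\<^sup>2 < 1" using \<rho> by (simp add: power_less_one_iff)
    then have z: "\<bar>z\<bar> \<le> 1" "z \<le> 1 - \<rho>\<^sup>2 / 2" "\<rho>\<^sup>2 / 2 > 0" using \<rho> by (auto simp: z_def)
    have i2: "has_bochner_integral lborel (\<lambda>u. \<rho> powr e * indicator {0..\<rho>} u) (\<rho> powr e * \<rho>)"
      using \<rho> has_bochner_integral_mult_right[OF has_bochner_integral_real_indicator[of "{0..\<rho>}" lborel], of "\<rho> powr e"] by simp
    have i1: "has_bochner_integral lborel (\<lambda>u. \<bar>\<psi> u * exp (- u)\<bar>) psi_norm"
      unfolding psi_norm_def using psi_integrable by (intro has_bochner_integral_integrable) auto
    have i: "has_bochner_integral lborel (\<lambda>u. A * \<bar>\<psi> u * exp (- u)\<bar> + B * (\<rho> powr e * indicator {0..\<rho>} u + u powr e * indicator {\<rho>..1} u))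
       (A * psi_norm + B * (\<rho> powr e * \<rho> + J))"
      by (intro has_bochner_integral_add has_bochner_integral_mult_right i1 i2 J[folded e_def])
    have "\<bar>\<integral>u. \<psi> u * gen_sum \<nu> (1 * exp (- u)) z \<partial>lborel\<bar> \<le> (\<integral>u. \<bar>\<psi> u * gen_sum \<nu> (1 * exp (- u)) z\<bar> \<partial>lborel)"
      by (rule integral_abs_bound)
    also have "\<dots> \<le> (\<integral>u. A * \<bar>\<psi> u * exp (- u)\<bar> + B * (\<rho> powr e * indicator {0..\<rho>} u + u powr e * indicator {\<rho>..1} u) \<partial>lborel)"
    proof (rule integral_mono)
      show "integrable lborel (\<lambda>u. \<bar>\<psi> u * gen_sum \<nu> (1 * exp (- u)) z\<bar>)"
        using resolvent_integrable[of 1 z "\<rho>\<^sup>2 / 2"] z by simp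
      show "integrable lborel (\<lambda>u. A * \<bar>\<psi> u * exp (- u)\<bar> + B * (\<rho> powr e * indicator {0..\<rho>} u + u powr e * indicator {\<rho>..1} u))"
        using i by (simp add: has_bochner_integral_iff)
      show "\<bar>\<psi> u * gen_sum \<nu> (1 * exp (- u)) z\<bar> \<le> A * \<bar>\<psi> u * exp (- u)\<bar> + B * (\<rho> powr e * indicator {0..\<rho>} u + u powr e * indicator {\<rho>..1} u)" for u
        using resolvent_integrand_near_diagonal[OF \<rho> z_def, of u] by (simp add: A_def B_def e_def)
    qed
    also have "\<dots> = A * psi_norm + B * (\<rho> powr e * \<rho> + J)" by (rule has_bochner_integral_integral_eq[OF i])
    also have "\<rho> powr e * \<rho> = \<rho> powr (2 * s - 2 * \<nu> - 1)"
    proof -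
      have "\<rho> powr e * \<rho> powr 1 = \<rho> powr (e + 1)" by (rule powr_add[symmetric])
      then show ?thesis using \<rho> by (simp add: e_def algebra_simps)
    qed
    finally show "\<bar>resolvent_fun 1 (1 - \<rho>\<^sup>2 / 2)\<bar> \<le> \<nu> + A * psi_norm + B * (\<rho> powr (2 * s - 2 * \<nu> - 1) + J)"
      using nu_pos unfolding resolvent_fun_def z_def by linarith
  qed (use AB P nu_pos in auto)
qed

lemma resolvent_fun_diagonal_power:
  assumes "2 * s < 2 * \<nu> + 1"
  obtains B where "\<And>\<rho>. 0 < \<rho> \<Longrightarrow> \<rho> < 1 \<Longrightarrow> \<bar>resolvent_fun 1 (1 - \<rho>\<^sup>2 / 2)\<bar> \<le> B * \<rho> powr (2 * s - 2 * \<nu> - 1)"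
proof -
  obtain A B where AB: "A \<ge> 0" "B \<ge> 0" and le: "\<And>\<rho> J. 0 < \<rho> \<Longrightarrow> \<rho> < 1 \<Longrightarrow>
       has_bochner_integral lborel (\<lambda>u. u powr (2 * s - 2 * \<nu> - 2) * indicator {\<rho>..1} u) J \<Longrightarrow>
       \<bar>resolvent_fun 1 (1 - \<rho>\<^sup>2 / 2)\<bar> \<le> A + B * (\<rho> powr (2 * s - 2 * \<nu> - 1) + J)"
    using resolvent_fun_near_diagonal by blast
  define p where "p = 2 * \<nu> + 1 - 2 * s"
  have p: "p > 0" using assms by (simp add: p_def)
  show thesis
  proof (rule that[of "A + B * (1 + 1 / p)"])
    fix \<rho> :: real assume \<rho>: "0 < \<rho>" "\<rho> < 1"
    have "has_bochner_integral lborel (\<lambda>u. u powr (- p - 1) * indicator {\<rho>..1} u) (- (1 powr - p) / p - - (\<rho> powr - p) / p)"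
    proof (rule has_bochner_integral_FTC_Icc_nonneg)
      fix x assume x: "x \<in> {\<rho>..1}"
      show "((\<lambda>x. - (x powr - p) / p) has_real_derivative x powr (- p - 1)) (at x)"
        using x \<rho> p by (auto intro!: derivative_eq_intros)
    qed (use \<rho> in auto)
    then have "\<bar>resolvent_fun 1 (1 - \<rho>\<^sup>2 / 2)\<bar> \<le> A + B * (\<rho> powr - p + (- (1 powr - p) / p - - (\<rho> powr - p) / p))"
    proof -
      have e: "2 * s - 2 * \<nu> - 2 = - p - 1" "2 * s - 2 * \<nu> - 1 = - p" by (simp_all add: p_def)
      assume "has_bochner_integral lborel (\<lambda>u. u powr (- p - 1) * indicator {\<rho>..1} u) (- (1 powr - p) / p - - (\<rho> powr - p) / p)"
      from le[OF \<rho>, unfolded e, OF this] show ?thesis .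
    qed
    also have "\<dots> \<le> A * \<rho> powr - p + B * (\<rho> powr - p + \<rho> powr - p / p)"
    proof (intro add_mono mult_left_mono AB)
      \<comment> \<open>The bounded part is absorbed into the singular one.\<close>
      have "1 \<le> \<rho> powr - p" using \<rho> p powr_mono'[of "- p" 0 \<rho>] by simp
      then show "A \<le> A * \<rho> powr - p" using mult_left_mono[of 1 "\<rho> powr - p" A] AB by simp
    qed (use p in auto)
    also have "\<dots> = (A + B * (1 + 1 / p)) * \<rho> powr - p" by (simp add: algebra_simps)
    also have "- p = 2 * s - 2 * \<nu> - 1" by (simp add: p_def)
    finally show "\<bar>resolvent_fun 1 (1 - \<rho>\<^sup>2 / 2)\<bar> \<le> (A + B * (1 + 1 / p)) * \<rho> powr (2 * s - 2 * \<nu> - 1)" .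
  qed
qed

lemma resolvent_fun_diagonal_log:
  assumes "2 * s = 2 * \<nu> + 1"
  obtains B where "\<And>\<rho>. 0 < \<rho> \<Longrightarrow> \<rho> \<le> exp (- 1) \<Longrightarrow> \<bar>resolvent_fun 1 (1 - \<rho>\<^sup>2 / 2)\<bar> \<le> B * \<bar>ln \<rho>\<bar>"
proof -
  obtain A B where AB: "A \<ge> 0" "B \<ge> 0" and le: "\<And>\<rho> J. 0 < \<rho> \<Longrightarrow> \<rho> < 1 \<Longrightarrow>
       has_bochner_integral lborel (\<lambda>u. u powr (2 * s - 2 * \<nu> - 2) * indicator {\<rho>..1} u) J \<Longrightarrow>
       \<bar>resolvent_fun 1 (1 - \<rho>\<^sup>2 / 2)\<bar> \<le> A + B * (\<rho> powr (2 * s - 2 * \<nu> - 1) + J)"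
    using resolvent_fun_near_diagonal by blast
  show thesis
  proof (rule that[of "A + B * 2"])
    fix \<rho> :: real assume \<rho>: "0 < \<rho>" "\<rho> \<le> exp (- 1)"
    have "exp (- 1) < (1::real)" by simp
    then have \<rho>1: "\<rho> < 1" using \<rho> by linarith
    have "ln \<rho> \<le> ln (exp (- 1))" using \<rho> by (subst ln_le_cancel_iff) auto
    \<comment> \<open>The restriction \<open>\<rho> \<le> exp (- 1)\<close> makes
      \<open>1 \<le> \<bar>ln \<rho>\<bar>\<close>, so that constants can be absorbed into the
      logarithm.\<close>
    then have l: "ln \<rho> \<le> - 1" by simp
    have e: "2 * s - 2 * \<nu> - 2 = - 1" "2 * s - 2 * \<nu> - 1 = 0" using assms by auto
    have "has_bochner_integral lborel (\<lambda>u. u powr - 1 * indicator {\<rho>..1} u) (ln 1 - ln \<rho>)"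
    proof (rule has_bochner_integral_FTC_Icc_nonneg)
      fix x assume x: "x \<in> {\<rho>..1}"
      show "(ln has_real_derivative x powr - 1) (at x)"
        using x \<rho> by (auto intro!: derivative_eq_intros simp: powr_minus_divide)
    qed (use \<rho> \<rho>1 in auto)
    then have "\<bar>resolvent_fun 1 (1 - \<rho>\<^sup>2 / 2)\<bar> \<le> A + B * (1 + - ln \<rho>)"
      using le[OF \<rho>(1) \<rho>1, of "- ln \<rho>"] \<rho> unfolding e by simp
    also have "\<dots> \<le> A * \<bar>ln \<rho>\<bar> + B * (2 * \<bar>ln \<rho>\<bar>)"
      using l mult_left_mono[of 1 "\<bar>ln \<rho>\<bar>" A] AB by (intro add_mono mult_left_mono) auto
    finally show "\<bar>resolvent_fun 1 (1 - \<rho>\<^sup>2 / 2)\<bar> \<le> (A + B * 2) * \<bar>ln \<rho>\<bar>" by (simp add: algebra_simps)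
  qed
qed

end

section \<open>Real analyticity\<close>

lemma prod_of_monomials:
  fixes y :: "'a \<Rightarrow> real"
  shows "(\<Prod>i\<in>I. \<Prod>b\<in>B. y b ^ \<beta> (g i) b) = (\<Prod>b\<in>B. y b ^ (\<Sum>i\<in>I. \<beta> (g i) b))"
  by (subst prod.swap) (simp add: power_sum)

text \<open>Multiplies out every \<open>P ^ n\<close> into words of length \<open>n\<close> over the
  terms of \<open>P\<close>, and regroups the words by their total exponent. Smallness of
  \<open>P\<close> with absolute coefficients at radius \<open>r\<close> makes the family of all
  words absolutely summable, so regrouping is legitimate.\<close>

lemma real_analytic_at_power_series:
  fixes k :: "'j \<Rightarrow> real" and \<beta> :: "'j \<Rightarrow> 'a::euclidean_space \<Rightarrow> nat" and c :: "nat \<Rightarrow> real"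
  assumes J: "finite J" and P: "\<And>v. P v = (\<Sum>j\<in>J. k j * (\<Prod>b\<in>Basis. (v \<bullet> b) ^ \<beta> j b))"
    and c: "summable (\<lambda>n. \<bar>c n\<bar> * \<rho> ^ n)" and r: "r > 0"
    and small: "(\<Sum>j\<in>J. \<bar>k j\<bar> * (\<Prod>b\<in>(Basis::'a set). r ^ \<beta> j b)) \<le> \<rho>"
  shows "real_analytic_at (\<lambda>x. \<Sum>n. c n * P (x - p) ^ n) p"
proof -
  define W where "W = Sigma (UNIV :: nat set) (\<lambda>n. {..<n} \<rightarrow>\<^sub>E J)"
  define C where "C w = c (fst w) * (\<Prod>i<fst w. k (snd w i))" for w :: "nat \<times> (nat \<Rightarrow> 'j)"
  \<comment> \<open>The total exponent of a word, restricted to \<open>Basis\<close> so that it is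
    extensional as \<open>real_analytic_at\<close> demands.\<close>
  define E where "E w = (\<lambda>b\<in>(Basis::'a set). \<Sum>i<fst w. \<beta> (snd w i) b)" for w :: "nat \<times> (nat \<Rightarrow> 'j)"
  define M where "M \<alpha> v = (\<Prod>b\<in>Basis. (v \<bullet> b) ^ \<alpha> b)" for \<alpha> and v :: 'a
  define R where "R \<alpha> = (\<Prod>b\<in>(Basis::'a set). r ^ \<alpha> b)" for \<alpha> :: "'a \<Rightarrow> nat"
  define S where "S = (\<Sum>j\<in>J. \<bar>k j\<bar> * R (\<beta> j))"
  have S: "S \<ge> 0" "S \<le> \<rho>" using small r by (auto simp: S_def R_def intro!: sum_nonneg mult_nonneg_nonneg prod_nonneg)
  have Rpos: "R \<alpha> > 0" for \<alpha> unfolding R_def using r by (intro prod_pos) auto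
  have finP: "finite ({..<n} \<rightarrow>\<^sub>E J)" for n :: nat by (intro finite_PiE) (use J in auto)
  have E_R: "R (E (n, g)) = (\<Prod>i<n. R (\<beta> (g i)))" for n g
    unfolding R_def E_def by (subst prod_of_monomials) simp
  have E_M: "M (E (n, g)) v = (\<Prod>i<n. M (\<beta> (g i)) v)" for n g v
    unfolding M_def E_def by (subst prod_of_monomials) simp
  have G: "(\<lambda>w. \<bar>C w\<bar> * R (E w)) summable_on W"
    unfolding W_def
  proof (rule summable_on_SigmaI)
    fix n :: nat
    have "(\<Sum>g\<in>{..<n} \<rightarrow>\<^sub>E J. \<bar>C (n, g)\<bar> * R (E (n, g))) = \<bar>c n\<bar> * (\<Sum>g\<in>{..<n} \<rightarrow>\<^sub>E J. \<Prod>i<n. \<bar>k (g i)\<bar> * R (\<beta> (g i)))"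
      by (simp add: C_def E_R abs_mult abs_prod prod.distrib sum_distrib_left mult.assoc)
    also have "(\<Sum>g\<in>{..<n} \<rightarrow>\<^sub>E J. \<Prod>i<n. \<bar>k (g i)\<bar> * R (\<beta> (g i))) = S ^ n"
      using prod_sum_PiE[of "{..<n}" "\<lambda>_. J" "\<lambda>i j. \<bar>k j\<bar> * R (\<beta> j)"] J by (simp add: S_def)
    finally show "((\<lambda>g. \<bar>C (n, g)\<bar> * R (E (n, g))) has_sum \<bar>c n\<bar> * S ^ n) ({..<n} \<rightarrow>\<^sub>E J)"
      using has_sum_finite[OF finP[of n], of "\<lambda>g. \<bar>C (n, g)\<bar> * R (E (n, g))"] by simp
  next
    have "summable (\<lambda>n. norm (\<bar>c n\<bar> * S ^ n))"
    proof (rule summable_comparison_test'[OF c, of 0])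
      fix n
      have "S ^ n \<le> \<rho> ^ n" using S by (intro power_mono) auto
      then show "norm (norm (\<bar>c n\<bar> * S ^ n)) \<le> \<bar>c n\<bar> * \<rho> ^ n"
        using S by (simp add: abs_mult mult_left_mono)
    qed
    then show "(\<lambda>n. \<bar>c n\<bar> * S ^ n) summable_on UNIV" by (rule norm_summable_imp_summable_on)
  qed (simp add: Rpos less_imp_le)
  define fibre where "fibre \<alpha> = {w \<in> W. E w = \<alpha>}" for \<alpha>
  have Cs: "C summable_on fibre \<alpha>" for \<alpha>
  proof -
    have "(\<lambda>w. \<bar>C w\<bar> * R (E w)) summable_on fibre \<alpha>"
      by (rule summable_on_subset_banach[OF G]) (auto simp: fibre_def)
    \<comment> \<open>On a fibre the weight \<open>R (E w)\<close> is the constant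
      \<open>R \<alpha> > 0\<close> and can be divided out.\<close>
    then have "(\<lambda>w. \<bar>C w\<bar> * R (E w) * inverse (R \<alpha>)) summable_on fibre \<alpha>" by (rule summable_on_cmult_left)
    also have "?this \<longleftrightarrow> (\<lambda>w. norm (C w)) summable_on fibre \<alpha>"
      using Rpos[of \<alpha>] by (intro summable_on_cong) (auto simp: fibre_def)
    finally show ?thesis by (rule abs_summable_summable)
  qed
  define c' where "c' \<alpha> = infsum C (fibre \<alpha>)" for \<alpha>
  have main: "((\<lambda>\<alpha>. c' \<alpha> * M \<alpha> v) has_sum (\<Sum>n. c n * P v ^ n)) (Basis \<rightarrow>\<^sub>E UNIV)"
    if v: "\<And>b. b \<in> Basis \<Longrightarrow> \<bar>v \<bullet> b\<bar> \<le> r" for v :: 'a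
  proof -
    have MR: "\<bar>M \<alpha> v\<bar> \<le> R \<alpha>" for \<alpha>
      unfolding M_def R_def abs_prod power_abs using v by (intro prod_mono) (auto intro: power_mono)
    have Fs: "(\<lambda>w. C w * M (E w) v) summable_on W"
    proof (rule abs_summable_summable, rule summable_on_comparison_test[OF G])
      show "norm (C w * M (E w) v) \<le> \<bar>C w\<bar> * R (E w)" for w
        using MR[of "E w"] by (simp add: abs_mult mult_left_mono)
    qed auto
    have Pv: "\<bar>P v\<bar> \<le> \<rho>"
    proof -
      have "\<bar>P v\<bar> \<le> (\<Sum>j\<in>J. \<bar>k j * M (\<beta> j) v\<bar>)" unfolding P M_def by (rule sum_abs)
      also have "\<dots> \<le> S" unfolding S_def abs_mult by (intro sum_mono mult_left_mono MR) auto
      finally show ?thesis using S by simp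
    qed
    have "((\<lambda>w. C w * M (E w) v) has_sum (\<Sum>n. c n * P v ^ n)) W"
      unfolding W_def
    proof (rule has_sum_SigmaI)
      fix n :: nat
      have "(\<Sum>g\<in>{..<n} \<rightarrow>\<^sub>E J. C (n, g) * M (E (n, g)) v) = c n * (\<Sum>g\<in>{..<n} \<rightarrow>\<^sub>E J. \<Prod>i<n. k (g i) * M (\<beta> (g i)) v)"
        by (simp add: C_def E_M prod.distrib sum_distrib_left mult.assoc)
      also have "(\<Sum>g\<in>{..<n} \<rightarrow>\<^sub>E J. \<Prod>i<n. k (g i) * M (\<beta> (g i)) v) = P v ^ n"
        using prod_sum_PiE[of "{..<n}" "\<lambda>_. J" "\<lambda>i j. k j * M (\<beta> j) v"] J by (simp add: P M_def)
      finally show "((\<lambda>g. C (n, g) * M (E (n, g)) v) has_sum c n * P v ^ n) ({..<n} \<rightarrow>\<^sub>E J)"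
        using has_sum_finite[OF finP[of n], of "\<lambda>g. C (n, g) * M (E (n, g)) v"] by simp
    next
      have ns: "summable (\<lambda>n. norm (c n * P v ^ n))"
      proof (rule summable_comparison_test'[OF c, of 0])
        fix n
        have "\<bar>P v\<bar> ^ n \<le> \<rho> ^ n" using Pv by (intro power_mono) auto
        then show "norm (norm (c n * P v ^ n)) \<le> \<bar>c n\<bar> * \<rho> ^ n"
          by (simp add: abs_mult power_abs mult_left_mono)
      qed
      then show "((\<lambda>n. c n * P v ^ n) has_sum (\<Sum>n. c n * P v ^ n)) UNIV"
        by (rule norm_summable_imp_has_sum[OF _ summable_sums[OF summable_norm_cancel]]) (use ns in simp_all)
    next
      show "(\<lambda>w. C w * M (E w) v) summable_on (SIGMA n:UNIV. {..<n} \<rightarrow>\<^sub>E J)"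
        using Fs by (simp only: W_def)
    qed
    \<comment> \<open>Each word lies in exactly one fibre, so the sum over words is a sum over
      exponents and fibres.\<close>
    moreover have "bij_betw snd (Sigma (Basis \<rightarrow>\<^sub>E UNIV) fibre) W"
      by (rule bij_betw_byWitness[of _ "\<lambda>w. (E w, w)"]) (auto simp: fibre_def E_def)
    ultimately have "((\<lambda>x. C (snd x) * M (E (snd x)) v) has_sum (\<Sum>n. c n * P v ^ n)) (Sigma (Basis \<rightarrow>\<^sub>E UNIV) fibre)"
      using has_sum_reindex_bij_betw[of snd _ W "\<lambda>w. C w * M (E w) v"] by blast
    then show ?thesis
    proof (rule has_sum_SigmaD)
      fix \<alpha> :: "'a \<Rightarrow> nat"
      have "((\<lambda>w. C w * M \<alpha> v) has_sum c' \<alpha> * M \<alpha> v) (fibre \<alpha>)"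
        unfolding c'_def by (intro has_sum_cmult_left has_sum_infsum Cs)
      then show "((\<lambda>w. C (snd (\<alpha>, w)) * M (E (snd (\<alpha>, w))) v) has_sum c' \<alpha> * M \<alpha> v) (fibre \<alpha>)"
        by (rule has_sum_cong[THEN iffD1, rotated]) (auto simp: fibre_def)
    qed
  qed
  show ?thesis unfolding real_analytic_at_def
  proof (intro exI[of _ r] exI[of _ c'] conjI ballI r)
    fix x assume x: "x \<in> ball p r"
    have "\<bar>(x - p) \<bullet> b\<bar> \<le> r" if "b \<in> Basis" for b
    proof -
      have "\<bar>(x - p) \<bullet> b\<bar> \<le> norm (x - p)" by (rule Basis_le_norm[OF that])
      then show ?thesis using x by (simp add: dist_norm norm_minus_commute)
    qed
    from main[OF this] show "((\<lambda>\<alpha>. c' \<alpha> * (\<Prod>b\<in>Basis. ((x - p) \<bullet> b) ^ \<alpha> b)) has_sum (\<Sum>n. c n * P (x - p) ^ n)) (Basis \<rightarrow>\<^sub>E UNIV)"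
      by (simp add: M_def)
  qed
qed

text \<open>In the increments of both arguments, the change of the inner product is a polynomial of
  degree \<open>2\<close> without constant term, so its absolute value sum falls below any
  \<open>\<rho> > 0\<close> on a small enough box.\<close>

lemma real_analytic_at_power_series_inner:
  fixes p q :: "'a::euclidean_space" and c :: "nat \<Rightarrow> real"
  assumes c: "summable (\<lambda>n. \<bar>c n\<bar> * \<rho> ^ n)" and \<rho>: "\<rho> > 0"
  shows "real_analytic_at (\<lambda>x. \<Sum>n. c n * (fst x \<bullet> snd x - p \<bullet> q) ^ n) (p, q)"
proof -
  let ?B = "Basis :: ('a \<times> 'a) set"
  \<comment> \<open>The left summand of \<open>J\<close> indexes the linear terms, the right one the
    quadratic terms.\<close>
  define J where "J = (?B <+> (?B \<times> ?B))"
  define l where "l e = p \<bullet> snd e + fst e \<bullet> q" for e :: "'a \<times> 'a"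
  define k :: "('a \<times> 'a) + ('a \<times> 'a) \<times> ('a \<times> 'a) \<Rightarrow> real"
    where "k = case_sum l (\<lambda>(e, e'). fst e \<bullet> snd e')"
  define \<beta> :: "('a \<times> 'a) + ('a \<times> 'a) \<times> ('a \<times> 'a) \<Rightarrow> 'a \<times> 'a \<Rightarrow> nat"
    where "\<beta> = case_sum (\<lambda>e b. if b = e then 1 else 0 :: nat) (\<lambda>(e, e') b. (if b = e then 1 else 0) + (if b = e' then 1 else 0))"
  have mono: "(\<Prod>b\<in>?B. y b ^ (if b = e then 1 else 0)) = y e" if "e \<in> ?B" for y :: "'a \<times> 'a \<Rightarrow> real" and e
    using that by (simp add: if_distrib[of "\<lambda>i. _ ^ i"] cong: if_cong)
  have J: "finite J" by (simp add: J_def)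
  have m1: "(\<Prod>b\<in>?B. y b ^ \<beta> (Inl e) b) = y e" if "e \<in> ?B" for y :: "'a \<times> 'a \<Rightarrow> real" and e
    using mono[OF that] by (simp add: \<beta>_def)
  have m2: "(\<Prod>b\<in>?B. y b ^ \<beta> (Inr (e, e')) b) = y e * y e'" if "e \<in> ?B" "e' \<in> ?B" for y :: "'a \<times> 'a \<Rightarrow> real" and e e'
    using mono[OF that(1)] mono[OF that(2)] by (simp only: \<beta>_def sum.case prod.case power_add prod.distrib)
  have sumJ: "(\<Sum>j\<in>J. F j) = (\<Sum>e\<in>?B. F (Inl e)) + (\<Sum>e\<in>?B. \<Sum>e'\<in>?B. F (Inr (e, e')))" for F :: "_ \<Rightarrow> real"
    by (simp add: J_def sum.Plus sum.cartesian_product)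
  define P where "P v = p \<bullet> snd v + fst v \<bullet> q + fst v \<bullet> snd v" for v :: "'a \<times> 'a"
  have P: "P v = (\<Sum>j\<in>J. k j * (\<Prod>b\<in>?B. (v \<bullet> b) ^ \<beta> j b))" for v
  proof -
    have v: "v = (\<Sum>e\<in>?B. (v \<bullet> e) *\<^sub>R e)" by (rule euclidean_representation[symmetric])
    have fs: "fst v = (\<Sum>e\<in>?B. (v \<bullet> e) *\<^sub>R fst e)" "snd v = (\<Sum>e\<in>?B. (v \<bullet> e) *\<^sub>R snd e)"
      by (subst (1) v, simp add: fst_sum snd_sum)+
    have "(\<Sum>j\<in>J. k j * (\<Prod>b\<in>?B. (v \<bullet> b) ^ \<beta> j b))
      = (\<Sum>e\<in>?B. l e * (v \<bullet> e)) + (\<Sum>e\<in>?B. \<Sum>e'\<in>?B. (fst e \<bullet> snd e') * ((v \<bullet> e) * (v \<bullet> e')))"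
      unfolding sumJ by (simp add: m1 m2 k_def)
    also have "(\<Sum>e\<in>?B. l e * (v \<bullet> e)) = p \<bullet> snd v + fst v \<bullet> q"
      unfolding fs by (simp add: inner_sum_right inner_sum_left l_def distrib_left sum.distrib mult.commute)
    also have "(\<Sum>e\<in>?B. \<Sum>e'\<in>?B. (fst e \<bullet> snd e') * ((v \<bullet> e) * (v \<bullet> e'))) = fst v \<bullet> snd v"
      unfolding fs by (subst sum.swap) (simp add: inner_sum_right inner_sum_left sum_distrib_left mult_ac)
    finally show ?thesis by (simp add: P_def)
  qed
  define T where "T = (\<Sum>j\<in>J. \<bar>k j\<bar>)"
  have T: "T \<ge> 0" by (simp add: T_def sum_nonneg)
  \<comment> \<open>The cap at \<open>1\<close> gives \<open>r * r \<le> r\<close>, so every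
    monomial, linear or quadratic, is at most \<open>r\<close>.\<close>
  define r where "r = min 1 (\<rho> / (1 + T))"
  have r: "r > 0" "r \<le> 1" using \<rho> T by (auto simp: r_def)
  have "(\<Sum>j\<in>J. \<bar>k j\<bar> * (\<Prod>b\<in>?B. r ^ \<beta> j b)) \<le> (\<Sum>j\<in>J. \<bar>k j\<bar> * r)"
  proof (intro sum_mono mult_left_mono)
    fix j assume "j \<in> J"
    then consider e where "e \<in> ?B" "j = Inl e" | e e' where "e \<in> ?B" "e' \<in> ?B" "j = Inr (e, e')"
      by (auto simp: J_def)
    then show "(\<Prod>b\<in>?B. r ^ \<beta> j b) \<le> r"
      using m1[of _ "\<lambda>_. r"] m2[of _ _ "\<lambda>_. r"] r by cases (auto simp: mult_le_cancel_left1)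
  qed simp
  also have "\<dots> = T * r" by (simp add: T_def sum_distrib_right)
  also have "\<dots> \<le> (1 + T) * (\<rho> / (1 + T))" using T r by (intro mult_mono) (auto simp: r_def)
  also have "\<dots> = \<rho>" using T by simp
  finally have small: "(\<Sum>j\<in>J. \<bar>k j\<bar> * (\<Prod>b\<in>?B. r ^ \<beta> j b)) \<le> \<rho>" .
  have "P (x - (p, q)) = fst x \<bullet> snd x - p \<bullet> q" for x
    by (simp add: P_def inner_diff_left inner_diff_right inner_commute)
  with real_analytic_at_power_series[OF J P c r(1) small, of "(p, q)"] show ?thesis by simp
qed

context resolvent_kernel
begin

text \<open>With \<open>r = exp (- u)\<close>, expand \<open>(A - 2 r w) powr - (\<nu> + 1)\<close> for \<open>A = gen_base r z\<^sub>0\<close>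
  in powers of \<open>w = z - z\<^sub>0\<close>; since \<open>A \<ge> 2 r (1 - z\<^sub>0)\<close>, the radius is uniform in \<open>u\<close>.\<close>
lemma resolvent_fun_power_series:
  assumes z0: "\<bar>z0\<bar> \<le> 1" "z0 < 1"
  obtains c :: "nat \<Rightarrow> real" where
    "summable (\<lambda>n. \<bar>c n\<bar> * ((1 - z0) / 8) ^ n)"
    "\<And>z. \<bar>z\<bar> \<le> 1 \<Longrightarrow> \<bar>z - z0\<bar> \<le> (1 - z0) / 8 \<Longrightarrow> (\<lambda>n. c n * (z - z0) ^ n) sums resolvent_fun 1 z"
proof -
  \<comment> \<open>Then
    \<open>A u \<ge> 2 * exp (- u) * (1 - z0) = 16 * exp (- u) * \<rho>\<close>, which keeps the
    expansion ratio below \<open>1/4\<close> for all \<open>u\<close>.\<close>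
  define \<rho> where "\<rho> = (1 - z0) / 8"
  have \<rho>: "\<rho> > 0" using z0 by (simp add: \<rho>_def)
  define A where "A u = gen_base (exp (- u)) z0" for u
  define b where "b n = pochhammer (\<nu> + 1) n / fact n" for n
  have b: "b n > 0" for n unfolding b_def using nu_pos by (intro divide_pos_pos pochhammer_pos) auto
  have b0: "b 0 = 1" by (simp add: b_def)
  define k where "k n u = \<nu> * (1 - (exp (- u))\<^sup>2) * A u powr - (\<nu> + 1) * (b n * (2 * exp (- u) / A u) ^ n)" for n u
  \<comment> \<open>Subtracting \<open>\<nu>\<close> at \<open>n = 0\<close> reflects the missing
    degree \<open>0\<close> in \<open>gen_sum\<close>; it returns in \<open>c 0\<close>.\<close>
  define f where "f n u = \<psi> u * (k n u - (if n = 0 then \<nu> else 0))" for n u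
  have [measurable]: "A \<in> borel_measurable borel" unfolding A_def gen_base_def by measurable
  have [measurable]: "f n \<in> borel_measurable borel" for n unfolding f_def k_def by measurable
  \<comment> \<open>Lower bound for \<open>A u\<close> that does not degenerate as \<open>u\<close>
    grows: \<open>1/4\<close> comes from \<open>(1 - r)\<^sup>2\<close> when
    \<open>r \<le> 1/2\<close>, and \<open>1 - z0\<close> from the other term.\<close>
  define a0 where "a0 = min (1/4) (1 - z0)"
  have a0: "a0 > 0" using z0 by (simp add: a0_def)
  have A1: "A u \<ge> 16 * exp (- u) * \<rho>" for u
    unfolding A_def gen_base_eq \<rho>_def by (simp add: field_simps)
  have A2: "A u \<ge> a0" if "u > 0" for u
  proof -
    define t X where "t = 2 * exp (- u) * (1 - z0)" and "X = (1 - exp (- u))\<^sup>2"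
    have At: "A u = X + t" by (simp add: A_def gen_base_eq t_def X_def)
    have X: "X \<ge> 0" "t \<ge> 0" using z0 by (simp_all add: X_def t_def)
    show ?thesis
    proof (cases "exp (- u) \<le> 1/2")
      case True
      then have "(1/2)\<^sup>2 \<le> X" unfolding X_def by (intro power_mono) auto
      then have "1/4 \<le> A u" using At X(2) by (simp add: power2_eq_square)
      then show ?thesis unfolding a0_def by (rule min.coboundedI1)
    next
      case False
      then have "1 * (1 - z0) \<le> t" unfolding t_def using z0 by (intro mult_right_mono) auto
      then have "1 - z0 \<le> A u" using At X(1) by simp
      then show ?thesis unfolding a0_def by (rule min.coboundedI2)
    qed
  qed
  define D where "D n = b n * (1/4) ^ n" for n
  have D: "D n > 0" for n using b[of n] by (simp add: D_def)
  \<comment> \<open>The first summand serves \<open>n \<ge> 1\<close>, the second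
    \<open>n = 0\<close>.\<close>
  define M where "M = \<nu> * a0 powr - (\<nu> + 1) * (2 * \<rho> / a0 * 4) + gen_bound (1 - z0)"
  have gb: "gen_bound (1 - z0) \<ge> 0" using nu_pos by (auto simp: gen_bound_def intro!: add_nonneg_nonneg)
  have M0: "\<nu> * a0 powr - (\<nu> + 1) * (2 * \<rho> / a0 * 4) \<ge> 0" using nu_pos a0 \<rho> by simp
  have fb: "\<bar>f n u\<bar> * \<rho> ^ n \<le> M * D n * \<bar>\<psi> u * exp (- u)\<bar>" for n u
  proof (cases "u > 0")
    case False
    then show ?thesis by (simp add: f_def psi_nonpos)
  next
    case u: True
    define r where "r = exp (- u)"
    have r: "0 < r" "r < 1" using u by (auto simp: r_def)
    have Ap: "A u > 0" using A2[OF u] a0 by linarith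
    show ?thesis
    proof (cases n)
      case 0
      have "k 0 u - \<nu> = gen_sum \<nu> (1 * exp (- u)) z0" by (simp add: k_def b0 gen_sum_def A_def algebra_simps)
      then have "\<bar>f 0 u\<bar> \<le> gen_bound (1 - z0) * \<bar>\<psi> u * exp (- u)\<bar>"
        using resolvent_integrand_le[of 1 z0 "1 - z0" u] z0 by (simp add: f_def)
      also have "\<dots> \<le> M * \<bar>\<psi> u * exp (- u)\<bar>" using M0 by (intro mult_right_mono) (auto simp: M_def)
      finally show ?thesis using 0 by (simp add: b0 D_def)
    next
      case (Suc m)
      define y where "y = 2 * r * \<rho> / A u"
      have y: "0 \<le> y" "y \<le> 1/4" using A1[of u] Ap \<rho> r by (auto simp: y_def r_def field_simps)
      have y': "y \<le> 2 * \<rho> / a0 * r"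
      proof -
        have "2 * r * \<rho> / A u \<le> 2 * r * \<rho> / a0" using A2[OF u] a0 r \<rho> by (intro divide_left_mono mult_pos_pos) auto
        then show ?thesis by (simp add: y_def mult_ac)
      qed
      \<comment> \<open>One factor \<open>y\<close> is kept as a multiple of
        \<open>r = exp (- u)\<close> for integrability against \<open>\<psi>\<close>; the others
        give the geometric decay in \<open>n\<close>.\<close>
      have "y ^ n = y * y ^ m" using Suc by simp
      also have "\<dots> \<le> (2 * \<rho> / a0 * r) * (1/4) ^ m"
        using y y' a0 \<rho> r by (intro mult_mono power_mono) auto
      also have "\<dots> = 2 * \<rho> / a0 * 4 * r * (1/4) ^ n" using Suc by simp
      finally have yn: "y ^ n \<le> 2 * \<rho> / a0 * 4 * r * (1/4) ^ n" .
      have Apw: "A u powr - (\<nu> + 1) \<le> a0 powr - (\<nu> + 1)" using A2[OF u] a0 nu_pos by (intro powr_mono2') auto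
      have r2: "0 \<le> 1 - r\<^sup>2" "1 - r\<^sup>2 \<le> 1" using r by (auto simp: power_le_one)
      have kn: "k n u * \<rho> ^ n = \<nu> * ((1 - r\<^sup>2) * A u powr - (\<nu> + 1)) * (b n * y ^ n)"
        by (simp add: k_def y_def r_def power_mult_distrib power_divide)
      also have "\<dots> \<le> \<nu> * (1 * a0 powr - (\<nu> + 1)) * (b n * (2 * \<rho> / a0 * 4 * r * (1/4) ^ n))"
        using nu_pos b[of n] yn y r2 Apw by (intro mult_mono mult_left_mono) auto
      also have "\<dots> = (\<nu> * a0 powr - (\<nu> + 1) * (2 * \<rho> / a0 * 4)) * D n * r"
        by (simp only: D_def mult_1 mult_ac)
      also have "\<dots> \<le> M * D n * r"
        using gb D[of n] r by (intro mult_right_mono) (auto simp: M_def)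
      finally have 1: "k n u * \<rho> ^ n \<le> M * D n * r" .
      have 2: "k n u * \<rho> ^ n \<ge> 0" unfolding kn using nu_pos b[of n] y r2 by (intro mult_nonneg_nonneg) auto
      have "\<bar>f n u\<bar> * \<rho> ^ n = \<bar>\<psi> u * (k n u * \<rho> ^ n)\<bar>"
        using Suc \<rho> by (simp only: f_def abs_mult) simp
      also have "\<dots> = \<bar>\<psi> u\<bar> * (k n u * \<rho> ^ n)"
        unfolding abs_mult[of "\<psi> u"] abs_of_nonneg[OF 2] ..
      also have "\<dots> \<le> \<bar>\<psi> u\<bar> * (M * D n * r)" using mult_left_mono[OF 1, of "\<bar>\<psi> u\<bar>"] by simp
      also have "\<dots> = M * D n * \<bar>\<psi> u * exp (- u)\<bar>" by (simp add: abs_mult r_def)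
      finally show ?thesis .
    qed
  qed
  have int: "integrable lborel (f n)" for n
  proof (rule Bochner_Integration.integrable_bound)
    show "integrable lborel (\<lambda>u. M * D n / \<rho> ^ n * (\<psi> u * exp (- u)))"
      using psi_integrable by (rule integrable_mult_right)
    have "M * D n / \<rho> ^ n \<ge> 0"
      using M0 gb D[of n] \<rho> by (intro divide_nonneg_nonneg mult_nonneg_nonneg) (auto simp: M_def)
    then show "AE u in lborel. norm (f n u) \<le> norm (M * D n / \<rho> ^ n * (\<psi> u * exp (- u)))"
    proof (intro AE_I2)
      fix u
      have "\<bar>f n u\<bar> \<le> M * D n * \<bar>\<psi> u * exp (- u)\<bar> / \<rho> ^ n"
        using fb[of n u] \<rho> by (simp add: pos_le_divide_eq)
      also have "\<dots> = norm (M * D n / \<rho> ^ n * (\<psi> u * exp (- u)))"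
        using \<open>M * D n / \<rho> ^ n \<ge> 0\<close> by (simp only: real_norm_def abs_mult[of "M * D n / \<rho> ^ n"] abs_of_nonneg) simp
      finally show "norm (f n u) \<le> norm (M * D n / \<rho> ^ n * (\<psi> u * exp (- u)))" by simp
    qed
  qed simp
  have bs: "summable (\<lambda>n. M * D n * psi_norm)"
  proof (intro summable_mult summable_mult2)
    show "summable D"
      using binomial_series_neg[of "1/4" "\<nu> + 1"] by (auto simp: b_def D_def[abs_def] sums_iff)
  qed
  have nb: "(\<integral>u. \<bar>f n u\<bar> \<partial>lborel) * \<rho> ^ n \<le> M * D n * psi_norm" for n
  proof -
    have "(\<integral>u. \<bar>f n u\<bar> \<partial>lborel) * \<rho> ^ n = (\<integral>u. \<bar>f n u\<bar> * \<rho> ^ n \<partial>lborel)" by simp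
    also have "\<dots> \<le> (\<integral>u. M * D n * \<bar>\<psi> u * exp (- u)\<bar> \<partial>lborel)"
      using int psi_integrable fb by (intro integral_mono) auto
    also have "\<dots> = M * D n * psi_norm" by (simp add: psi_norm_def)
    finally show ?thesis .
  qed
  define c where "c n = (\<integral>u. f n u \<partial>lborel) + (if n = 0 then \<nu> else 0)" for n
  show thesis
  proof (rule that[of c, folded \<rho>_def])
    have "\<bar>c n\<bar> * \<rho> ^ n \<le> M * D n * psi_norm" if "n \<ge> 1" for n
    proof -
      have "\<bar>c n\<bar> * \<rho> ^ n \<le> (\<integral>u. \<bar>f n u\<bar> \<partial>lborel) * \<rho> ^ n"
        using that \<rho> by (intro mult_right_mono) (auto simp: c_def)
      then show ?thesis using nb[of n] by linarith
    qed
    then show "summable (\<lambda>n. \<bar>c n\<bar> * \<rho> ^ n)"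
      using \<rho> by (intro summable_comparison_test'[OF bs, of 1]) auto
  next
    fix z assume z: "\<bar>z\<bar> \<le> 1" "\<bar>z - z0\<bar> \<le> \<rho>"
    define w where "w = z - z0"
    have w: "\<bar>w\<bar> \<le> \<rho>" using z by (simp add: w_def)
    have int': "integrable lborel (\<lambda>u. f n u * w ^ n)" for n
      using int by (rule integrable_mult_left)
    have sum: "summable (\<lambda>n. \<integral>u. \<bar>f n u * w ^ n\<bar> \<partial>lborel)"
    proof (rule summable_comparison_test'[OF bs, of 0])
      fix n
      have "(\<integral>u. \<bar>f n u * w ^ n\<bar> \<partial>lborel) = (\<integral>u. \<bar>f n u\<bar> \<partial>lborel) * \<bar>w\<bar> ^ n"
        by (simp only: abs_mult integral_mult_left_zero power_abs)
      also have "\<dots> \<le> (\<integral>u. \<bar>f n u\<bar> \<partial>lborel) * \<rho> ^ n"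
        using w by (intro mult_left_mono power_mono) auto
      finally show "norm (\<integral>u. \<bar>f n u * w ^ n\<bar> \<partial>lborel) \<le> M * D n * psi_norm"
        using nb[of n] by (simp only: real_norm_def abs_of_nonneg[OF Bochner_Integration.integral_nonneg] abs_ge_zero)
    qed
    have S: "(\<Sum>n. f n u * w ^ n) = \<psi> u * gen_sum \<nu> (1 * exp (- u)) z" for u
    proof (cases "u > 0")
      case u: True
      define r where "r = exp (- u)"
      have r: "0 < r" using u by (auto simp: r_def)
      have Ap: "A u > 0" using A2[OF u] a0 by linarith
      define y where "y = 2 * r * w / A u"
      have "\<bar>y\<bar> \<le> 2 * r * \<rho> / A u"
        unfolding y_def using Ap r w by (auto simp: abs_mult intro!: divide_right_mono)
      also have "\<dots> \<le> 1/4" using A1[of u] Ap \<rho> r by (auto simp: r_def field_simps)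
      finally have y: "\<bar>y\<bar> < 1" by simp
      have "(\<lambda>n. \<nu> * (1 - r\<^sup>2) * A u powr - (\<nu> + 1) * (b n * y ^ n)) sums (\<nu> * (1 - r\<^sup>2) * A u powr - (\<nu> + 1) * (1 - y) powr - (\<nu> + 1))"
        unfolding b_def by (intro sums_mult binomial_series_neg y)
      moreover have "\<nu> * (1 - r\<^sup>2) * A u powr - (\<nu> + 1) * (b n * y ^ n) = k n u * w ^ n" for n
        by (simp add: k_def y_def r_def power_mult_distrib power_divide)
      moreover have "A u powr - (\<nu> + 1) * (1 - y) powr - (\<nu> + 1) = gen_base r z powr - (\<nu> + 1)"
      proof -
        have "A u powr - (\<nu> + 1) * (1 - y) powr - (\<nu> + 1) = (A u * (1 - y)) powr - (\<nu> + 1)"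
          using Ap y by (simp add: powr_mult)
        also have "A u * (1 - y) = A u - 2 * r * w" using Ap by (simp add: y_def field_simps)
        also have "\<dots> = gen_base r z" by (simp add: A_def r_def w_def gen_base_def algebra_simps)
        finally show ?thesis .
      qed
      ultimately have "(\<lambda>n. k n u * w ^ n) sums (\<nu> * (1 - r\<^sup>2) * gen_base r z powr - (\<nu> + 1))"
        by (simp add: mult.assoc)
      from sums_diff[OF this sums_single[of 0 "\<lambda>_. \<nu>"]]
      have "(\<lambda>n. k n u * w ^ n - (if n = 0 then \<nu> else 0)) sums gen_sum \<nu> r z"
        by (simp add: gen_sum_def algebra_simps)
      then have "(\<lambda>n. \<psi> u * (k n u * w ^ n - (if n = 0 then \<nu> else 0))) sums (\<psi> u * gen_sum \<nu> r z)"
        by (rule sums_mult)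
      moreover have "\<psi> u * (k n u * w ^ n - (if n = 0 then \<nu> else 0)) = f n u * w ^ n" for n
        by (simp add: f_def algebra_simps)
      ultimately show ?thesis by (simp add: sums_iff r_def)
    qed (simp add: f_def psi_nonpos)
    have "(\<lambda>n. \<integral>u. f n u * w ^ n \<partial>lborel) sums (\<integral>u. \<psi> u * gen_sum \<nu> (1 * exp (- u)) z \<partial>lborel)"
      using sums_integral_if_summable(2)[OF int' sum] unfolding S .
    from sums_add[OF this sums_single[of 0 "\<lambda>_. \<nu>"]]
    have "(\<lambda>n. (\<integral>u. f n u * w ^ n \<partial>lborel) + (if n = 0 then \<nu> else 0)) sums resolvent_fun 1 z"
      by (simp add: resolvent_fun_def add.commute)
    moreover have "(\<integral>u. f n u * w ^ n \<partial>lborel) + (if n = 0 then \<nu> else 0) = c n * w ^ n" for n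
      by (simp add: c_def)
    ultimately show "(\<lambda>n. c n * (z - z0) ^ n) sums resolvent_fun 1 z" by (simp only: w_def)
  qed
qed

end

section \<open>Surface measure and the Poisson kernel\<close>

text \<open>Surface measure as the image under radial projection of \<open>d\<close> times Lebesgue
  measure on the unit ball, so that the cone formula in \<open>sphere_integral\<close> becomes
  integration against a finite measure, with Fubini and dominated convergence at hand.\<close>

definition sphere_measure :: "(real^'n) measure" where
  "sphere_measure = distr (density lborel (\<lambda>x. ennreal (real CARD('n) * indicator (ball 0 1) x))) borel (\<lambda>x. x /\<^sub>R norm x)"

lemma sets_sphere_measure [measurable_cong, simp]: "sets sphere_measure = sets borel"
  and space_sphere_measure [simp]: "space sphere_measure = UNIV"
  by (simp_all add: sphere_measure_def)

lemma ball_density_measurable [measurable]: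
  "(\<lambda>x::real^'n. c * indicator (ball 0 1) x :: real) \<in> borel_measurable borel"
  by (intro borel_measurable_times borel_measurable_indicator) auto

lemma emeasure_sphere_measure:
  fixes A :: "(real^'n) set"
  assumes A: "A \<in> sets borel"
  shows "emeasure sphere_measure A = ennreal (real CARD('n)) * emeasure lborel {x \<in> ball 0 1. x /\<^sub>R norm x \<in> A}"
proof -
  have [measurable]: "(\<lambda>x::real^'n. x /\<^sub>R norm x) -` A \<in> sets borel"
    using measurable_sets_borel[of "\<lambda>x::real^'n. x /\<^sub>R norm x" borel A] A by measurable
  have "emeasure sphere_measure A = emeasure (density lborel (\<lambda>x::real^'n. ennreal (real CARD('n) * indicator (ball 0 1) x))) ((\<lambda>x. x /\<^sub>R norm x) -` A)"
    unfolding sphere_measure_def using A by (subst emeasure_distr) auto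
  also have "\<dots> = (\<integral>\<^sup>+x. ennreal (real CARD('n) * indicator (ball 0 1) x) * indicator ((\<lambda>x. x /\<^sub>R norm x) -` A) x \<partial>lborel)"
    by (subst emeasure_density) auto
  also have "\<dots> = (\<integral>\<^sup>+x. ennreal (real CARD('n)) * indicator {x \<in> ball 0 1. x /\<^sub>R norm x \<in> A} x \<partial>lborel)"
    by (intro nn_integral_cong) (auto split: split_indicator)
  also have "\<dots> = ennreal (real CARD('n)) * emeasure lborel {x \<in> ball 0 1. x /\<^sub>R norm x \<in> A}"
  proof -
    have "{x \<in> ball 0 1. x /\<^sub>R norm x \<in> A} = ball (0::real^'n) 1 \<inter> (\<lambda>x. x /\<^sub>R norm x) -` A" by auto
    then have "{x \<in> ball (0::real^'n) 1. x /\<^sub>R norm x \<in> A} \<in> sets borel" by simp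
    then show ?thesis by (intro nn_integral_cmult_indicator) simp
  qed
  finally show ?thesis .
qed

lemma finite_measure_sphere_measure: "finite_measure (sphere_measure :: (real^'n) measure)"
proof
  have "{x \<in> ball 0 1. x /\<^sub>R norm x \<in> UNIV} = ball (0::real^'n) 1" by auto
  then show "emeasure sphere_measure (space sphere_measure :: (real^'n) set) \<noteq> \<infinity>"
    using emeasure_lborel_ball_finite[of "0::real^'n" 1]
    by (simp add: emeasure_sphere_measure ennreal_mult_eq_top_iff top.not_eq_extremum)
qed

lemma integral_sphere_measure:
  fixes f :: "real^'n \<Rightarrow> real"
  assumes f: "(\<lambda>x. indicator (sphere 0 1) x * f x) \<in> borel_measurable borel"
  shows "(\<integral>x. indicator (sphere 0 1) x * f x \<partial>sphere_measure) = sphere_integral f"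
proof -
  define g where "g x = indicator (sphere 0 1) x * f x" for x
  have [measurable]: "g \<in> borel_measurable borel" using f by (simp add: g_def[abs_def])
  have [measurable]: "ball (0::real^'n) 1 \<in> sets borel" by simp
  have gf: "g (x /\<^sub>R norm x) = f (x /\<^sub>R norm x)" if "x \<noteq> 0" for x
    using that by (simp add: g_def)
  \<comment> \<open>The origin is the one point not projected to the sphere; it affects neither
    measurability nor the integral.\<close>
  have "(\<lambda>x. f (x /\<^sub>R norm x)) = (\<lambda>x. if x = 0 then f 0 else g (x /\<^sub>R norm x))"
    using gf by auto
  then have [measurable]: "(\<lambda>x. f (x /\<^sub>R norm x)) \<in> borel_measurable borel" by simp
  have "(\<integral>x. g x \<partial>sphere_measure) = (\<integral>x. g (x /\<^sub>R norm x) \<partial>density lborel (\<lambda>x::real^'n. ennreal (real CARD('n) * indicator (ball 0 1) x)))"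
    unfolding sphere_measure_def by (rule integral_distr) measurable
  also have "\<dots> = (\<integral>x. (real CARD('n) * indicator (ball 0 1) x) *\<^sub>R g (x /\<^sub>R norm x) \<partial>lborel)"
    by (rule integral_density) auto
  also have "\<dots> = (\<integral>x. real CARD('n) * (indicator (ball 0 1) x *\<^sub>R f (x /\<^sub>R norm x)) \<partial>lborel)"
  proof (rule integral_cong_AE)
    have "AE x in lborel. x \<noteq> (0::real^'n)" by (rule AE_lborel_singleton)
    then show "AE x in lborel. (real CARD('n) * indicator (ball 0 1) x) *\<^sub>R g (x /\<^sub>R norm x) = real CARD('n) * (indicator (ball 0 1) x *\<^sub>R f (x /\<^sub>R norm x))"
      by eventually_elim (simp add: gf)
  qed measurable
  also have "\<dots> = sphere_integral f"
    unfolding sphere_integral_def set_lebesgue_integral_def by simp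
  finally show ?thesis by (simp add: g_def)
qed

definition cap :: "real^'n \<Rightarrow> real \<Rightarrow> (real^'n) set" where
  "cap m \<rho> = {x \<in> sphere 0 1. norm (x - m) \<le> \<rho>}"

lemma cap_borel [measurable]: "cap m \<rho> \<in> sets borel"
proof -
  have "cap m \<rho> = sphere 0 1 \<inter> cball m \<rho>" by (auto simp: cap_def dist_norm norm_minus_commute)
  then show ?thesis by simp
qed

text \<open>The part at distance at least \<open>1 - \<rho>\<close> from the origin of the cone over a cap of radius
  \<open>\<rho>\<close> lies in a ball of radius \<open>2 \<rho>\<close>; by scaling, it makes up a fraction of at least \<open>\<rho>\<close>
  of the cone.\<close>
lemma sphere_measure_cap_le:
  obtains c where "c \<ge> 0"
    "\<And>(m::real^'n) \<rho>. norm m = 1 \<Longrightarrow> \<rho> > 0 \<Longrightarrow> emeasure sphere_measure (cap m \<rho>) \<le> ennreal (c * \<rho> ^ (CARD('n) - 1))"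
proof -
  interpret finite_measure "sphere_measure :: (real^'n) measure" by (rule finite_measure_sphere_measure)
  let ?d = "CARD('n)"
  have d: "?d > 0" by simp
  define v where "v = unit_ball_vol (real ?d)"
  have v: "v \<ge> 0" by (simp add: v_def)
  define T where "T = measure (sphere_measure :: (real^'n) measure) UNIV"
  define c where "c = max T (real ?d * (v * 2 ^ ?d))"
  show thesis
  proof (rule that[of c])
    show "c \<ge> 0" by (simp add: c_def T_def le_max_iff_disj)
    fix m :: "real^'n" and \<rho> :: real assume m: "norm m = 1" and \<rho>: "\<rho> > 0"
    show "emeasure sphere_measure (cap m \<rho>) \<le> ennreal (c * \<rho> ^ (?d - 1))"
    proof (cases "\<rho> < 1")
      case False
      have "emeasure sphere_measure (cap m \<rho>) \<le> ennreal T"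
        unfolding T_def emeasure_eq_measure by (intro ennreal_leI finite_measure_mono) auto
      also have "\<dots> \<le> ennreal (c * \<rho> ^ (?d - 1))"
      proof (intro ennreal_leI)
        have "T * 1 \<le> c * \<rho> ^ (?d - 1)"
          using False by (intro mult_mono one_le_power) (auto simp: c_def T_def le_max_iff_disj)
        then show "T \<le> c * \<rho> ^ (?d - 1)" by simp
      qed
      finally show ?thesis .
    next
      case True
      define G where "G = {x \<in> ball 0 1. x /\<^sub>R norm x \<in> cap m \<rho>}"
      define k where "k = 1 - \<rho>"
      have k: "0 < k" "k < 1" using \<rho> True by (auto simp: k_def)
      have [measurable]: "(\<lambda>x::real^'n. x /\<^sub>R norm x) -` cap m \<rho> \<in> sets borel"
        using measurable_sets_borel[of "\<lambda>x::real^'n. x /\<^sub>R norm x" borel "cap m \<rho>"] by measurable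
      have "G = ball 0 1 \<inter> (\<lambda>x. x /\<^sub>R norm x) -` cap m \<rho>" by (auto simp: G_def)
      then have G[measurable]: "G \<in> sets borel" by simp
      have Gfin: "emeasure lborel G < \<infinity>"
      proof -
        have "emeasure lborel G \<le> emeasure lborel (ball (0::real^'n) 1)"
          by (intro emeasure_mono) (auto simp: G_def)
        then show ?thesis using emeasure_lborel_ball_finite[of "0::real^'n" 1] by (rule le_less_trans)
      qed
      define V where "V = measure lborel G"
      have V: "emeasure lborel G = ennreal V"
        unfolding V_def using Gfin by (intro emeasure_eq_ennreal_measure) auto
      have V0: "V \<ge> 0" by (simp add: V_def)
      \<comment> \<open>Membership in the cone depends only on direction, so its part within radius
        \<open>k\<close> is the cone scaled by \<open>k\<close>.\<close>
      have i: "emeasure lborel (G \<inter> ball 0 k) = ennreal (k ^ ?d * V)"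
      proof -
        have "emeasure lborel (G \<inter> ball 0 k) = emeasure (density (distr lborel borel (\<lambda>x::real^'n. 0 + k *\<^sub>R x)) (\<lambda>_. \<bar>k\<bar> ^ DIM(real^'n))) (G \<inter> ball 0 k)"
          by (subst lborel_affine[of k 0]) (use k in auto)
        also have "\<dots> = ennreal (k ^ ?d) * emeasure (distr lborel borel (\<lambda>x::real^'n. k *\<^sub>R x)) (G \<inter> ball 0 k)"
          using k by (subst emeasure_density) (auto simp: nn_integral_cmult_indicator)
        also have "emeasure (distr lborel borel (\<lambda>x::real^'n. k *\<^sub>R x)) (G \<inter> ball 0 k) = emeasure lborel ((\<lambda>x. k *\<^sub>R x) -` (G \<inter> ball 0 k))"
          by (subst emeasure_distr) auto
        also have "(\<lambda>x. k *\<^sub>R x) -` (G \<inter> ball 0 k) = G"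
        proof -
          have e1: "(k *\<^sub>R x) /\<^sub>R norm (k *\<^sub>R x) = x /\<^sub>R norm x" for x :: "real^'n"
            using k by simp
          have e2: "norm (k *\<^sub>R x) < k \<longleftrightarrow> norm x < 1" for x :: "real^'n" using k by simp
          have e3: "norm x < 1 \<Longrightarrow> norm (k *\<^sub>R x) < 1" for x :: "real^'n"
            using k mult_strict_mono[of k 1 "norm x" 1] by simp
          have "k *\<^sub>R x \<in> G \<inter> ball 0 k \<longleftrightarrow> x \<in> G" for x
            unfolding G_def Int_iff mem_Collect_eq mem_ball_0 e1 e2 using e3 by blast
          then show ?thesis by blast
        qed
        finally show ?thesis using k V0 by (simp add: V ennreal_mult)
      qed
      have o: "emeasure lborel (G - ball 0 k) \<le> ennreal (v * (2 * \<rho>) ^ ?d)"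
      proof -
        have "G - ball 0 k \<subseteq> cball m (2 * \<rho>)"
        proof
          fix x assume x: "x \<in> G - ball 0 k"
          then have n: "norm x < 1" "norm x \<ge> k" "norm (x /\<^sub>R norm x - m) \<le> \<rho>"
            by (auto simp: G_def cap_def)
          have x0: "x \<noteq> 0" using n k by auto
          have "x - x /\<^sub>R norm x = (1 - inverse (norm x)) *\<^sub>R x" by (simp add: algebra_simps)
          then have "norm (x - x /\<^sub>R norm x) = \<bar>1 - inverse (norm x)\<bar> * norm x" by simp
          also have "\<dots> = \<bar>(1 - inverse (norm x)) * norm x\<bar>" by (simp add: abs_mult)
          also have "(1 - inverse (norm x)) * norm x = norm x - 1" using x0 by (simp add: field_simps)
          finally have "norm (x - x /\<^sub>R norm x) \<le> \<rho>" using n by (simp add: k_def)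
          then have "norm (x - m) \<le> \<rho> + \<rho>"
            using norm_triangle_ineq[of "x - x /\<^sub>R norm x" "x /\<^sub>R norm x - m"] n(3) by simp
          then show "x \<in> cball m (2 * \<rho>)" by (simp add: dist_norm norm_minus_commute)
        qed
        then have "emeasure lborel (G - ball 0 k) \<le> emeasure lborel (cball m (2 * \<rho>))"
          by (intro emeasure_mono) auto
        also have "\<dots> = ennreal (v * (2 * \<rho>) ^ ?d)"
          using \<rho> by (subst emeasure_cball) (auto simp: v_def)
        finally show ?thesis .
      qed
      have "emeasure lborel G = emeasure lborel (G \<inter> ball 0 k) + emeasure lborel (G - ball 0 k)"
        by (subst plus_emeasure) (auto intro!: arg_cong[where f="emeasure lborel"])
      also have "\<dots> \<le> ennreal (k ^ ?d * V) + ennreal (v * (2 * \<rho>) ^ ?d)"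
        unfolding i by (intro add_left_mono o)
      finally have "V \<le> k ^ ?d * V + v * (2 * \<rho>) ^ ?d"
      proof -
        have nn: "0 \<le> k ^ ?d * V" "0 \<le> v * (2 * \<rho>) ^ ?d" using k V0 v \<rho> by simp_all
        assume "emeasure lborel G \<le> ennreal (k ^ ?d * V) + ennreal (v * (2 * \<rho>) ^ ?d)"
        then show ?thesis unfolding V ennreal_plus[OF nn, symmetric]
          using nn by (subst (asm) ennreal_le_iff) auto
      qed
      \<comment> \<open>This leaves \<open>(1 - k) * V = \<rho> * V\<close> on the left, and
        cancelling one \<open>\<rho>\<close> gives the exponent \<open>d - 1\<close>.\<close>
      moreover have "k ^ ?d * V \<le> k * V"
        using k V0 power_decreasing[of 1 ?d k] by (intro mult_right_mono) auto
      ultimately have "\<rho> * V \<le> v * (2 * \<rho>) ^ ?d" by (simp add: k_def algebra_simps)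
      also have "\<dots> = \<rho> * (v * 2 ^ ?d * \<rho> ^ (?d - 1))"
        using d by (simp add: power_mult_distrib power_eq_if[of \<rho> ?d])
      finally have VV: "V \<le> v * 2 ^ ?d * \<rho> ^ (?d - 1)" using \<rho> by simp
      have "emeasure sphere_measure (cap m \<rho>) = ennreal (real ?d) * ennreal V"
        unfolding V[symmetric] G_def by (rule emeasure_sphere_measure) simp
      also have "\<dots> = ennreal (real ?d * V)" using V0 by (simp add: ennreal_mult)
      also have "\<dots> \<le> ennreal (c * \<rho> ^ (?d - 1))"
      proof (intro ennreal_leI)
        have "real ?d * V \<le> real ?d * (v * 2 ^ ?d * \<rho> ^ (?d - 1))" by (intro mult_left_mono VV) simp
        also have "\<dots> = (real ?d * (v * 2 ^ ?d)) * \<rho> ^ (?d - 1)" by simp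
        also have "\<dots> \<le> c * \<rho> ^ (?d - 1)" using \<rho> by (intro mult_right_mono) (auto simp: c_def)
        finally show "real ?d * V \<le> c * \<rho> ^ (?d - 1)" .
      qed
      finally show ?thesis .
    qed
  qed
qed


lemma inner_unit_dist:
  assumes "norm x = 1" "norm y = 1"
  shows "x \<bullet> y = 1 - (norm (x - y))\<^sup>2 / 2"
proof -
  have "(norm (x - y))\<^sup>2 = 2 - 2 * (x \<bullet> y)"
    unfolding power2_norm_eq_inner using assms
    by (simp add: inner_diff_left inner_diff_right inner_commute norm_eq_1)
  then show ?thesis by (simp add: field_simps)
qed

section \<open>Uniform bound for the mass of the Poisson kernel\<close>

text \<open>Dyadic decomposition at scale \<open>\<delta> = 1 - t\<close>. At distance about
  \<open>2 ^ k * \<delta>\<close> from \<open>m\<close> the kernel is of order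
  \<open>\<delta> * (2 ^ k * \<delta>) powr - d\<close>, while the cap has measure of order
  \<open>(2 ^ k * \<delta>) ^ (d - 1)\<close>. The products decay like \<open>2 ^ - k\<close>,
  uniformly in \<open>t\<close>.\<close>

lemma poisson_integral_le:
  defines "P \<equiv> \<lambda>t z. (1 - t\<^sup>2) * gen_base t z powr - (real CARD('n) / 2)"
  obtains c where "c \<ge> 0"
    "\<And>t (m::real^'n). 0 \<le> t \<Longrightarrow> t < 1 \<Longrightarrow> norm m = 1 \<Longrightarrow>
       (\<integral>\<^sup>+x. ennreal (indicator (sphere 0 1) x * P t (m \<bullet> x)) \<partial>sphere_measure) \<le> ennreal c"
proof -
  interpret finite_measure "sphere_measure :: (real^'n) measure" by (rule finite_measure_sphere_measure)
  let ?d = "CARD('n)"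
  obtain c0 where c0: "c0 \<ge> 0" "\<And>(m::real^'n) \<rho>. norm m = 1 \<Longrightarrow> \<rho> > 0 \<Longrightarrow>
      emeasure sphere_measure (cap m \<rho>) \<le> ennreal (c0 * \<rho> ^ (?d - 1))"
    using sphere_measure_cap_le by blast
  define T where "T = measure (sphere_measure :: (real^'n) measure) UNIV"
  \<comment> \<open>The base \<open>8\<close> is the denominator in the lower bound for
    \<open>gen_base\<close> below: \<open>4\<close> for the step from scale \<open>k\<close> to
    \<open>k - 1\<close>, and \<open>2\<close> for \<open>t \<ge> 1/2\<close>.\<close>
  define A :: real where "A = 8 powr (real ?d / 2)"
  define c where "c = max ((1/4) powr - (real ?d / 2) * T) (A * 4 * c0)"
  have zx: "m \<bullet> x \<le> 1" if "norm m = 1" "norm x = 1" for m x :: "real^'n"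
    using inner_unit_dist[OF that] zero_le_power2[of "norm (m - x)"] by linarith
  show thesis
  proof (rule that[of c])
    show "c \<ge> 0" by (simp add: c_def T_def le_max_iff_disj)
    fix t :: real and m :: "real^'n" assume t: "0 \<le> t" "t < 1" and m: "norm m = 1"
    have t2: "0 \<le> 1 - t\<^sup>2" using t by (simp add: power_le_one)
    show "(\<integral>\<^sup>+x. ennreal (indicator (sphere 0 1) x * P t (m \<bullet> x)) \<partial>sphere_measure) \<le> ennreal c"
    proof (cases "t < 1/2")
      case True
      have "indicator (sphere 0 1) x * P t (m \<bullet> x) \<le> (1/4) powr - (real ?d / 2)" for x
      proof (cases "norm x = 1")
        case n: True
        have "(1/2)\<^sup>2 \<le> (1 - t)\<^sup>2" using True by (intro power_mono) auto
        moreover have "2 * t * (1 - m \<bullet> x) \<ge> 0" using t zx[OF m n] by simp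
        ultimately have "1/4 \<le> gen_base t (m \<bullet> x)" unfolding gen_base_eq by (simp add: power2_eq_square)
        then have "gen_base t (m \<bullet> x) powr - (real ?d / 2) \<le> (1/4) powr - (real ?d / 2)"
          by (intro powr_mono2') auto
        then have "P t (m \<bullet> x) \<le> 1 * (1/4) powr - (real ?d / 2)"
          unfolding P_def using t t2 by (intro mult_mono) auto
        then show ?thesis using n by simp
      qed simp
      then have "(\<integral>\<^sup>+x. ennreal (indicator (sphere 0 1) x * P t (m \<bullet> x)) \<partial>sphere_measure)
        \<le> (\<integral>\<^sup>+(x::real^'n). ennreal ((1/4) powr - (real ?d / 2)) \<partial>sphere_measure)"
        by (intro nn_integral_mono ennreal_leI)
      also have "\<dots> = ennreal ((1/4) powr - (real ?d / 2) * T)"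
        by (simp add: T_def emeasure_eq_measure ennreal_mult)
      also have "\<dots> \<le> ennreal c" by (intro ennreal_leI) (simp add: c_def)
      finally show ?thesis .
    next
      case False
      define \<delta> where "\<delta> = 1 - t"
      have \<delta>: "0 < \<delta>" using t by (simp add: \<delta>_def)
      define w where "w k = A * (2 * \<delta>) * inverse ((2 ^ k * \<delta>) ^ ?d)" for k
      have w: "w k \<ge> 0" for k using \<delta> by (simp add: w_def A_def)
      define g where "g k x = ennreal (w k) * indicator (cap m (2 ^ k * \<delta>)) x" for k x
      have "ennreal (indicator (sphere 0 1) x * P t (m \<bullet> x)) \<le> (\<Sum>k. g k x)" for x
      proof (cases "norm x = 1")
        case n: True
        define h where "h = norm (x - m)"
        have h: "h \<ge> 0" by (simp add: h_def)
        obtain K where "h / \<delta> < 2 ^ K" using real_arch_pow[of 2 "h / \<delta>"] by auto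
        then have ex: "h \<le> 2 ^ K * \<delta>" using \<delta> by (simp add: field_simps)
        \<comment> \<open>Minimality bounds the distance from below by the previous scale; for
          \<open>k = 0\<close> the term \<open>\<delta>\<^sup>2\<close> alone suffices.\<close>
        define k where "k = (LEAST k. h \<le> 2 ^ k * \<delta>)"
        have k: "h \<le> 2 ^ k * \<delta>" unfolding k_def using ex by (rule LeastI)
        have gb: "gen_base t (m \<bullet> x) = \<delta>\<^sup>2 + t * h\<^sup>2"
          unfolding gen_base_eq inner_unit_dist[OF m n] h_def \<delta>_def by (simp add: norm_minus_commute)
        have "gen_base t (m \<bullet> x) \<ge> (2 ^ k * \<delta>)\<^sup>2 / 8"
        proof (cases k)
          case 0
          have "t * h\<^sup>2 \<ge> 0" using t by simp
          then show ?thesis unfolding gb using 0 zero_le_power2[of \<delta>] by simp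
        next
          case (Suc j)
          then have "\<not> h \<le> 2 ^ j * \<delta>" unfolding k_def by (intro not_less_Least) auto
          then have "(2 ^ j * \<delta>)\<^sup>2 \<le> h\<^sup>2" using \<delta> by (intro power_mono) auto
          moreover have "h\<^sup>2 / 2 \<le> t * h\<^sup>2" using False mult_right_mono[of "1/2" t "h\<^sup>2"] by simp
          moreover have "(2 ^ k * \<delta>)\<^sup>2 / 8 = (2 ^ j * \<delta>)\<^sup>2 / 2" using Suc by (simp add: power_mult_distrib)
          ultimately show ?thesis unfolding gb using zero_le_power2[of \<delta>] by linarith
        qed
        then have "gen_base t (m \<bullet> x) powr - (real ?d / 2) \<le> ((2 ^ k * \<delta>)\<^sup>2 / 8) powr - (real ?d / 2)"
          using \<delta> by (intro powr_mono2') auto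
        also have "\<dots> = ((2 ^ k * \<delta>)\<^sup>2) powr - (real ?d / 2) * A"
        proof -
          have "((2 ^ k * \<delta>)\<^sup>2 / 8) powr - (real ?d / 2) = ((2 ^ k * \<delta>)\<^sup>2) powr - (real ?d / 2) / 8 powr - (real ?d / 2)"
            by (rule powr_divide)
          also have "8 powr - (real ?d / 2) = inverse A" unfolding A_def by (rule powr_minus)
          finally show ?thesis by (simp only: divide_inverse inverse_inverse_eq)
        qed
        also have "((2 ^ k * \<delta>)\<^sup>2) powr - (real ?d / 2) = inverse ((2 ^ k * \<delta>) ^ ?d)"
        proof -
          define y where "y = 2 ^ k * \<delta>"
          have y: "y > 0" using \<delta> by (simp add: y_def)
          have "y powr 2 = y\<^sup>2" by (rule powr_numeral) (use y in linarith)
          moreover have "(y powr 2) powr - (real ?d / 2) = y powr (2 * - (real ?d / 2))" by (rule powr_powr)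
          moreover have "y powr - real ?d = inverse (y powr real ?d)" by (rule powr_minus)
          moreover have "y powr real ?d = y ^ ?d" using y by (rule powr_realpow)
          ultimately show ?thesis by (simp add: y_def)
        qed
        finally have 1: "gen_base t (m \<bullet> x) powr - (real ?d / 2) \<le> inverse ((2 ^ k * \<delta>) ^ ?d) * A" .
        have "1 - t\<^sup>2 = \<delta> * (1 + t)" by (simp add: \<delta>_def power2_eq_square algebra_simps)
        also have "\<dots> \<le> \<delta> * 2" using t \<delta> by (intro mult_left_mono) auto
        finally have "P t (m \<bullet> x) \<le> (\<delta> * 2) * (inverse ((2 ^ k * \<delta>) ^ ?d) * A)"
          unfolding P_def using 1 t2 \<delta> by (intro mult_mono) auto
        also have "\<dots> = w k" by (simp add: w_def)
        finally have "ennreal (indicator (sphere 0 1) x * P t (m \<bullet> x)) \<le> ennreal (w k)"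
          using n by (intro ennreal_leI) simp
        also have "\<dots> = g k x" using n k by (simp add: g_def cap_def h_def)
        also have "\<dots> \<le> (\<Sum>k. g k x)"
          using sum_le_suminf[of "\<lambda>k. g k x" "{k}"] by (simp add: summableI)
        finally show ?thesis .
      qed simp
      then have "(\<integral>\<^sup>+x. ennreal (indicator (sphere 0 1) x * P t (m \<bullet> x)) \<partial>sphere_measure)
        \<le> (\<integral>\<^sup>+x. (\<Sum>k. g k x) \<partial>sphere_measure)" by (intro nn_integral_mono)
      also have "\<dots> = (\<Sum>k. \<integral>\<^sup>+x. g k x \<partial>sphere_measure)"
        unfolding g_def by (rule nn_integral_suminf) measurable
      also have "\<dots> \<le> (\<Sum>k. ennreal (A * 2 * c0 * (1/2) ^ k))"
      proof (intro suminf_le summableI)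
        fix k
        have p: "2 ^ k * \<delta> > 0" using \<delta> by simp
        have "(\<integral>\<^sup>+x. g k x \<partial>sphere_measure) = ennreal (w k) * emeasure sphere_measure (cap m (2 ^ k * \<delta>))"
          unfolding g_def by (rule nn_integral_cmult_indicator) simp
        also have "\<dots> \<le> ennreal (w k) * ennreal (c0 * (2 ^ k * \<delta>) ^ (?d - 1))"
          by (intro mult_left_mono c0(2)[OF m p]) simp
        also have "\<dots> = ennreal (w k * (c0 * (2 ^ k * \<delta>) ^ (?d - 1)))"
          using w c0(1) \<delta> by (simp add: ennreal_mult)
        also have "w k * (c0 * (2 ^ k * \<delta>) ^ (?d - 1)) = A * 2 * c0 * (1/2) ^ k"
        proof -
          define y where "y = 2 ^ k * \<delta>"
          have y: "y > 0" "\<delta> = y * (1/2) ^ k" using p by (simp_all add: y_def power_divide)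
          have yd: "y ^ ?d = y * y ^ (?d - 1)" by (simp add: power_eq_if)
          have "w k * (c0 * y ^ (?d - 1)) = A * 2 * c0 * (\<delta> * (inverse (y ^ ?d) * y ^ (?d - 1)))"
            by (simp add: w_def y_def)
          also have "inverse (y ^ ?d) * y ^ (?d - 1) = inverse y"
            unfolding yd using y by simp
          also have "\<delta> * inverse y = (1/2) ^ k" using y by simp
          finally show ?thesis by (simp only: y_def)
        qed
        finally show "(\<integral>\<^sup>+x. g k x \<partial>sphere_measure) \<le> ennreal (A * 2 * c0 * (1/2) ^ k)" .
      qed
      also have "\<dots> = ennreal (\<Sum>k. A * 2 * c0 * (1/2) ^ k)"
        using c0(1) by (intro suminf_ennreal2 summable_mult summable_geometric) (auto simp: A_def)
      also have "(\<Sum>k. A * 2 * c0 * (1/2) ^ k) = A * 4 * c0"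
        using suminf_geometric[of "1/2::real"] by (subst suminf_mult) (auto intro: summable_geometric)
      also have "ennreal (A * 4 * c0) \<le> ennreal c" by (intro ennreal_leI) (simp add: c_def)
      finally show ?thesis .
    qed
  qed
qed

section \<open>Pairing with zonal kernels\<close>

definition on_sphere :: "(real^'n \<Rightarrow> real) \<Rightarrow> real^'n \<Rightarrow> real" where
  "on_sphere f x = indicator (sphere 0 1) x * f x"

text \<open>Tests a zonal kernel against \<open>g\<close> in the first and \<open>f\<close> in the
  second argument. A single integral over the product measure lets the convergence theorems apply
  directly; \<open>pairing_iterated\<close> recovers the iterated form.\<close>

definition pairing :: "(real \<Rightarrow> real) \<Rightarrow> (real^'n \<Rightarrow> real) \<Rightarrow> (real^'n \<Rightarrow> real) \<Rightarrow> real" where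
  "pairing k f g = (\<integral>p. on_sphere g (fst p) * (on_sphere f (snd p) * k (fst p \<bullet> snd p))
     \<partial>(sphere_measure \<Otimes>\<^sub>M sphere_measure))"

lemma on_sphere_neq_0: "on_sphere f x \<noteq> 0 \<Longrightarrow> norm x = 1"
  by (auto simp: on_sphere_def split: split_indicator_asm)

lemma abs_inner_unit_le:
  assumes "norm x = 1" "norm y = 1"
  shows "\<bar>x \<bullet> y\<bar> \<le> 1"
  using Cauchy_Schwarz_ineq2[of x y] assms by simp

lemma pair_sigma_finite_sphere:
  "pair_sigma_finite (sphere_measure :: (real^'n) measure) (sphere_measure :: (real^'n) measure)"
proof -
  interpret finite_measure "sphere_measure :: (real^'n) measure" by (rule finite_measure_sphere_measure)
  show ?thesis by unfold_locales
qed

lemma finite_measure_sphere_pair: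
  "finite_measure ((sphere_measure :: (real^'n) measure) \<Otimes>\<^sub>M (sphere_measure :: (real^'n) measure))"
  by (intro finite_measure_pair_measure finite_measure_sphere_measure)

lemma pairing_integrable:
  fixes f g :: "real^'n \<Rightarrow> real" and k :: "real \<Rightarrow> real"
  assumes [measurable]: "k \<in> borel_measurable borel" "on_sphere f \<in> borel_measurable borel" "on_sphere g \<in> borel_measurable borel"
    and bound: "\<And>m m'. \<bar>on_sphere g m * (on_sphere f m' * k (m \<bullet> m'))\<bar> \<le> c"
  shows "integrable (sphere_measure \<Otimes>\<^sub>M sphere_measure) (\<lambda>p. on_sphere g (fst p) * (on_sphere f (snd p) * k (fst p \<bullet> snd p)))"
  by (rule finite_measure.integrable_const_bound[OF finite_measure_sphere_pair, of _ c]) (use bound in auto)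

lemma pairing_iterated:
  fixes f g :: "real^'n \<Rightarrow> real" and k :: "real \<Rightarrow> real"
  assumes [measurable]: "k \<in> borel_measurable borel" "on_sphere f \<in> borel_measurable borel" "on_sphere g \<in> borel_measurable borel"
    and bound: "\<And>m m'. \<bar>on_sphere g m * (on_sphere f m' * k (m \<bullet> m'))\<bar> \<le> c"
  shows "pairing k f g = (\<integral>m. \<integral>m'. on_sphere g m * (on_sphere f m' * k (m \<bullet> m')) \<partial>sphere_measure \<partial>sphere_measure)"
    and "sphere_integral (\<lambda>m. g m * sphere_integral (\<lambda>m'. k (m \<bullet> m') * f m')) = pairing k f g"
proof -
  interpret S: finite_measure "sphere_measure :: (real^'n) measure" by (rule finite_measure_sphere_measure)
  interpret pair_sigma_finite "sphere_measure :: (real^'n) measure" "sphere_measure :: (real^'n) measure"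
    by (rule pair_sigma_finite_sphere)
  define I where "I m = (\<integral>m'. on_sphere f m' * k (m \<bullet> m') \<partial>sphere_measure)" for m
  have [measurable]: "I \<in> borel_measurable borel"
    unfolding I_def[abs_def] by measurable
  show it: "pairing k f g = (\<integral>m. \<integral>m'. on_sphere g m * (on_sphere f m' * k (m \<bullet> m')) \<partial>sphere_measure \<partial>sphere_measure)"
    unfolding pairing_def using integral_fst'[OF pairing_integrable[OF assms]] by simp
  have inner: "sphere_integral (\<lambda>m'. k (m \<bullet> m') * f m') = I m" for m
  proof -
    have eq: "indicator (sphere 0 1) x * (k (m \<bullet> x) * f x) = on_sphere f x * k (m \<bullet> x)" for x
      by (simp add: on_sphere_def)
    show ?thesis
      using integral_sphere_measure[of "\<lambda>x. k (m \<bullet> x) * f x"] unfolding eq I_def by simp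
  qed
  have eq: "indicator (sphere 0 1) m * (g m * I m) = on_sphere g m * I m" for m
    by (simp add: on_sphere_def)
  have "sphere_integral (\<lambda>m. g m * sphere_integral (\<lambda>m'. k (m \<bullet> m') * f m')) = (\<integral>m. on_sphere g m * I m \<partial>sphere_measure)"
    unfolding inner using integral_sphere_measure[of "\<lambda>m. g m * I m"] unfolding eq by simp
  also have "\<dots> = pairing k f g" unfolding it I_def by simp
  finally show "sphere_integral (\<lambda>m. g m * sphere_integral (\<lambda>m'. k (m \<bullet> m') * f m')) = pairing k f g" .
qed

lemma on_sphere_kernel_bound:
  assumes "\<And>x. \<bar>on_sphere f x\<bar> \<le> F" "\<And>x. \<bar>on_sphere g x\<bar> \<le> G" "F \<ge> 0" "G \<ge> 0"
    and "\<And>z. \<bar>z\<bar> \<le> 1 \<Longrightarrow> \<bar>k z\<bar> \<le> b" "b \<ge> 0"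
  shows "\<bar>on_sphere g m * (on_sphere f m' * k (m \<bullet> m'))\<bar> \<le> G * (F * b)"
proof (cases "on_sphere g m = 0 \<or> on_sphere f m' = 0")
  case True
  then show ?thesis using assms by auto
next
  case False
  then have "\<bar>m \<bullet> m'\<bar> \<le> 1" using on_sphere_neq_0 by (intro abs_inner_unit_le) blast+
  then show ?thesis unfolding abs_mult using assms by (intro mult_mono) auto
qed

lemma pairing_sums:
  fixes f g :: "real^'n \<Rightarrow> real" and k :: "nat \<Rightarrow> real \<Rightarrow> real"
  assumes k: "\<And>l. k l \<in> borel_measurable borel"
    and f: "on_sphere f \<in> borel_measurable borel" and g: "on_sphere g \<in> borel_measurable borel"
    and F: "\<And>x. \<bar>on_sphere f x\<bar> \<le> F" "\<And>x. \<bar>on_sphere g x\<bar> \<le> G" "F \<ge> 0" "G \<ge> 0"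
    and b: "\<And>l z. \<bar>z\<bar> \<le> 1 \<Longrightarrow> \<bar>k l z\<bar> \<le> b l" "summable b"
    and K: "\<And>z. \<bar>z\<bar> \<le> 1 \<Longrightarrow> (\<lambda>l. k l z) sums K z"
  shows "(\<lambda>l. pairing (k l) f g) sums pairing K f g"
proof -
  let ?M = "(sphere_measure :: (real^'n) measure) \<Otimes>\<^sub>M (sphere_measure :: (real^'n) measure)"
  interpret finite_measure ?M by (rule finite_measure_sphere_pair)
  define h where "h l p = on_sphere g (fst p) * (on_sphere f (snd p) * k l (fst p \<bullet> snd p))" for l p
  have b0: "b l \<ge> 0" for l using b(1)[of 0 l] by linarith
  have kb: "\<bar>on_sphere g m * (on_sphere f m' * k l (m \<bullet> m'))\<bar> \<le> G * (F * b l)" for l m m'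
    by (rule on_sphere_kernel_bound) (use F b(1) b0 in auto)
  have hb: "\<bar>h l p\<bar> \<le> G * (F * b l)" for l p unfolding h_def by (rule kb)
  have int: "integrable ?M (h l)" for l
    unfolding h_def by (rule pairing_integrable[OF k f g kb])
  have sum: "summable (\<lambda>l. \<integral>p. \<bar>h l p\<bar> \<partial>?M)"
  proof (rule summable_comparison_test'[of "\<lambda>l. G * (F * b l) * measure ?M (space ?M)" 0])
    show "summable (\<lambda>l. G * (F * b l) * measure ?M (space ?M))"
      by (intro summable_mult summable_mult2 b)
    fix l
    have "(\<integral>p. \<bar>h l p\<bar> \<partial>?M) \<le> (\<integral>p. G * (F * b l) \<partial>?M)"
      using int hb by (intro integral_mono) auto
    then show "norm (\<integral>p. \<bar>h l p\<bar> \<partial>?M) \<le> G * (F * b l) * measure ?M (space ?M)"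
      by (simp add: mult_ac)
  qed
  have S: "(\<Sum>l. h l p) = on_sphere g (fst p) * (on_sphere f (snd p) * K (fst p \<bullet> snd p))" for p
  proof (cases "on_sphere g (fst p) = 0 \<or> on_sphere f (snd p) = 0")
    case True
    then show ?thesis by (auto simp: h_def)
  next
    case False
    then have "\<bar>fst p \<bullet> snd p\<bar> \<le> 1" using on_sphere_neq_0 by (intro abs_inner_unit_le) blast+
    from sums_mult[OF sums_mult[OF K[OF this], of "on_sphere f (snd p)"], of "on_sphere g (fst p)"]
    show ?thesis by (simp add: h_def sums_iff)
  qed
  from sums_integral_if_summable(2)[OF int sum] show ?thesis
    unfolding S by (simp add: pairing_def h_def)
qed

lemma continuous_gegenbauer: "continuous_on UNIV (gegenbauer \<nu> n)"
proof (induction n rule: induct_nat_012)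
  case 0
  then show ?case by (simp add: gegenbauer_0[abs_def])
next
  case 1
  then show ?case by (simp add: gegenbauer_1[abs_def])
next
  case (ge2 n)
  have "gegenbauer \<nu> (Suc (Suc n)) = (\<lambda>z. (2 * (real n + 1 + \<nu>) * z * gegenbauer \<nu> (Suc n) z - (real n + 2 * \<nu>) * gegenbauer \<nu> n z) / (real n + 2))"
    using gegenbauer_recurrence[of n \<nu>] by (auto simp: fun_eq_iff eq_divide_eq add.commute mult.commute)
  then show ?case using ge2 by (simp only:) (intro continuous_intros, auto)
qed

lemma borel_measurable_gegenbauer [measurable]: "gegenbauer \<nu> n \<in> borel_measurable borel"
  by (rule borel_measurable_continuous_onI[OF continuous_gegenbauer])

text \<open>The finite-rank form factors the double integral into products of coefficients
  \<open>c f a\<close> and \<open>c g a\<close>. The diagonal pairing is then a sum of squares, and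
  the mixed one is bounded by the mean of the two diagonal ones.\<close>

lemma pairing_gegenbauer_psd:
  fixes f g :: "real^'n \<Rightarrow> real" and n :: nat
  assumes d: "CARD('n) \<ge> 3"
    and f: "on_sphere f \<in> borel_measurable borel" "\<And>x. \<bar>on_sphere f x\<bar> \<le> F" "F \<ge> 0"
    and g: "on_sphere g \<in> borel_measurable borel" "\<And>x. \<bar>on_sphere g x\<bar> \<le> G" "G \<ge> 0"
  defines "C \<equiv> gegenbauer (real CARD('n) / 2 - 1) n"
  shows "pairing C f f \<ge> 0" "\<bar>pairing C f g\<bar> \<le> (pairing C f f + pairing C g g) / 2"
proof -
  interpret S: finite_measure "sphere_measure :: (real^'n) measure" by (rule finite_measure_sphere_measure)
  obtain A :: "('n \<Rightarrow> nat) set" and \<phi> where A: "finite A" "\<And>a. a \<in> A \<Longrightarrow> continuous_on UNIV (\<phi> a)"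
    and *: "\<And>x y::real^'n. x \<in> sphere 0 1 \<Longrightarrow> y \<in> sphere 0 1 \<Longrightarrow> C (x \<bullet> y) = (\<Sum>a\<in>A. \<phi> a x * \<phi> a y)"
    using gegenbauer_finite_rank[OF d, of n] unfolding C_def by metis
  define c where "c u a = (\<integral>x. on_sphere u x * \<phi> a x \<partial>sphere_measure)" for u :: "real^'n \<Rightarrow> real" and a
  have Cm: "C \<in> borel_measurable borel" unfolding C_def by simp
  have int: "integrable sphere_measure (\<lambda>x. on_sphere u x * \<phi> a x)"
    if u: "on_sphere u \<in> borel_measurable borel" "\<And>x. \<bar>on_sphere u x\<bar> \<le> U" "U \<ge> 0" and a: "a \<in> A" for u U a
  proof -
    have [measurable]: "\<phi> a \<in> borel_measurable borel" "on_sphere u \<in> borel_measurable borel"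
      using borel_measurable_continuous_onI[OF A(2)[OF a]] u by auto
    have "compact (\<phi> a ` sphere 0 1)"
      using A(2)[OF a] by (intro compact_continuous_image) (auto intro: continuous_on_subset)
    then have "bounded (\<phi> a ` sphere 0 1)" by (rule compact_imp_bounded)
    then obtain b where "\<forall>y\<in>\<phi> a ` sphere 0 1. norm y \<le> b" unfolding bounded_iff by blast
    then have b: "\<bar>\<phi> a x\<bar> \<le> b" if "x \<in> sphere 0 1" for x using that by auto
    have "\<bar>on_sphere u x * \<phi> a x\<bar> \<le> U * \<bar>b\<bar>" for x
    proof (cases "norm x = 1")
      case True
      then have "\<bar>\<phi> a x\<bar> \<le> \<bar>b\<bar>" using b[of x] by simp
      then show ?thesis unfolding abs_mult using u by (intro mult_mono) auto
    qed (use u(3) in \<open>auto simp: on_sphere_def\<close>)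
    then show ?thesis by (intro S.integrable_const_bound[of _ "U * \<bar>b\<bar>"]) auto
  qed
  have pair: "pairing C u v = (\<Sum>a\<in>A. c v a * c u a)"
    if u: "on_sphere u \<in> borel_measurable borel" "\<And>x. \<bar>on_sphere u x\<bar> \<le> U" "U \<ge> 0"
      and v: "on_sphere v \<in> borel_measurable borel" "\<And>x. \<bar>on_sphere v x\<bar> \<le> V" "V \<ge> 0" for u v U V
  proof -
    obtain b where b: "\<And>z. \<bar>z\<bar> \<le> 1 \<Longrightarrow> \<bar>C z\<bar> \<le> b"
    proof -
      have "compact (C ` {-1..1})"
        unfolding C_def by (intro compact_continuous_image continuous_on_subset[OF continuous_gegenbauer]) auto
      then have "bounded (C ` {-1..1})" by (rule compact_imp_bounded)
      then obtain b where "\<forall>y\<in>C ` {-1..1}. norm y \<le> b" unfolding bounded_iff by blast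
      then show thesis by (intro that[of b]) (auto simp: abs_le_iff)
    qed
    have b0: "b \<ge> 0" using b[of 0] by linarith
    have pt: "on_sphere v m * (on_sphere u m' * C (m \<bullet> m')) = (\<Sum>a\<in>A. on_sphere v m * \<phi> a m * (on_sphere u m' * \<phi> a m'))" for m m'
    proof (cases "m \<in> sphere 0 1 \<and> m' \<in> sphere 0 1")
      case True
      then show ?thesis using *[of m m'] by (simp add: sum_distrib_left mult_ac)
    qed (auto simp: on_sphere_def)
    have "pairing C u v = (\<integral>m. \<integral>m'. on_sphere v m * (on_sphere u m' * C (m \<bullet> m')) \<partial>sphere_measure \<partial>sphere_measure)"
    proof (rule pairing_iterated(1)[OF Cm u(1) v(1)])
      show "\<bar>on_sphere v m * (on_sphere u m' * C (m \<bullet> m'))\<bar> \<le> V * (U * b)" for m m'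
        by (rule on_sphere_kernel_bound) (use u v b b0 in auto)
    qed
    also have "\<dots> = (\<integral>m. (\<Sum>a\<in>A. on_sphere v m * \<phi> a m * c u a) \<partial>sphere_measure)"
      unfolding pt c_def by (simp add: Bochner_Integration.integral_sum int[OF u])
    also have "\<dots> = (\<Sum>a\<in>A. c v a * c u a)"
      by (subst Bochner_Integration.integral_sum) (auto simp: c_def int[OF v])
    finally show ?thesis .
  qed
  show "pairing C f f \<ge> 0" unfolding pair[OF f f] by (intro sum_nonneg) simp
  have le: "\<bar>x * y\<bar> \<le> (x * x + y * y) / 2" for x y :: real
    using sum_squares_bound[of x y] sum_squares_bound[of x "-y"] by (auto simp: power2_eq_square)
  have "\<bar>pairing C f g\<bar> \<le> (\<Sum>a\<in>A. \<bar>c g a * c f a\<bar>)" unfolding pair[OF f g] by (rule sum_abs)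
  also have "\<dots> \<le> (\<Sum>a\<in>A. (c g a * c g a + c f a * c f a) / 2)" by (intro sum_mono le)
  also have "\<dots> = (pairing C f f + pairing C g g) / 2"
    unfolding pair[OF f f] pair[OF g g] by (simp add: sum.distrib flip: sum_divide_distrib)
  finally show "\<bar>pairing C f g\<bar> \<le> (pairing C f f + pairing C g g) / 2" .
qed

section \<open>Convergence of the pairings with the projection kernels\<close>

context gegenbauer_bounded
begin

text \<open>The projection kernel in the variable \<open>z\<close>, up to the constant
  \<open>1 / (sphere_area d * \<nu>)\<close>; see \<open>proj_kernel_eq\<close>.\<close>

definition proj_fun :: "nat \<Rightarrow> real \<Rightarrow> real" where
  "proj_fun l z = (real l + \<nu>) * gegenbauer \<nu> l z"

lemma proj_fun_measurable [measurable]: "proj_fun l \<in> borel_measurable borel"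
  unfolding proj_fun_def by measurable

lemma abs_proj_fun_le: "\<bar>z\<bar> \<le> 1 \<Longrightarrow> \<bar>proj_fun l z\<bar> \<le> proj_fun l 1"
  unfolding proj_fun_def abs_mult using nu_pos gegenbauer_bound[of z l] by (intro mult_mono) auto

lemma summable_proj_fun_1:
  assumes "0 \<le> t" "t < 1"
  shows "summable (\<lambda>l. t ^ l * proj_fun l 1)"
  using gegenbauer_generating[of 1 t] assms by (auto simp: sums_iff proj_fun_def mult_ac)

lemma pairing_proj_fun: "pairing (proj_fun l) f g = (real l + \<nu>) * pairing (gegenbauer \<nu> l) f g"
  unfolding pairing_def proj_fun_def by (simp add: mult.left_commute flip: integral_mult_right_zero)

lemma pairing_proj_fun_psd:
  fixes f g :: "real^'n \<Rightarrow> real"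
  assumes \<nu>: "\<nu> = real CARD('n) / 2 - 1" and d: "CARD('n) \<ge> 3"
    and f: "on_sphere f \<in> borel_measurable borel" "\<And>x. \<bar>on_sphere f x\<bar> \<le> F" "F \<ge> 0"
    and g: "on_sphere g \<in> borel_measurable borel" "\<And>x. \<bar>on_sphere g x\<bar> \<le> G" "G \<ge> 0"
  shows "pairing (proj_fun l) f f \<ge> 0"
    "\<bar>pairing (proj_fun l) f g\<bar> \<le> (pairing (proj_fun l) f f + pairing (proj_fun l) g g) / 2"
proof -
  note p = pairing_gegenbauer_psd[OF d f g, where n=l, folded \<nu>]
  have l: "real l + \<nu> \<ge> 0" using nu_pos by simp
  show "pairing (proj_fun l) f f \<ge> 0" unfolding pairing_proj_fun using p(1) l by simp
  show "\<bar>pairing (proj_fun l) f g\<bar> \<le> (pairing (proj_fun l) f f + pairing (proj_fun l) g g) / 2"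
    using mult_left_mono[OF p(2) l] l unfolding pairing_proj_fun abs_mult by (simp add: algebra_simps)
qed

text \<open>Positivity of the Poisson kernel and its uniformly bounded mass control the Abel means.\<close>
lemma summable_pairing_proj_fun:
  fixes f :: "real^'n \<Rightarrow> real"
  assumes \<nu>: "\<nu> = real CARD('n) / 2 - 1" and d: "CARD('n) \<ge> 3"
    and f: "on_sphere f \<in> borel_measurable borel" "\<And>x. \<bar>on_sphere f x\<bar> \<le> F" "F \<ge> 0"
  shows "summable (\<lambda>l. pairing (proj_fun l) f f)"
proof -
  interpret S: finite_measure "sphere_measure :: (real^'n) measure" by (rule finite_measure_sphere_measure)
  let ?M = "(sphere_measure :: (real^'n) measure) \<Otimes>\<^sub>M (sphere_measure :: (real^'n) measure)"
  define P where "P t z = (1 - t\<^sup>2) * gen_base t z powr - (real CARD('n) / 2)" for t z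
  have \<nu>1: "\<nu> + 1 = real CARD('n) / 2" using \<nu> by simp
  have [measurable]: "P t \<in> borel_measurable borel" for t unfolding P_def gen_base_def by measurable
  note [measurable] = f(1)
  obtain c where c: "c \<ge> 0" "\<And>t (m::real^'n). 0 \<le> t \<Longrightarrow> t < 1 \<Longrightarrow> norm m = 1 \<Longrightarrow>
       (\<integral>\<^sup>+x. ennreal (indicator (sphere 0 1) x * P t (m \<bullet> x)) \<partial>sphere_measure) \<le> ennreal c"
    using poisson_integral_le unfolding P_def by blast
  define T where "T = measure (sphere_measure :: (real^'n) measure) UNIV"
  define B where "B = \<nu> * F\<^sup>2 * c * T"
  have sums: "(\<lambda>l. t ^ l * pairing (proj_fun l) f f) sums pairing (\<lambda>z. \<nu> * P t z) f f" if t: "0 \<le> t" "t < 1" for t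
  proof -
    have "(\<lambda>l. pairing (\<lambda>z. t ^ l * proj_fun l z) f f) sums pairing (\<lambda>z. \<nu> * P t z) f f"
    proof (rule pairing_sums[where b = "\<lambda>l. t ^ l * proj_fun l 1" and F = F and G = F])
      fix l and z :: real assume z: "\<bar>z\<bar> \<le> 1"
      show "\<bar>t ^ l * proj_fun l z\<bar> \<le> t ^ l * proj_fun l 1"
        using abs_proj_fun_le[OF z, of l] t by (simp add: abs_mult mult_left_mono)
      show "(\<lambda>l. t ^ l * proj_fun l z) sums (\<nu> * P t z)"
        using gegenbauer_generating[OF z, of t] t by (simp add: proj_fun_def P_def \<nu>1 mult_ac)
    qed (use f summable_proj_fun_1[OF t] in auto)
    moreover have "pairing (\<lambda>z. t ^ l * proj_fun l z) f f = t ^ l * pairing (proj_fun l) f f" for l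
      unfolding pairing_def by (simp add: mult.left_commute[of _ "t ^ l"] flip: integral_mult_right_zero)
    ultimately show ?thesis by simp
  qed
  have Pnn: "P t z \<ge> 0" if "0 \<le> t" "t < 1" for t z using that by (simp add: P_def power_le_one)
  \<comment> \<open>Bounding both functions by \<open>F\<close>, the inner integral by the Poisson
    mass \<open>c\<close> and the outer one by the total mass \<open>T\<close> gives
    \<open>B\<close>, independently of \<open>t\<close>.\<close>
  have bound: "pairing (\<lambda>z. \<nu> * P t z) f f \<le> B" if t: "0 \<le> t" "t < 1" for t
  proof -
    have pt: "norm (on_sphere f m * (on_sphere f m' * (\<nu> * P t (m \<bullet> m'))))
        \<le> (\<nu> * F\<^sup>2 * indicator (sphere 0 1) m) * (indicator (sphere 0 1) m' * P t (m \<bullet> m'))" for m m'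
    proof (cases "m \<in> sphere 0 1 \<and> m' \<in> sphere 0 1")
      case True
      have "norm (on_sphere f m * (on_sphere f m' * (\<nu> * P t (m \<bullet> m')))) = \<bar>on_sphere f m\<bar> * (\<bar>on_sphere f m'\<bar> * (\<nu> * P t (m \<bullet> m')))"
        using nu_pos Pnn[OF t] by (simp add: abs_mult)
      also have "\<dots> \<le> F * (F * (\<nu> * P t (m \<bullet> m')))"
        using f nu_pos Pnn[OF t] by (intro mult_mono mult_right_mono) auto
      finally show ?thesis using True by (simp add: power2_eq_square mult_ac)
    qed (auto simp: on_sphere_def)
    have "ennreal \<bar>pairing (\<lambda>z. \<nu> * P t z) f f\<bar> \<le> (\<integral>\<^sup>+p. ennreal (norm (on_sphere f (fst p) * (on_sphere f (snd p) * (\<nu> * P t (fst p \<bullet> snd p))))) \<partial>?M)"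
    proof (cases "integrable ?M (\<lambda>p. on_sphere f (fst p) * (on_sphere f (snd p) * (\<nu> * P t (fst p \<bullet> snd p))))")
      case True
      then show ?thesis unfolding pairing_def using integral_norm_bound_ennreal[OF True] by simp
    qed (simp add: pairing_def not_integrable_integral_eq)
    also have "\<dots> \<le> (\<integral>\<^sup>+p. ennreal (\<nu> * F\<^sup>2 * indicator (sphere 0 1) (fst p)) * ennreal (indicator (sphere 0 1) (snd p) * P t (fst p \<bullet> snd p)) \<partial>?M)"
    proof (intro nn_integral_mono)
      fix p :: "(real^'n) \<times> (real^'n)"
      have "ennreal (norm (on_sphere f (fst p) * (on_sphere f (snd p) * (\<nu> * P t (fst p \<bullet> snd p)))))
         \<le> ennreal ((\<nu> * F\<^sup>2 * indicator (sphere 0 1) (fst p)) * (indicator (sphere 0 1) (snd p) * P t (fst p \<bullet> snd p)))"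
        by (intro ennreal_leI pt)
      also have "\<dots> = ennreal (\<nu> * F\<^sup>2 * indicator (sphere 0 1) (fst p)) * ennreal (indicator (sphere 0 1) (snd p) * P t (fst p \<bullet> snd p))"
        using nu_pos Pnn[OF t] by (intro ennreal_mult) auto
      finally show "ennreal (norm (on_sphere f (fst p) * (on_sphere f (snd p) * (\<nu> * P t (fst p \<bullet> snd p)))))
         \<le> ennreal (\<nu> * F\<^sup>2 * indicator (sphere 0 1) (fst p)) * ennreal (indicator (sphere 0 1) (snd p) * P t (fst p \<bullet> snd p))" .
    qed
    also have "\<dots> = (\<integral>\<^sup>+(m::real^'n). \<integral>\<^sup>+m'. ennreal (\<nu> * F\<^sup>2 * indicator (sphere 0 1) m) * ennreal (indicator (sphere 0 1) m' * P t (m \<bullet> m')) \<partial>sphere_measure \<partial>sphere_measure)"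
    proof -
      have [measurable]: "sphere (0::real^'n) 1 \<in> sets borel" by simp
      show ?thesis by (subst S.nn_integral_fst[symmetric]) simp_all
    qed
    also have "\<dots> \<le> (\<integral>\<^sup>+(m::real^'n). ennreal (\<nu> * F\<^sup>2 * c) \<partial>sphere_measure)"
    proof (intro nn_integral_mono)
      fix m :: "real^'n"
      have [measurable]: "sphere (0::real^'n) 1 \<in> sets borel" by simp
      have "(\<integral>\<^sup>+m'. ennreal (\<nu> * F\<^sup>2 * indicator (sphere 0 1) m) * ennreal (indicator (sphere 0 1) m' * P t (m \<bullet> m')) \<partial>sphere_measure)
         = ennreal (\<nu> * F\<^sup>2 * indicator (sphere 0 1) m) * (\<integral>\<^sup>+m'. ennreal (indicator (sphere 0 1) m' * P t (m \<bullet> m')) \<partial>sphere_measure)"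
        by (rule nn_integral_cmult) measurable
      also have "\<dots> \<le> ennreal (\<nu> * F\<^sup>2 * c)"
      proof (cases "norm m = 1")
        case True
        have "ennreal (\<nu> * F\<^sup>2 * indicator (sphere 0 1) m) * (\<integral>\<^sup>+m'. ennreal (indicator (sphere 0 1) m' * P t (m \<bullet> m')) \<partial>sphere_measure)
          \<le> ennreal (\<nu> * F\<^sup>2) * ennreal c"
          using True by (intro mult_mono c(2)[OF t]) auto
        then show ?thesis using nu_pos c(1) by (simp add: ennreal_mult)
      qed simp
      finally show "(\<integral>\<^sup>+m'. ennreal (\<nu> * F\<^sup>2 * indicator (sphere 0 1) m) * ennreal (indicator (sphere 0 1) m' * P t (m \<bullet> m')) \<partial>sphere_measure) \<le> ennreal (\<nu> * F\<^sup>2 * c)" .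
    qed
    also have "\<dots> = ennreal B"
      using nu_pos c(1) by (simp add: B_def T_def S.emeasure_eq_measure ennreal_mult)
    finally have "\<bar>pairing (\<lambda>z. \<nu> * P t z) f f\<bar> \<le> B"
      using nu_pos c(1) by (subst (asm) ennreal_le_iff) (auto simp: B_def T_def)
    then show ?thesis by linarith
  qed
  show ?thesis
  proof (rule summableI_nonneg_bounded[of _ B])
    show nn: "pairing (proj_fun l) f f \<ge> 0" for l by (rule pairing_proj_fun_psd[OF \<nu> d f f])
    fix N :: nat
    \<comment> \<open>Tauberian step for nonnegative terms: a finite partial sum at
      \<open>t < 1\<close> stays below the full Abel mean, hence below \<open>B\<close>, and this
      survives \<open>t \<rightarrow> 1\<close>.\<close>
    have "((\<lambda>t. \<Sum>l<N. t ^ l * pairing (proj_fun l) f f) \<longlongrightarrow> (\<Sum>l<N. 1 ^ l * pairing (proj_fun l) f f)) (at_left (1::real))"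
      by (intro tendsto_intros)
    moreover have "eventually (\<lambda>t. (\<Sum>l<N. t ^ l * pairing (proj_fun l) f f) \<le> B) (at_left (1::real))"
    proof (rule eventually_at_leftI[of 0])
      fix t :: real assume t: "t \<in> {0<..<1}"
      have "(\<Sum>l<N. t ^ l * pairing (proj_fun l) f f) \<le> (\<Sum>l. t ^ l * pairing (proj_fun l) f f)"
        using sums[of t] t nn by (intro sum_le_suminf) (auto simp: sums_iff)
      also have "\<dots> \<le> B" using sums[of t] bound[of t] t by (auto simp: sums_iff)
      finally show "(\<Sum>l<N. t ^ l * pairing (proj_fun l) f f) \<le> B" .
    qed simp
    ultimately have "(\<Sum>l<N. 1 ^ l * pairing (proj_fun l) f f) \<le> B"
      by (rule tendsto_upperbound) simp
    then show "(\<Sum>l<N. pairing (proj_fun l) f f) \<le> B" by simp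
  qed
qed

end

context resolvent_kernel
begin

lemma resolvent_fun_measurable [measurable]: "resolvent_fun t \<in> borel_measurable borel"
proof -
  have "(\<lambda>p. \<psi> (snd p) * gen_sum \<nu> (t * exp (- snd p)) (fst p)) \<in> borel_measurable (borel \<Otimes>\<^sub>M lborel)"
    unfolding gen_sum_def gen_base_def by measurable
  then have "(\<lambda>z. \<integral>u. \<psi> u * gen_sum \<nu> (t * exp (- u)) z \<partial>lborel) \<in> borel_measurable borel"
    by (intro lborel.borel_measurable_lebesgue_integral) (simp add: case_prod_unfold)
  then show ?thesis unfolding resolvent_fun_def[abs_def] by measurable
qed

definition multiplier :: "nat \<Rightarrow> real" where
  "multiplier l = inverse (1 + (real l * (real l + 2 * \<nu>)) powr s)"

lemma multiplier_bounds: "0 \<le> multiplier l" "multiplier l \<le> 1"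
proof -
  have "1 + (real l * (real l + 2 * \<nu>)) powr s \<ge> 1" by simp
  then show "0 \<le> multiplier l" "multiplier l \<le> 1"
    unfolding multiplier_def by (auto simp: inverse_le_1_iff)
qed

text \<open>Both sides are limits of the identity at \<open>t < 1\<close>: the series by Tannery's
  theorem, with the summable absolute pairings as majorant, and the integral by dominated
  convergence, since separated supports keep the inner product at most
  \<open>1 - \<epsilon>\<close>.\<close>

lemma resolvent_pairing_sums:
  fixes f g :: "real^'n \<Rightarrow> real"
  assumes \<nu>: "\<nu> = real CARD('n) / 2 - 1" and d: "CARD('n) \<ge> 3"
    and f: "on_sphere f \<in> borel_measurable borel" "\<And>x. \<bar>on_sphere f x\<bar> \<le> F" "F \<ge> 0"
    and g: "on_sphere g \<in> borel_measurable borel" "\<And>x. \<bar>on_sphere g x\<bar> \<le> G" "G \<ge> 0"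
    and \<epsilon>: "\<epsilon> > 0"
    and sep: "\<And>m m'. on_sphere g m \<noteq> 0 \<Longrightarrow> on_sphere f m' \<noteq> 0 \<Longrightarrow> m \<bullet> m' \<le> 1 - \<epsilon>"
  shows "(\<lambda>l. multiplier l * pairing (proj_fun l) f g) sums pairing (resolvent_fun 1) f g"
    and "\<And>m m'. \<bar>on_sphere g m * (on_sphere f m' * resolvent_fun 1 (m \<bullet> m'))\<bar> \<le> G * (F * (\<nu> + gen_bound \<epsilon> * psi_norm))"
proof -
  let ?M = "(sphere_measure :: (real^'n) measure) \<Otimes>\<^sub>M (sphere_measure :: (real^'n) measure)"
  interpret finite_measure ?M by (rule finite_measure_sphere_pair)
  note [measurable] = f(1) g(1)
  define b where "b l = \<bar>pairing (proj_fun l) f g\<bar>" for l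
  have sb: "summable b"
  proof (rule summable_comparison_test'[of "\<lambda>l. (pairing (proj_fun l) f f + pairing (proj_fun l) g g) / 2" 0])
    show "summable (\<lambda>l. (pairing (proj_fun l) f f + pairing (proj_fun l) g g) / 2)"
      by (intro summable_divide summable_add summable_pairing_proj_fun[OF \<nu> d f] summable_pairing_proj_fun[OF \<nu> d g])
    show "norm (b l) \<le> (pairing (proj_fun l) f f + pairing (proj_fun l) g g) / 2" for l
      using pairing_proj_fun_psd(2)[OF \<nu> d f g, of l] by (simp add: b_def)
  qed
  define Q where "Q = \<nu> + gen_bound \<epsilon> * psi_norm"
  have Q: "Q \<ge> 0"
    using resolvent_fun_le[of 0 "max (-1) (1 - \<epsilon>)" "min \<epsilon> 2"] nu_pos \<epsilon>
    by (auto simp: Q_def gen_bound_def psi_norm_def intro!: add_nonneg_nonneg mult_nonneg_nonneg)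
  have Rb: "\<bar>on_sphere g m * (on_sphere f m' * resolvent_fun t (m \<bullet> m'))\<bar> \<le> G * (F * Q)"
    if t: "0 \<le> t" "t \<le> 1" for t m m'
  proof (cases "on_sphere g m = 0 \<or> on_sphere f m' = 0")
    case True
    then show ?thesis using f(3) g(3) Q by auto
  next
    case False
    then have "\<bar>m \<bullet> m'\<bar> \<le> 1" "m \<bullet> m' \<le> 1 - \<epsilon>"
      using on_sphere_neq_0 sep by (blast intro!: abs_inner_unit_le)+
    then have "\<bar>resolvent_fun t (m \<bullet> m')\<bar> \<le> Q" unfolding Q_def using t \<epsilon> by (intro resolvent_fun_le)
    then show ?thesis unfolding abs_mult using f g by (intro mult_mono) auto
  qed
  then show "\<bar>on_sphere g m * (on_sphere f m' * resolvent_fun 1 (m \<bullet> m'))\<bar> \<le> G * (F * (\<nu> + gen_bound \<epsilon> * psi_norm))" for m m'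
    unfolding Q_def by simp
  have abel: "(\<lambda>l. multiplier l * t ^ l * pairing (proj_fun l) f g) sums pairing (resolvent_fun t) f g"
    if t: "0 \<le> t" "t < 1" for t
  proof -
    have "(\<lambda>l. pairing (\<lambda>z. multiplier l * t ^ l * proj_fun l z) f g) sums pairing (resolvent_fun t) f g"
    proof (rule pairing_sums[where b = "\<lambda>l. t ^ l * proj_fun l 1" and F = F and G = G])
      fix l and z :: real assume z: "\<bar>z\<bar> \<le> 1"
      have "\<bar>multiplier l * t ^ l * proj_fun l z\<bar> = multiplier l * (t ^ l * \<bar>proj_fun l z\<bar>)"
        using multiplier_bounds(1)[of l] t by (simp add: abs_mult)
      also have "\<dots> \<le> 1 * (t ^ l * proj_fun l 1)"
        using multiplier_bounds[of l] abs_proj_fun_le[OF z, of l] t by (intro mult_mono) auto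
      finally show "\<bar>multiplier l * t ^ l * proj_fun l z\<bar> \<le> t ^ l * proj_fun l 1" by simp
      show "(\<lambda>l. multiplier l * t ^ l * proj_fun l z) sums resolvent_fun t z"
        using resolvent_sums[OF t z] by (simp add: multiplier_def proj_fun_def)
    qed (use f g summable_proj_fun_1[OF t] in auto)
    moreover have "pairing (\<lambda>z. multiplier l * t ^ l * proj_fun l z) f g = multiplier l * t ^ l * pairing (proj_fun l) f g" for l
      unfolding pairing_def by (simp add: mult.left_commute[of _ "multiplier l * t ^ l"] flip: integral_mult_right_zero)
    ultimately show ?thesis by simp
  qed
  \<comment> \<open>Any sequence in \<open>[0, 1)\<close> tending to \<open>1\<close> would do; both
    limit theorems are applied along sequences.\<close>
  define S where "S n = 1 - inverse (real n + 2)" for n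
  have Sn: "0 \<le> S n" "S n < 1" for n by (simp_all add: S_def field_simps)
  have Slim: "S \<longlonglongrightarrow> 1"
  proof -
    have "(\<lambda>n. 1 - inverse (real (n + 2))) \<longlonglongrightarrow> 1 - 0"
      by (intro tendsto_diff tendsto_const LIMSEQ_ignore_initial_segment[OF lim_inverse_n])
    then show ?thesis by (simp add: S_def[abs_def] add.commute)
  qed
  have "(\<lambda>n. \<Sum>l. multiplier l * S n ^ l * pairing (proj_fun l) f g) \<longlonglongrightarrow> (\<Sum>l. multiplier l * 1 ^ l * pairing (proj_fun l) f g)"
  proof (rule conjunct2[OF conjunct2[OF tannerys_theorem[where M = b]]])
    show "(\<lambda>n. multiplier l * S n ^ l * pairing (proj_fun l) f g) \<longlonglongrightarrow> multiplier l * 1 ^ l * pairing (proj_fun l) f g" for l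
      by (intro tendsto_intros Slim)
    have "norm (multiplier l * S n ^ l * pairing (proj_fun l) f g) \<le> b l" for l n
    proof -
      have "multiplier l * S n ^ l \<le> 1 * 1" using multiplier_bounds[of l] Sn[of n]
        by (intro mult_mono power_le_one) auto
      then have "(multiplier l * S n ^ l) * \<bar>pairing (proj_fun l) f g\<bar> \<le> 1 * \<bar>pairing (proj_fun l) f g\<bar>"
        by (intro mult_right_mono) auto
      then show ?thesis using multiplier_bounds(1)[of l] Sn[of n] by (simp add: b_def abs_mult)
    qed
    then show "\<forall>\<^sub>F (l, n) in sequentially \<times>\<^sub>F sequentially. norm (multiplier l * S n ^ l * pairing (proj_fun l) f g) \<le> b l"
      by (intro always_eventually) auto
  qed (use sb in auto)
  then have l1: "(\<lambda>n. pairing (resolvent_fun (S n)) f g) \<longlonglongrightarrow> (\<Sum>l. multiplier l * pairing (proj_fun l) f g)"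
    using abel[OF Sn] by (simp add: sums_iff)
  have l2: "(\<lambda>n. pairing (resolvent_fun (S n)) f g) \<longlonglongrightarrow> pairing (resolvent_fun 1) f g"
    unfolding pairing_def
  proof (rule integral_dominated_convergence[where w = "\<lambda>_. G * (F * Q)"])
    show "AE p in ?M. norm (on_sphere g (fst p) * (on_sphere f (snd p) * resolvent_fun (S n) (fst p \<bullet> snd p))) \<le> G * (F * Q)" for n
      using Rb[of "S n"] Sn[of n] by simp
    show "AE p in ?M. (\<lambda>n. on_sphere g (fst p) * (on_sphere f (snd p) * resolvent_fun (S n) (fst p \<bullet> snd p)))
       \<longlonglongrightarrow> on_sphere g (fst p) * (on_sphere f (snd p) * resolvent_fun 1 (fst p \<bullet> snd p))"
    proof (intro AE_I2)
      fix p :: "(real^'n) \<times> (real^'n)"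
      show "(\<lambda>n. on_sphere g (fst p) * (on_sphere f (snd p) * resolvent_fun (S n) (fst p \<bullet> snd p)))
       \<longlonglongrightarrow> on_sphere g (fst p) * (on_sphere f (snd p) * resolvent_fun 1 (fst p \<bullet> snd p))"
      proof (cases "on_sphere g (fst p) = 0 \<or> on_sphere f (snd p) = 0")
        case True
        then show ?thesis by auto
      next
        case False
        then have z: "\<bar>fst p \<bullet> snd p\<bar> \<le> 1" "fst p \<bullet> snd p \<le> 1 - \<epsilon>"
          using on_sphere_neq_0 sep by (blast intro!: abs_inner_unit_le)+
        have "filterlim S (at_left 1) sequentially"
          unfolding filterlim_at using Slim Sn less_imp_neq[OF Sn(2)] by simp
        then have "(\<lambda>n. resolvent_fun (S n) (fst p \<bullet> snd p)) \<longlonglongrightarrow> resolvent_fun 1 (fst p \<bullet> snd p)"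
          using z \<epsilon> by (intro filterlim_compose[OF resolvent_fun_tendsto]) auto
        then show ?thesis by (intro tendsto_intros)
      qed
    qed
  qed auto
  have "summable (\<lambda>l. multiplier l * pairing (proj_fun l) f g)"
  proof (rule summable_comparison_test'[OF sb, of 0])
    show "norm (multiplier l * pairing (proj_fun l) f g) \<le> b l" for l
      using multiplier_bounds[of l] mult_right_mono[of "multiplier l" 1 "b l"] by (simp add: b_def abs_mult)
  qed
  moreover have "(\<Sum>l. multiplier l * pairing (proj_fun l) f g) = pairing (resolvent_fun 1) f g"
    by (rule LIMSEQ_unique[OF l1 l2])
  ultimately show "(\<lambda>l. multiplier l * pairing (proj_fun l) f g) sums pairing (resolvent_fun 1) f g"
    by (simp add: sums_iff)
qed

end

section \<open>The resolvent kernel on the sphere\<close>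

text \<open>Every \<open>z\<close> in \<open>[- 1, 1]\<close> is the inner product of two unit
  vectors in a coordinate plane, so the bound on the sphere holds for all such
  \<open>z\<close>.\<close>

lemma gegenbauer_bounded_sphere:
  assumes d: "CARD('n::finite) \<ge> 3"
  shows "gegenbauer_bounded (real CARD('n) / 2 - 1)"
proof
  show "real CARD('n) / 2 - 1 > 0" using d by simp
  fix n and z :: real assume z: "\<bar>z\<bar> \<le> 1"
  obtain i j :: 'n where ij: "i \<noteq> j"
  proof -
    have "\<not> (\<forall>i j :: 'n. i = j)"
    proof
      assume "\<forall>i j :: 'n. i = j"
      then have "(UNIV :: 'n set) = {undefined}" by auto
      then have "CARD('n) = 1" by (metis card_1_singleton_iff One_nat_def)
      then show False using d by simp
    qed
    then show thesis using that by blast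
  qed
  define y :: "real^'n" where "y = z *\<^sub>R axis i 1 + sqrt (1 - z\<^sup>2) *\<^sub>R axis j 1"
  have z2: "1 - z\<^sup>2 \<ge> 0" using z by (simp add: abs_square_le_1)
  have "y \<bullet> y = z\<^sup>2 + (sqrt (1 - z\<^sup>2))\<^sup>2"
    using ij by (simp add: y_def inner_add_left inner_add_right inner_axis_axis power2_eq_square)
  also have "\<dots> = 1" using z2 by simp
  finally have "y \<in> sphere 0 1" by (simp add: norm_eq_1)
  moreover have "axis i 1 \<in> sphere (0::real^'n) 1" by (simp add: norm_eq_1 inner_axis_axis)
  moreover have "axis i 1 \<bullet> y = z" using ij by (simp add: y_def inner_add_right inner_axis_axis)
  ultimately show "\<bar>gegenbauer (real CARD('n) / 2 - 1) n z\<bar> \<le> gegenbauer (real CARD('n) / 2 - 1) n 1"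
    using abs_gegenbauer_le[OF d, of "axis i 1" y n] by simp
qed

text \<open>In terms of Pochhammer symbols of \<open>d - 2 = 2 \<nu>\<close>, the dimension and the
  value at \<open>1\<close> share the factor \<open>pochhammer (d - 2) l / l!\<close>; their
  quotient is \<open>(l + \<nu>) / \<nu>\<close>.\<close>

lemma proj_kernel_eq:
  fixes m m' :: "real^'n"
  assumes d: "CARD('n) \<ge> 3"
  defines "\<nu> \<equiv> real CARD('n) / 2 - 1"
  shows "proj_kernel l m m' = 1 / (sphere_area CARD('n) * \<nu>) * ((real l + \<nu>) * gegenbauer \<nu> l (m \<bullet> m'))"
proof -
  define e where "e = real CARD('n) - 2"
  have e: "e > 0" using d by (simp add: e_def)
  have e\<nu>: "e = 2 * \<nu>" by (simp add: e_def \<nu>_def)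
  have G: "Gamma e > 0" using e by (rule Gamma_real_pos)
  define p where "p = pochhammer e l"
  have p: "p > 0" unfolding p_def using e by (rule pochhammer_pos)
  have "e \<notin> \<int>\<^sub>\<le>\<^sub>0" using e by (auto elim: nonpos_Ints_cases)
  then have g1: "Gamma (real l + real CARD('n) - 2) = p * Gamma e"
    using pochhammer_Gamma[of e l] G by (simp add: p_def e_def algebra_simps)
  have g2: "Gamma (real CARD('n) - 1) = e * Gamma e"
  proof -
    have "Gamma (e + 1) = e * Gamma e" using e by (intro Gamma_plus1) (auto elim: nonpos_Ints_cases)
    then show ?thesis by (simp add: e_def)
  qed
  have g3: "Gamma (real l + 1) = fact l" by (simp add: Gamma_fact add.commute)
  have h: "harm_dim CARD('n) l = (2 * real l + e) * (p * Gamma e) / (e * Gamma e * fact l)"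
    unfolding harm_dim_def g1 g2 g3 by (simp add: e_def algebra_simps)
  have c1: "gegenbauer \<nu> l 1 = p / fact l" by (simp add: gegenbauer_at_1 p_def e\<nu>)
  have "harm_dim CARD('n) l / gegenbauer \<nu> l 1 = (2 * real l + e) / e"
  proof -
    have "Gamma e \<noteq> 0" using G by linarith
    then show ?thesis unfolding h c1 using p e by simp
  qed
  also have "\<dots> = (real l + \<nu>) / \<nu>" using e by (simp add: e\<nu> field_simps)
  finally have r: "harm_dim CARD('n) l / gegenbauer \<nu> l 1 = (real l + \<nu>) / \<nu>" .
  have "proj_kernel l m m' = harm_dim CARD('n) l / gegenbauer \<nu> l 1 * (gegenbauer \<nu> l (m \<bullet> m') / sphere_area CARD('n))"
    by (simp add: proj_kernel_def gegenbauer_norm_def \<nu>_def)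
  then show ?thesis unfolding r by simp
qed

lemma on_sphere_continuous:
  fixes f :: "real^'n \<Rightarrow> real"
  assumes f: "continuous_on (sphere 0 1) f"
  shows "on_sphere f \<in> borel_measurable borel"
    and "\<exists>F\<ge>0. \<forall>x. \<bar>on_sphere f x\<bar> \<le> F"
proof -
  have "(\<lambda>x. indicator (sphere 0 1) x *\<^sub>R f x) \<in> borel_measurable borel"
    by (rule borel_measurable_continuous_on_indicator) (use f in auto)
  then show "on_sphere f \<in> borel_measurable borel" by (simp add: on_sphere_def[abs_def])
  have "bounded (f ` sphere 0 1)" by (intro compact_imp_bounded compact_continuous_image f compact_sphere)
  then obtain b where b: "\<forall>y\<in>f ` sphere 0 1. norm y \<le> b" unfolding bounded_iff by blast
  have "\<bar>on_sphere f x\<bar> \<le> \<bar>b\<bar>" for x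
  proof (cases "x \<in> sphere 0 1")
    case True
    then have "norm (f x) \<le> b" using b by blast
    then show ?thesis using True by (simp add: on_sphere_def)
  qed (simp add: on_sphere_def)
  then show "\<exists>F\<ge>0. \<forall>x. \<bar>on_sphere f x\<bar> \<le> F" by (intro exI[of _ "\<bar>b\<bar>"]) simp
qed

text \<open>The supports are compact, so disjointness gives a positive distance
  \<open>\<delta>\<close>, and \<open>inner_unit_dist\<close> converts it into
  \<open>\<epsilon> = \<delta>\<^sup>2 / 2\<close>.\<close>

lemma sphere_support_separated:
  fixes f g :: "real^'n \<Rightarrow> real"
  assumes "sphere_support f \<inter> sphere_support g = {}"
  obtains \<epsilon> where "\<epsilon> > 0"
    "\<And>m m'. on_sphere g m \<noteq> 0 \<Longrightarrow> on_sphere f m' \<noteq> 0 \<Longrightarrow> m \<bullet> m' \<le> 1 - \<epsilon>"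
proof -
  have sub: "{x \<in> sphere 0 1. u x \<noteq> 0} \<subseteq> sphere_support u" for u :: "real^'n \<Rightarrow> real"
    unfolding sphere_support_def by (rule closure_subset)
  have "bounded {x \<in> sphere 0 1. g x \<noteq> 0}"
    by (rule bounded_subset[OF bounded_sphere[of 0 1]]) auto
  then have "compact (sphere_support g)" by (simp only: sphere_support_def compact_closure)
  moreover have "closed (sphere_support f)" by (simp add: sphere_support_def)
  moreover have "sphere_support g \<inter> sphere_support f = {}" using assms by blast
  ultimately have "\<exists>\<delta>>0. \<forall>x\<in>sphere_support g. \<forall>y\<in>sphere_support f. \<delta> \<le> dist x y"
    by (rule separate_compact_closed)
  then obtain \<delta> where \<delta>: "\<delta> > 0" "\<And>x y. x \<in> sphere_support g \<Longrightarrow> y \<in> sphere_support f \<Longrightarrow> \<delta> \<le> dist x y"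
    by blast
  show thesis
  proof (rule that[of "\<delta>\<^sup>2 / 2"])
    show "\<delta>\<^sup>2 / 2 > 0" using \<delta> by simp
    fix m m' assume *: "on_sphere g m \<noteq> 0" "on_sphere f m' \<noteq> 0"
    then have n: "norm m = 1" "norm m' = 1" using on_sphere_neq_0 by blast+
    have "m \<in> {x \<in> sphere 0 1. g x \<noteq> 0}" "m' \<in> {x \<in> sphere 0 1. f x \<noteq> 0}"
      using * n by (auto simp: on_sphere_def)
    then have "\<delta> \<le> norm (m - m')" using \<delta>(2)[of m m'] sub by (auto simp: dist_norm)
    then have "\<delta>\<^sup>2 \<le> (norm (m - m'))\<^sup>2" using \<delta> by (intro power_mono) auto
    then show "m \<bullet> m' \<le> 1 - \<delta>\<^sup>2 / 2" unfolding inner_unit_dist[OF n] by simp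
  qed
qed

context resolvent_kernel
begin

lemma resolvent_kernel_analytic:
  fixes p q :: "real^'n"
  assumes pq: "norm p = 1" "norm q = 1" "p \<noteq> q"
  shows "\<exists>F :: (real^'n) \<times> (real^'n) \<Rightarrow> real. \<exists>r > 0. real_analytic_at F (p, q) \<and>
    (\<forall>x \<in> sphere 0 1. \<forall>y \<in> sphere 0 1. dist (x, y) (p, q) < r \<longrightarrow> F (x, y) = \<kappa> * resolvent_fun 1 (x \<bullet> y))"
proof -
  define z0 where "z0 = p \<bullet> q"
  have z0: "\<bar>z0\<bar> \<le> 1" "z0 < 1"
    using abs_inner_unit_le[OF pq(1,2)] inner_unit_dist[OF pq(1,2)] pq(3) by (auto simp: z0_def)
  define \<rho> where "\<rho> = (1 - z0) / 8"
  have \<rho>: "\<rho> > 0" using z0 by (simp add: \<rho>_def)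
  obtain c where c: "summable (\<lambda>n. \<bar>c n\<bar> * \<rho> ^ n)"
    "\<And>z. \<bar>z\<bar> \<le> 1 \<Longrightarrow> \<bar>z - z0\<bar> \<le> \<rho> \<Longrightarrow> (\<lambda>n. c n * (z - z0) ^ n) sums resolvent_fun 1 z"
    using resolvent_fun_power_series[OF z0] unfolding \<rho>_def by blast
  \<comment> \<open>The power series in the inner product is defined off the sphere too, giving a
    local analytic extension; agreement with the kernel is claimed only for unit vectors.\<close>
  define F where "F x = (\<Sum>n. \<kappa> * c n * (fst x \<bullet> snd x - p \<bullet> q) ^ n)" for x :: "(real^'n) \<times> (real^'n)"
  have "summable (\<lambda>n. \<bar>\<kappa> * c n\<bar> * \<rho> ^ n)"
    using summable_mult[OF c(1), of "\<bar>\<kappa>\<bar>"] by (simp add: abs_mult mult.assoc)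
  then have an: "real_analytic_at F (p, q)"
    unfolding F_def using \<rho> by (rule real_analytic_at_power_series_inner)
  have "isCont (\<lambda>v::(real^'n) \<times> (real^'n). fst v \<bullet> snd v) (p, q)" by (intro continuous_intros)
  then obtain r where r: "r > 0" "\<And>v. dist v (p, q) < r \<Longrightarrow> dist (fst v \<bullet> snd v) (fst (p, q) \<bullet> snd (p, q)) < \<rho>"
    using \<rho> unfolding continuous_at_eps_delta by blast
  have "F (x, y) = \<kappa> * resolvent_fun 1 (x \<bullet> y)"
    if xy: "x \<in> sphere 0 1" "y \<in> sphere 0 1" "dist (x, y) (p, q) < r" for x y
  proof -
    have "\<bar>x \<bullet> y - z0\<bar> \<le> \<rho>" using r(2)[OF xy(3)] by (simp add: z0_def dist_real_def)
    then have "(\<lambda>n. c n * (x \<bullet> y - z0) ^ n) sums resolvent_fun 1 (x \<bullet> y)"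
      using xy by (intro c(2) abs_inner_unit_le) auto
    from sums_mult[OF this, of \<kappa>] show ?thesis by (simp add: F_def z0_def sums_iff mult.assoc)
  qed
  then show ?thesis using an r(1) by blast
qed

lemma resolvent_kernel_bigo_power:
  fixes m :: "real^'n"
  assumes m: "norm m = 1" and s: "2 * s < 2 * \<nu> + 1"
  shows "(\<lambda>m'. \<kappa> * resolvent_fun 1 (m \<bullet> m')) \<in> O[at m within sphere 0 1](\<lambda>m'. norm (m - m') powr (2 * s - 2 * \<nu> - 1))"
proof -
  obtain B where B: "\<And>\<rho>. 0 < \<rho> \<Longrightarrow> \<rho> < 1 \<Longrightarrow> \<bar>resolvent_fun 1 (1 - \<rho>\<^sup>2 / 2)\<bar> \<le> B * \<rho> powr (2 * s - 2 * \<nu> - 1)"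
    using resolvent_fun_diagonal_power[OF s] by blast
  show ?thesis
  proof (rule bigoI[of _ "\<bar>\<kappa>\<bar> * B"])
    have "\<forall>m'\<in>sphere 0 1. m' \<noteq> m \<and> dist m' m < 1 \<longrightarrow>
        norm (\<kappa> * resolvent_fun 1 (m \<bullet> m')) \<le> \<bar>\<kappa>\<bar> * B * norm (norm (m - m') powr (2 * s - 2 * \<nu> - 1))"
    proof (intro ballI impI)
      fix m' assume m': "m' \<in> sphere 0 1" "m' \<noteq> m \<and> dist m' m < 1"
      then have "0 < norm (m - m')" "norm (m - m') < 1" "norm m' = 1" by (auto simp: dist_norm norm_minus_commute)
      then show "norm (\<kappa> * resolvent_fun 1 (m \<bullet> m')) \<le> \<bar>\<kappa>\<bar> * B * norm (norm (m - m') powr (2 * s - 2 * \<nu> - 1))"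
        using B[of "norm (m - m')"] inner_unit_dist[OF m, of m'] by (simp add: abs_mult mult.assoc mult_left_mono)
    qed
    then show "\<forall>\<^sub>F m' in at m within sphere 0 1.
        norm (\<kappa> * resolvent_fun 1 (m \<bullet> m')) \<le> \<bar>\<kappa>\<bar> * B * norm (norm (m - m') powr (2 * s - 2 * \<nu> - 1))"
      unfolding eventually_at by (intro exI[of _ 1]) simp
  qed
qed

lemma resolvent_kernel_bigo_log:
  fixes m :: "real^'n"
  assumes m: "norm m = 1" and s: "2 * s = 2 * \<nu> + 1"
  shows "(\<lambda>m'. \<kappa> * resolvent_fun 1 (m \<bullet> m')) \<in> O[at m within sphere 0 1](\<lambda>m'. \<bar>ln (norm (m - m'))\<bar>)"
proof -
  obtain B where B: "\<And>\<rho>. 0 < \<rho> \<Longrightarrow> \<rho> \<le> exp (- 1) \<Longrightarrow> \<bar>resolvent_fun 1 (1 - \<rho>\<^sup>2 / 2)\<bar> \<le> B * \<bar>ln \<rho>\<bar>"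
    using resolvent_fun_diagonal_log[OF s] by blast
  show ?thesis
  proof (rule bigoI[of _ "\<bar>\<kappa>\<bar> * B"])
    have "\<forall>m'\<in>sphere 0 1. m' \<noteq> m \<and> dist m' m < exp (- 1) \<longrightarrow>
        norm (\<kappa> * resolvent_fun 1 (m \<bullet> m')) \<le> \<bar>\<kappa>\<bar> * B * norm \<bar>ln (norm (m - m'))\<bar>"
    proof (intro ballI impI)
      fix m' assume m': "m' \<in> sphere 0 1" "m' \<noteq> m \<and> dist m' m < exp (- 1)"
      then have "0 < norm (m - m')" "norm (m - m') \<le> exp (- 1)" "norm m' = 1" by (auto simp: dist_norm norm_minus_commute)
      then show "norm (\<kappa> * resolvent_fun 1 (m \<bullet> m')) \<le> \<bar>\<kappa>\<bar> * B * norm \<bar>ln (norm (m - m'))\<bar>"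
        using B[of "norm (m - m')"] inner_unit_dist[OF m, of m'] by (simp add: abs_mult mult.assoc mult_left_mono)
    qed
    then show "\<forall>\<^sub>F m' in at m within sphere 0 1.
        norm (\<kappa> * resolvent_fun 1 (m \<bullet> m')) \<le> \<bar>\<kappa>\<bar> * B * norm \<bar>ln (norm (m - m'))\<bar>"
      unfolding eventually_at by (intro exI[of _ "exp (- 1)"]) simp
  qed
qed

lemma resolvent_kernel_pairing:
  fixes f g :: "real^'n \<Rightarrow> real"
  assumes \<nu>: "\<nu> = real CARD('n) / 2 - 1" and d: "CARD('n) \<ge> 3"
    and f: "continuous_on (sphere 0 1) f" and g: "continuous_on (sphere 0 1) g"
    and sep: "sphere_support f \<inter> sphere_support g = {}"
  shows "(\<lambda>l. multiplier l * sphere_integral (\<lambda>m. g m * sphere_integral (\<lambda>m'. \<kappa> * proj_fun l (m \<bullet> m') * f m')))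
     sums sphere_integral (\<lambda>m. g m * sphere_integral (\<lambda>m'. \<kappa> * resolvent_fun 1 (m \<bullet> m') * f m'))"
proof -
  obtain F G where F: "F \<ge> 0" "\<And>x. \<bar>on_sphere f x\<bar> \<le> F" and G: "G \<ge> 0" "\<And>x. \<bar>on_sphere g x\<bar> \<le> G"
    using on_sphere_continuous(2)[OF f] on_sphere_continuous(2)[OF g] by blast
  note fm = on_sphere_continuous(1)[OF f] and gm = on_sphere_continuous(1)[OF g]
  obtain \<epsilon> where \<epsilon>: "\<epsilon> > 0" "\<And>m m'. on_sphere g m \<noteq> 0 \<Longrightarrow> on_sphere f m' \<noteq> 0 \<Longrightarrow> m \<bullet> m' \<le> 1 - \<epsilon>"
    using sphere_support_separated[OF sep] by blast
  note R = resolvent_pairing_sums[OF \<nu> d fm F(2) F(1) gm G(2) G(1) \<epsilon>]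
  have scale: "pairing (\<lambda>z. \<kappa> * k z) f g = \<kappa> * pairing k f g" for k
    unfolding pairing_def by (simp add: mult.left_commute[of _ \<kappa>] flip: integral_mult_right_zero)
  have km: "(\<lambda>z. \<kappa> * k z) \<in> borel_measurable borel" if "k \<in> borel_measurable borel" for k
    using that by measurable
  have kb: "\<bar>on_sphere g m * (on_sphere f m' * (\<kappa> * k (m \<bullet> m')))\<bar> \<le> \<bar>\<kappa>\<bar> * c"
    if "\<And>m m'. \<bar>on_sphere g m * (on_sphere f m' * k (m \<bullet> m'))\<bar> \<le> c" for k c m m'
    using mult_left_mono[OF that[of m m'], of "\<bar>\<kappa>\<bar>"] by (simp add: abs_mult mult.left_commute)
  have K: "sphere_integral (\<lambda>m. g m * sphere_integral (\<lambda>m'. \<kappa> * resolvent_fun 1 (m \<bullet> m') * f m')) = \<kappa> * pairing (resolvent_fun 1) f g"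
    unfolding scale[symmetric]
    by (rule pairing_iterated(2)[OF km fm gm kb]) (use R(2) in auto)
  have P: "sphere_integral (\<lambda>m. g m * sphere_integral (\<lambda>m'. \<kappa> * proj_fun l (m \<bullet> m') * f m')) = \<kappa> * pairing (proj_fun l) f g" for l
    unfolding scale[symmetric]
  proof (rule pairing_iterated(2)[OF km fm gm kb])
    show "\<bar>on_sphere g m * (on_sphere f m' * proj_fun l (m \<bullet> m'))\<bar> \<le> G * (F * proj_fun l 1)" for m m'
      using F G abs_proj_fun_le[of _ l] abs_proj_fun_le[of 1 l] by (intro on_sphere_kernel_bound) auto
  qed auto
  from sums_mult[OF R(1), of \<kappa>] show ?thesis
    unfolding K P by (simp add: mult.left_commute)
qed

end

lemma resolvent_kernel_exists:
  assumes d: "CARD('n::finite) \<ge> 3" and s: "0 < s"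
  obtains C \<psi> where "resolvent_kernel (real CARD('n) / 2 - 1) s C \<psi>"
proof -
  interpret gegenbauer_bounded "real CARD('n) / 2 - 1" by (rule gegenbauer_bounded_sphere[OF d])
  show thesis
  proof (rule resolvent_multiplier_laplace[OF s nu_pos])
    fix \<psi> C
    assume "\<psi> \<in> borel_measurable borel" "\<And>u. u \<le> 0 \<Longrightarrow> \<psi> u = 0"
      "integrable lborel (\<lambda>u. \<psi> u * exp (- u))"
      "\<And>l::nat. l \<ge> 1 \<Longrightarrow> (\<integral>u. \<psi> u * exp (- (real l * u)) \<partial>lborel)
         = inverse (1 + (real l * (real l + 2 * (real CARD('n) / 2 - 1))) powr s)"
      "\<And>u. 0 < u \<Longrightarrow> u \<le> 1 \<Longrightarrow> \<bar>\<psi> u\<bar> \<le> C * u powr (2 * s - 1)"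
    then show thesis using s by (intro that[of C \<psi>]) (unfold_locales, auto)
  qed
qed

text \<open>The distributional kernel off the diagonal is tested on continuous \<open>f\<close> and
  \<open>g\<close> with disjoint supports: the spectral series of the pairing of \<open>g\<close>
  with \<open>(1 + \<Delta>^s)^(-1) f\<close> must converge to the double integral against
  \<open>K\<close>. Analyticity on the product of spheres is expressed by local analytic extensions
  to the ambient space.\<close>

theorem theorem7p2:
  fixes s :: real
  assumes d3: "CARD('n) \<ge> 3"
    and s_pos: "0 < s"
    and s_le: "s \<le> (real CARD('n) - 1) / 2"
  shows
    "(\<forall>t \<in> {0<..<1}. \<forall>m \<in> sphere (0::real^'n) 1. \<forall>m' \<in> sphere 0 1.
        summable (Kst_term s t m m'))
     \<and> (\<exists>K :: real^'n \<Rightarrow> real^'n \<Rightarrow> real.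
          (\<forall>m \<in> sphere 0 1. \<forall>m' \<in> sphere 0 1. m \<noteq> m' \<longrightarrow>
              ((\<lambda>t. Kst s t m m') \<longlongrightarrow> K m m') (at_left 1))
        \<and> (\<forall>f g :: real^'n \<Rightarrow> real.
              continuous_on (sphere 0 1) f \<longrightarrow> continuous_on (sphere 0 1) g \<longrightarrow>
              sphere_support f \<inter> sphere_support g = {} \<longrightarrow>
              (\<lambda>l. inverse (1 + sph_eigen CARD('n) l powr s) *
                     sphere_integral (\<lambda>m. g m * sphere_integral (\<lambda>m'. proj_kernel l m m' * f m')))
                sums sphere_integral (\<lambda>m. g m * sphere_integral (\<lambda>m'. K m m' * f m')))
        \<and> (\<forall>p \<in> sphere 0 1. \<forall>q \<in> sphere 0 1. p \<noteq> q \<longrightarrow>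
              (\<exists>F :: (real^'n) \<times> (real^'n) \<Rightarrow> real. \<exists>r > 0. real_analytic_at F (p, q) \<and>
                 (\<forall>x \<in> sphere 0 1. \<forall>y \<in> sphere 0 1.
                     dist (x, y) (p, q) < r \<longrightarrow> F (x, y) = K x y)))
        \<and> (2 * s < real CARD('n) - 1 \<longrightarrow>
              (\<forall>m \<in> sphere 0 1. (\<lambda>m'. K m m') \<in>
                 O[at m within sphere 0 1](\<lambda>m'. norm (m - m') powr (2 * s - real CARD('n) + 1))))
        \<and> (2 * s = real CARD('n) - 1 \<longrightarrow>
              (\<forall>m \<in> sphere 0 1. (\<lambda>m'. K m m') \<in>
                 O[at m within sphere 0 1](\<lambda>m'. \<bar>ln (norm (m - m'))\<bar>))))"
proof -
  define \<nu> where "\<nu> = real CARD('n) / 2 - 1"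
  obtain C \<psi> where "resolvent_kernel \<nu> s C \<psi>"
    using resolvent_kernel_exists[OF d3 s_pos] unfolding \<nu>_def by blast
  then interpret resolvent_kernel \<nu> s C \<psi> .
  define \<kappa> where "\<kappa> = 1 / (sphere_area CARD('n) * \<nu>)"
  \<comment> \<open>The kernel is the Laplace integral taken at \<open>t = 1\<close>; that it is the
    Abel limit is shown afterwards in \<open>lim\<close>.\<close>
  define K where "K m m' = \<kappa> * resolvent_fun 1 (m \<bullet> m')" for m m' :: "real^'n"
  have mult: "inverse (1 + sph_eigen CARD('n) l powr s) = multiplier l" for l
  proof -
    have "sph_eigen CARD('n) l = real l * (real l + 2 * \<nu>)"
      by (simp add: sph_eigen_def \<nu>_def algebra_simps)
    then show ?thesis by (simp only: multiplier_def)
  qed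
  have proj: "proj_kernel l m m' = \<kappa> * proj_fun l (m \<bullet> m')" for l and m m' :: "real^'n"
    unfolding proj_fun_def \<kappa>_def unfolding \<nu>_def by (rule proj_kernel_eq[OF d3])
  have sums: "Kst_term s t m m' sums (\<kappa> * resolvent_fun t (m \<bullet> m'))"
    if "0 \<le> t" "t < 1" "norm m = 1" "norm m' = 1" for t and m m' :: "real^'n"
  proof -
    have "(\<lambda>l. \<kappa> * (multiplier l * t ^ l * proj_fun l (m \<bullet> m'))) sums (\<kappa> * resolvent_fun t (m \<bullet> m'))"
      using resolvent_sums[OF that(1,2) abs_inner_unit_le[OF that(3,4)]]
      unfolding multiplier_def proj_fun_def by (rule sums_mult)
    then show ?thesis by (simp add: Kst_term_def[abs_def] mult proj mult.left_commute)
  qed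
  have lt1: "m \<bullet> m' < 1" if "norm m = 1" "norm m' = 1" "m \<noteq> m'" for m m' :: "real^'n"
    using that inner_unit_dist[OF that(1,2)] by simp
  have lim: "((\<lambda>t. Kst s t m m') \<longlongrightarrow> K m m') (at_left 1)"
    if m: "norm m = 1" "norm m' = 1" "m \<noteq> m'" for m m' :: "real^'n"
  proof (rule Lim_transform_eventually)
    show "((\<lambda>t. \<kappa> * resolvent_fun t (m \<bullet> m')) \<longlongrightarrow> K m m') (at_left 1)"
      unfolding K_def by (intro tendsto_intros resolvent_fun_tendsto abs_inner_unit_le lt1 m)
    show "eventually (\<lambda>t. \<kappa> * resolvent_fun t (m \<bullet> m') = Kst s t m m') (at_left 1)"
      by (rule eventually_at_leftI[of 0]) (use sums[OF _ _ m(1,2)] in \<open>auto simp: Kst_def sums_iff\<close>)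
  qed
  have e: "2 * s - real CARD('n) + 1 = 2 * s - 2 * \<nu> - 1" "real CARD('n) - 1 = 2 * \<nu> + 1"
    by (simp_all add: \<nu>_def)
  show ?thesis
  proof (intro conjI exI[of _ K])
    show "\<forall>t\<in>{0<..<1}. \<forall>m\<in>sphere (0::real^'n) 1. \<forall>m'\<in>sphere 0 1. summable (Kst_term s t m m')"
    proof (intro ballI)
      fix t :: real and m m' :: "real^'n"
      assume "t \<in> {0<..<1}" "m \<in> sphere 0 1" "m' \<in> sphere 0 1"
      then have "Kst_term s t m m' sums (\<kappa> * resolvent_fun t (m \<bullet> m'))" by (intro sums) auto
      then show "summable (Kst_term s t m m')" by (rule sums_summable)
    qed
    show "\<forall>m\<in>sphere 0 1. \<forall>m'\<in>sphere 0 1. m \<noteq> m' \<longrightarrow> ((\<lambda>t. Kst s t m m') \<longlongrightarrow> K m m') (at_left 1)"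
      using lim by simp
    show "\<forall>f g :: real^'n \<Rightarrow> real. continuous_on (sphere 0 1) f \<longrightarrow> continuous_on (sphere 0 1) g \<longrightarrow>
              sphere_support f \<inter> sphere_support g = {} \<longrightarrow>
              (\<lambda>l. inverse (1 + sph_eigen CARD('n) l powr s) *
                     sphere_integral (\<lambda>m. g m * sphere_integral (\<lambda>m'. proj_kernel l m m' * f m')))
                sums sphere_integral (\<lambda>m. g m * sphere_integral (\<lambda>m'. K m m' * f m'))"
      unfolding mult proj K_def using resolvent_kernel_pairing[OF \<nu>_def d3] by blast
    show "\<forall>p\<in>sphere 0 1. \<forall>q\<in>sphere 0 1. p \<noteq> q \<longrightarrow>
              (\<exists>F :: (real^'n) \<times> (real^'n) \<Rightarrow> real. \<exists>r > 0. real_analytic_at F (p, q) \<and>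
                 (\<forall>x \<in> sphere 0 1. \<forall>y \<in> sphere 0 1.
                     dist (x, y) (p, q) < r \<longrightarrow> F (x, y) = K x y))"
      unfolding K_def by (intro ballI impI resolvent_kernel_analytic) auto
    show "2 * s < real CARD('n) - 1 \<longrightarrow>
              (\<forall>m \<in> sphere 0 1. (\<lambda>m'. K m m') \<in>
                 O[at m within sphere 0 1](\<lambda>m'. norm (m - m') powr (2 * s - real CARD('n) + 1)))"
      unfolding K_def e by (intro ballI impI resolvent_kernel_bigo_power) auto
    show "2 * s = real CARD('n) - 1 \<longrightarrow>
              (\<forall>m \<in> sphere 0 1. (\<lambda>m'. K m m') \<in>
                 O[at m within sphere 0 1](\<lambda>m'. \<bar>ln (norm (m - m'))\<bar>))"
      unfolding K_def e by (intro ballI impI resolvent_kernel_bigo_log) auto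
  qed
qed

end
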